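(* $\mathcal{L}_\infty$ attains its infimum on $M_\infty$, and $\ell_\infty=\lim_{K\to\infty}\ell_K$, where $\ell_K:=\inf_{M_K}\mathcal{L}_K$. Moreover, every sequence $(K_m)_{m\in\mathbb{N}}\subset(0,\infty)$ with $K_m\to\infty$ has a subsequence $(K_n)_{n\in\mathbb{N}}$ for which there exist minimizers $W_n\in M_{K_n}$ of $\mathcal{L}_{K_n}|_{M_{K_n}}$ (periodic ground waves) and a minimizer $W_\infty\in M_\infty$ of $\mathcal{L}_\infty|_{M_\infty}$ (a solitary ground wave, solving $\sigma^2W+\mathcal{A}\Psi_q(\mathcal{A}W)=\mathcal{A}\Psi_p(\mathcal{A}W)$ on $\mathbb{R}$) such that $$\|W_\infty-V_n\|_{2,\mathbb{R}}\to0\quad (n\to\infty),$$ where $V_n\in X_\infty$ is defined by $V_n(\varphi)=W_n(\varphi)$ for $\varphi\in I_{K_n}$ and $V_n(\varphi)=0$ for $\varphi\notin I_{K_n}$.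
   Context: Fix $p>2$, $1<q<p$, $\sigma^2>0$. For $K\in(0,\infty)$, $I_K=(-K,K]$ with functions identified with $2K$-periodic functions on $\mathbb{R}$; $I_\infty=\mathbb{R}$; $\|\cdot\|_{r,I_K}$ is the $L^r$ norm over $I_K$. $(\mathcal{A}W)(\varphi)=\int_{\varphi-1/2}^{\varphi+1/2}W(s)\,ds$, $\Psi_r(w)=r\,\mathrm{sgn}(w)|w|^{r-1}$. $X_K=\{W\in L^2(I_K):\mathcal{A}W\in L^q(I_K)\cap L^p(I_K)\}$, $\mathcal{Q}_K(W)=\int_{I_K}|\mathcal{A}W|^q$, $\mathcal{P}_K(W)=\int_{I_K}|\mathcal{A}W|^p$, $\mathcal{L}_K(W)=\tfrac12\sigma^2\|W\|_{2,I_K}^2+\mathcal{Q}_K(W)-\mathcal{P}_K(W)$, $\mathcal{F}_K(W)=\sigma^2\|W\|_{2,I_K}^2+q\mathcal{Q}_K(W)-p\mathcal{P}_K(W)$, $M_K=\{W\in X_K:W\ne0,\ \mathcal{F}_K(W)=0\}$. *)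

theory Defs
  imports "HOL-Analysis.Analysis"
begin

text \<open>K ranges over (0,\<infinity>] as an extended real; I_K = (-K,K] (= the whole real line for K = \<infinity>).
For finite K, functions on I_K are represented by their 2K-periodic extensions to the real line.\<close>

definition IK :: "ereal \<Rightarrow> real set" where
  "IK K = {x::real. - K < ereal x \<and> ereal x \<le> K}"

definition inLr :: "real \<Rightarrow> real set \<Rightarrow> (real \<Rightarrow> real) \<Rightarrow> bool" where
  "inLr r S f \<longleftrightarrow> f \<in> borel_measurable lborel \<and> set_integrable lborel S (\<lambda>x. \<bar>f x\<bar> powr r)"

definition normLr :: "real \<Rightarrow> real set \<Rightarrow> (real \<Rightarrow> real) \<Rightarrow> real" where
  "normLr r S f = (\<integral>x\<in>S. \<bar>f x\<bar> powr r \<partial>lborel) powr (1 / r)"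

definition avgop :: "(real \<Rightarrow> real) \<Rightarrow> real \<Rightarrow> real" where
  "avgop W \<phi> = (\<integral>s\<in>{\<phi> - 1/2 .. \<phi> + 1/2}. W s \<partial>lborel)"

definition Psi :: "real \<Rightarrow> real \<Rightarrow> real" where
  "Psi r w = r * sgn w * \<bar>w\<bar> powr (r - 1)"

definition periodicK :: "ereal \<Rightarrow> (real \<Rightarrow> real) \<Rightarrow> bool" where
  "periodicK K W \<longleftrightarrow> (\<forall>k. K = ereal k \<longrightarrow> (\<forall>x. W (x + 2 * k) = W x))"

definition XK :: "real \<Rightarrow> real \<Rightarrow> ereal \<Rightarrow> (real \<Rightarrow> real) set" where
  "XK p q K = {W. periodicK K W \<and> inLr 2 (IK K) W
                 \<and> inLr q (IK K) (avgop W) \<and> inLr p (IK K) (avgop W)}"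

definition QK :: "real \<Rightarrow> ereal \<Rightarrow> (real \<Rightarrow> real) \<Rightarrow> real" where
  "QK q K W = (\<integral>x\<in>IK K. \<bar>avgop W x\<bar> powr q \<partial>lborel)"

definition PK :: "real \<Rightarrow> ereal \<Rightarrow> (real \<Rightarrow> real) \<Rightarrow> real" where
  "PK p K W = (\<integral>x\<in>IK K. \<bar>avgop W x\<bar> powr p \<partial>lborel)"

definition LK :: "real \<Rightarrow> real \<Rightarrow> real \<Rightarrow> ereal \<Rightarrow> (real \<Rightarrow> real) \<Rightarrow> real" where
  "LK p q \<sigma>2 K W = 1/2 * \<sigma>2 * (normLr 2 (IK K) W)\<^sup>2 + QK q K W - PK p K W"

definition FK :: "real \<Rightarrow> real \<Rightarrow> real \<Rightarrow> ereal \<Rightarrow> (real \<Rightarrow> real) \<Rightarrow> real" where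
  "FK p q \<sigma>2 K W = \<sigma>2 * (normLr 2 (IK K) W)\<^sup>2 + q * QK q K W - p * PK p K W"

text \<open>W \<noteq> 0 as an element of L^2(I_K): W is not almost everywhere zero on I_K.\<close>
definition MK :: "real \<Rightarrow> real \<Rightarrow> real \<Rightarrow> ereal \<Rightarrow> (real \<Rightarrow> real) set" where
  "MK p q \<sigma>2 K = {W \<in> XK p q K. \<not> (AE x\<in>IK K in lborel. W x = 0) \<and> FK p q \<sigma>2 K W = 0}"

definition ellK :: "real \<Rightarrow> real \<Rightarrow> real \<Rightarrow> ereal \<Rightarrow> real" where
  "ellK p q \<sigma>2 K = Inf (LK p q \<sigma>2 K ` MK p q \<sigma>2 K)"

definition is_minimizer :: "real \<Rightarrow> real \<Rightarrow> real \<Rightarrow> ereal \<Rightarrow> (real \<Rightarrow> real) \<Rightarrow> bool" where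
  "is_minimizer p q \<sigma>2 K W \<longleftrightarrow> W \<in> MK p q \<sigma>2 K \<and> (\<forall>U \<in> MK p q \<sigma>2 K. LK p q \<sigma>2 K W \<le> LK p q \<sigma>2 K U)"

end

theory Submission
  imports Defs "HOL-Complex_Analysis.Great_Picard" "HOL-Real_Asymp.Real_Asymp"
begin

text \<open>On the Nehari set the functional \<open>\<L>\<^sub>K\<close> equals
\<open>J = (1/2 - 1/p) \<sigma>\<^sup>2 \<parallel>W\<parallel>\<^sup>2 + (1 - q/p) \<Q>\<^sub>K\<close>, which has positive coefficients, and every
\<open>W \<noteq> 0\<close> with \<open>\<F>\<^sub>K W \<le> 0\<close> is mapped into the Nehari set by a factor \<open>t \<le> 1\<close>; hence \<open>\<ell>\<^sub>K\<close> is the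
infimum of \<open>J\<close> over \<open>\<F>\<^sub>K \<le> 0\<close>. Weak compactness is never used. For finite \<open>K\<close>, the averages of a minimizing
sequence converge pointwise along a subsequence, and a midpoint argument then makes the sequence itself Cauchy in
\<open>L\<^sup>2\<close>. A minimizer satisfies \<open>\<sigma>\<^sup>2 W = \<A> \<Psi>\<^sub>p(\<A> W) - \<A> \<Psi>\<^sub>q(\<A> W)\<close>, so for \<open>K \<rightarrow> \<infinity>\<close> pointwise convergence
of the averages forces pointwise convergence of the minimizers themselves. Translating so that
\<open>\<bar>\<A> W(0)\<bar>\<close> stays away from zero, the limit is nonzero and solves the same equation, so it lies in \<open>M\<^sub>\<infinity>\<close>; Fatou's
lemma and \<open>limsup \<ell>\<^sub>K \<le> \<ell>\<^sub>\<infinity>\<close> (truncate and periodize) show that no part of \<open>J\<close> is lost, which upgrades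
pointwise to strong convergence. Only \<open>K \<ge> 1\<close> is ever considered, since small periods can be discarded.\<close>

section \<open>Integration over the period cell\<close>

text \<open>\<open>LK\<close>, \<open>FK\<close> and \<open>J\<close> see \<open>W\<close> only
  through its squared norm and its average. On a finite cell the averages of a bounded sequence are
  compact, so the norm is the one term that may fail to converge, and it enters \<open>FK\<close>
  and \<open>J\<close> with the same sign. Hence a drop of the norm at midpoints contradicts
  minimality over \<open>FK <= 0\<close>. On the line two obstacles appear. Compactness of the
  averages is only local there, which is why the constraint for the limit is recovered from its
  equation and not from convergence of the functionals. Moreover \<open>q\<close> may lie below 2:
  then finiteness of \<open>QK q\<close> does not follow from square integrability, and
  \<open>Psi q (avgop W)\<close> need not be square integrable. So self-adjointness of averaging is
  stated for a bounded and an integrable factor, and errors of a cut-off are measured by the L2 mass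
  near and beyond the cut, spread over two unit intervals. The bound \<open>1 <= K\<close> makes a
  unit window fit into one period cell, so that local norms are bounded by global ones with constant
  1, uniformly in \<open>K\<close>.\<close>

definition mu :: "ereal \<Rightarrow> real measure" where
  "mu K = restrict_space lborel (IK K)"

text \<open>Polymorphic in the codomain, so that the translation lemmas also serve integrands with
  values in \<open>ennreal\<close>; for \<open>K = \<infinity>\<close> no condition is
  imposed.\<close>

definition per :: "ereal \<Rightarrow> (real \<Rightarrow> 'a) \<Rightarrow> bool" where
  "per K f \<longleftrightarrow> (\<forall>k. K = ereal k \<longrightarrow> (\<forall>x. f (x + 2 * k) = f x))"

lemma IK_ereal [simp]: "IK (ereal k) = {-k<..k}"
  by (auto simp: IK_def)

lemma IK_PInf [simp]: "IK \<infinity> = UNIV"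
  by (auto simp: IK_def)

lemma IK_borel [measurable]: "IK K \<in> sets borel"
proof (cases K)
  case MInf
  then have "IK K = {}" by (auto simp: IK_def)
  then show ?thesis by simp
qed auto

lemma space_mu [simp]: "space (mu K) = IK K"
  by (simp add: mu_def space_restrict_space)

lemma measurable_mu [measurable (raw)]: "f \<in> measurable borel N \<Longrightarrow> f \<in> measurable (mu K) N"
  unfolding mu_def by (rule measurable_restrict_space1) simp

lemma mu_PInf: "mu \<infinity> = lborel"
  by (rule measure_eqI) (auto simp: mu_def sets_restrict_space emeasure_restrict_space)

lemma set_lebesgue_integral_mu: "(LINT x:IK K|lborel. f x) = (\<integral>x. f x \<partial>mu K)"
  for f :: "real \<Rightarrow> real"
  unfolding mu_def set_lebesgue_integral_def by (subst integral_restrict_space) auto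

lemma set_integrable_mu: "set_integrable lborel (IK K) f \<longleftrightarrow> integrable (mu K) f"
  for f :: "real \<Rightarrow> real"
  unfolding mu_def set_integrable_def by (subst integrable_restrict_space) auto

lemma nn_integral_mu: "(\<integral>\<^sup>+x. f x \<partial>mu K) = (\<integral>\<^sup>+x. f x * indicator (IK K) x \<partial>lborel)"
  unfolding mu_def by (subst nn_integral_restrict_space) auto

lemma AE_mu: "(AE x in mu K. P x) \<longleftrightarrow> (AE x\<in>IK K in lborel. P x)"
  unfolding mu_def by (subst AE_restrict_space_iff) auto

lemma sigma_finite_mu: "sigma_finite_measure (mu K)"
  unfolding mu_def by (rule sigma_finite_measure_restrict_space) (auto intro: lborel.sigma_finite_measure_axioms)

lemma finite_measure_mu: "finite_measure (mu (ereal k))"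
  unfolding mu_def
  by (rule finite_measureI, cases "k \<ge> 0") (auto simp: emeasure_restrict_space space_restrict_space)

lemma per_int:
  assumes "per (ereal k) f"
  shows "f (x + of_int m * (2 * k)) = f x"
proof -
  have p: "f (x + 2 * k) = f x" for x using assms by (simp add: per_def)
  have n: "f (x + of_nat n * (2 * k)) = f x" for x and n :: nat
  proof (induction n)
    case (Suc n)
    have "f (x + of_nat (Suc n) * (2 * k)) = f (x + of_nat n * (2*k) + 2 * k)"
      by (simp add: algebra_simps)
    then show ?case using p Suc by simp
  qed simp
  show ?thesis
  proof (cases "m \<ge> 0")
    case True
    then show ?thesis using n[of x "nat m"] by simp
  next
    case False
    then show ?thesis using n[of "x + of_int m * (2*k)" "nat (-m)"] by simp
  qed
qed

lemma nn_integral_shift_Ioc: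
  fixes f :: "real \<Rightarrow> ennreal"
  assumes [measurable]: "f \<in> borel_measurable borel"
  shows "(\<integral>\<^sup>+x. f (x + s) * indicator {a<..b} x \<partial>lborel)
    = (\<integral>\<^sup>+x. f x * indicator {a+s<..b+s} x \<partial>lborel)"
proof -
  have "(\<integral>\<^sup>+x. f x * indicator {a+s<..b+s} x \<partial>lborel)
     = ennreal \<bar>1\<bar> * (\<integral>\<^sup>+x. f (s + 1 * x) * indicator {a+s<..b+s} (s + 1 * x) \<partial>lborel)"
    by (rule nn_integral_real_affine) auto
  also have "\<dots> = (\<integral>\<^sup>+x. f (x + s) * indicator {a<..b} x \<partial>lborel)"
    by (auto intro!: nn_integral_cong simp: indicator_def add.commute)
  finally show ?thesis by simp
qed

lemma nn_integral_split_Ioc: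
  fixes f :: "real \<Rightarrow> ennreal"
  assumes [measurable]: "f \<in> borel_measurable borel" and "a \<le> b" "b \<le> c"
  shows "(\<integral>\<^sup>+x. f x * indicator {a<..c} x \<partial>lborel)
    = (\<integral>\<^sup>+x. f x * indicator {a<..b} x \<partial>lborel) + (\<integral>\<^sup>+x. f x * indicator {b<..c} x \<partial>lborel)"
  using assms(2,3)
  by (subst nn_integral_add[symmetric]) (auto intro!: nn_integral_cong simp: indicator_def)

text \<open>A shift between 0 and \<open>2 * k\<close> pushes the cell past its right end; by
  periodicity the overhang equals the piece lost on the left. A general shift is first reduced
  modulo the period. On the line this is translation invariance of Lebesgue measure.\<close>

lemma nn_integral_mu_translate:
  fixes f :: "real \<Rightarrow> ennreal"
  assumes f [measurable]: "f \<in> borel_measurable borel" and per: "per K f" and K: "0 < K"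
  shows "(\<integral>\<^sup>+x. f (x + s) \<partial>mu K) = (\<integral>\<^sup>+x. f x \<partial>mu K)"
proof (cases K)
  case PInf
  have "(\<integral>\<^sup>+x. f x \<partial>lborel) = ennreal \<bar>1\<bar> * (\<integral>\<^sup>+x. f (s + 1 * x) \<partial>lborel)"
    by (rule nn_integral_real_affine) auto
  then show ?thesis by (simp add: PInf mu_PInf add.commute)
next
  case (real k)
  then have k: "k > 0" using K by simp
  have p: "f (x + 2 * k) = f x" for x using per by (simp add: per_def real)
  have base: "(\<integral>\<^sup>+x. f (x + s) * indicator {-k<..k} x \<partial>lborel) = (\<integral>\<^sup>+x. f x * indicator {-k<..k} x \<partial>lborel)"
    if s: "0 \<le> s" "s \<le> 2 * k" for s
  proof -
    have "(\<integral>\<^sup>+x. f (x + s) * indicator {-k<..k} x \<partial>lborel) = (\<integral>\<^sup>+x. f x * indicator {-k+s<..k+s} x \<partial>lborel)"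
      by (rule nn_integral_shift_Ioc) simp
    also have "\<dots> = (\<integral>\<^sup>+x. f x * indicator {-k+s<..k} x \<partial>lborel) + (\<integral>\<^sup>+x. f x * indicator {k<..k+s} x \<partial>lborel)"
      using s by (intro nn_integral_split_Ioc) auto
    also have "(\<integral>\<^sup>+x. f x * indicator {k<..k+s} x \<partial>lborel) = (\<integral>\<^sup>+x. f x * indicator {-k+2*k<..-k+s+2*k} x \<partial>lborel)"
      by (auto intro!: nn_integral_cong simp: indicator_def)
    also have "\<dots> = (\<integral>\<^sup>+x. f (x + 2 * k) * indicator {-k<..-k+s} x \<partial>lborel)"
      by (rule nn_integral_shift_Ioc[symmetric]) simp
    also have "\<dots> = (\<integral>\<^sup>+x. f x * indicator {-k<..-k+s} x \<partial>lborel)" by (simp add: p)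
    finally show ?thesis using s nn_integral_split_Ioc[of f "-k" "-k+s" k] by (simp add: add.commute)
  qed
  define m where "m = \<lfloor>s / (2 * k)\<rfloor>"
  define t where "t = s - of_int m * (2 * k)"
  have "of_int m \<le> s / (2*k)" "s / (2*k) < of_int m + 1" by (auto simp: m_def)
  then have t: "0 \<le> t" "t \<le> 2 * k" using k by (auto simp: t_def field_simps)
  have "f (x + s) = f (x + t)" for x
    using per_int[of k f "x + t" m] per real by (simp add: t_def)
  then show ?thesis using base[OF t] by (simp add: nn_integral_mu real)
next
  case MInf
  then show ?thesis using K by simp
qed

lemma integral_mu_translate:
  fixes f :: "real \<Rightarrow> real"
  assumes f [measurable]: "f \<in> borel_measurable borel" and per: "per K f" and K: "0 < K"
  shows "integrable (mu K) (\<lambda>x. f (x + s)) \<longleftrightarrow> integrable (mu K) f"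
    and "(\<integral>x. f (x + s) \<partial>mu K) = (\<integral>x. f x \<partial>mu K)"
proof -
  have tr: "(\<integral>\<^sup>+x. g (f (x + s)) \<partial>mu K) = (\<integral>\<^sup>+x. g (f x) \<partial>mu K)"
    if [measurable]: "g \<in> borel_measurable borel" for g :: "real \<Rightarrow> ennreal"
    using nn_integral_mu_translate[of "\<lambda>x. g (f x)" K s] per K by (auto simp: per_def)
  show 1: "integrable (mu K) (\<lambda>x. f (x + s)) \<longleftrightarrow> integrable (mu K) f"
    using tr[of "\<lambda>y. ennreal (norm y)"] by (simp add: integrable_iff_bounded)
  show "(\<integral>x. f (x + s) \<partial>mu K) = (\<integral>x. f x \<partial>mu K)"
  proof (cases "integrable (mu K) f")
    case True
    then show ?thesis
      using 1 tr[of "\<lambda>y. ennreal y"] tr[of "\<lambda>y. ennreal (-y)"] by (simp add: real_lebesgue_integral_def)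
  next
    case False
    then show ?thesis using 1 by (simp add: not_integrable_integral_eq)
  qed
qed

section \<open>The averaging operator\<close>

lemma integrable_mult_sq:
  fixes f g :: "'a \<Rightarrow> real"
  assumes [measurable]: "f \<in> borel_measurable M" "g \<in> borel_measurable M"
    and f: "integrable M (\<lambda>x. (f x)\<^sup>2)" and g: "integrable M (\<lambda>x. (g x)\<^sup>2)"
  shows "integrable M (\<lambda>x. f x * g x)"
proof (rule Bochner_Integration.integrable_bound[OF Bochner_Integration.integrable_add[OF f g]])
  have "2 * \<bar>a * b\<bar> \<le> a\<^sup>2 + b\<^sup>2" for a b :: real
    using sum_squares_bound[of "\<bar>a\<bar>" "\<bar>b\<bar>"] by (simp add: abs_mult power2_eq_square)
  then have "\<bar>a * b\<bar> \<le> a\<^sup>2 + b\<^sup>2" for a b :: real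
    by (smt (verit, best) zero_le_power2)
  then show "AE x in M. norm (f x * g x) \<le> norm ((f x)\<^sup>2 + (g x)\<^sup>2)" by simp
qed simp

lemma integrable_add_sq:
  fixes f g :: "'a \<Rightarrow> real"
  assumes [measurable]: "f \<in> borel_measurable M" "g \<in> borel_measurable M"
    and f: "integrable M (\<lambda>x. (f x)\<^sup>2)" and g: "integrable M (\<lambda>x. (g x)\<^sup>2)"
  shows "integrable M (\<lambda>x. (f x + g x)\<^sup>2)"
  using integrable_mult_sq[OF assms] f g by (simp add: power2_sum mult.assoc)

lemma Cauchy_Schwarz_integral:
  fixes f g :: "'a \<Rightarrow> real"
  assumes [measurable]: "f \<in> borel_measurable M" "g \<in> borel_measurable M"
    and f: "integrable M (\<lambda>x. (f x)\<^sup>2)" and g: "integrable M (\<lambda>x. (g x)\<^sup>2)"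
  shows "(\<integral>x. f x * g x \<partial>M)\<^sup>2 \<le> (\<integral>x. (f x)\<^sup>2 \<partial>M) * (\<integral>x. (g x)\<^sup>2 \<partial>M)"
proof -
  note fg = integrable_mult_sq[OF assms]
  define a b c where "a = (\<integral>x. (f x)\<^sup>2 \<partial>M)" and "b = (\<integral>x. f x * g x \<partial>M)" and "c = (\<integral>x. (g x)\<^sup>2 \<partial>M)"
  have q: "0 \<le> a - 2 * t * b + t\<^sup>2 * c" for t
  proof -
    have "0 \<le> (\<integral>x. (f x - t * g x)\<^sup>2 \<partial>M)" by simp
    also have "(\<lambda>x. (f x - t * g x)\<^sup>2) = (\<lambda>x. (f x)\<^sup>2 - 2 * t * (f x * g x) + t\<^sup>2 * (g x)\<^sup>2)"
      by (simp add: power2_eq_square algebra_simps)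
    also have "(\<integral>x. (f x)\<^sup>2 - 2 * t * (f x * g x) + t\<^sup>2 * (g x)\<^sup>2 \<partial>M) = a - 2 * t * b + t\<^sup>2 * c"
      using f g fg by (simp add: a_def b_def c_def)
    finally show ?thesis .
  qed
  have c0: "0 \<le> c" by (simp add: c_def)
  show ?thesis
  proof (cases "c = 0")
    case True
    have "b = 0"
    proof (rule ccontr)
      assume "b \<noteq> 0"
      \<comment> \<open>For \<open>c = 0\<close> the quadratic in \<open>t\<close> is affine, and
        this \<open>t\<close> gives it the value -1.\<close>
      then show False using q[of "(a + 1) / (2 * b)"] True by (simp add: field_simps)
    qed
    then show ?thesis using True by (simp add: b_def c_def)
  next
    case False
    then have "c > 0" using c0 by simp
    then have "b\<^sup>2 \<le> a * c" using q[of "b / c"] by (simp add: field_simps power2_eq_square)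
    then show ?thesis by (simp add: a_def b_def c_def)
  qed
qed

text \<open>Averaging becomes integration against a fixed probability measure, with the translation
  moved into the integrand; Cauchy-Schwarz, Fubini and dominated convergence then apply
  directly.\<close>

definition win :: "real measure" where
  "win = restrict_space lborel {-1/2..1/2}"

lemma space_win [simp]: "space win = {-1/2..1/2}"
  by (simp add: win_def space_restrict_space)

lemma measurable_win [measurable (raw)]: "f \<in> measurable borel N \<Longrightarrow> f \<in> measurable win N"
  unfolding win_def by (rule measurable_restrict_space1) simp

lemma emeasure_win [simp]: "emeasure win {-1/2..1/2} = 1" "emeasure win {- (1/2)..1/2} = 1"
  by (simp_all add: win_def emeasure_restrict_space)

lemma finite_measure_win: "finite_measure win"
  by (rule finite_measureI) simp

lemma sigma_finite_win: "sigma_finite_measure win"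
  using finite_measure_win by (simp add: finite_measure_def)

lemma integrable_const_win [simp]: "integrable win (\<lambda>x. c :: real)"
  using finite_measure.integrable_const[OF finite_measure_win] .

lemma integral_const_win [simp]: "(\<integral>x. c \<partial>win) = (c :: real)"
  by (simp add: measure_def)

lemma measure_win [simp]: "measure win {- (1/2)..1/2} = 1"
  by (simp add: measure_def)

lemma nn_integral_win: "(\<integral>\<^sup>+x. f x \<partial>win) = (\<integral>\<^sup>+x. f x * indicator {-1/2..1/2} x \<partial>lborel)"
  unfolding win_def by (subst nn_integral_restrict_space) auto

lemma integral_win: "(\<integral>x. f x \<partial>win) = (\<integral>x. indicator {-1/2..1/2} x * f x \<partial>lborel)"
  for f :: "real \<Rightarrow> real"
  unfolding win_def by (subst integral_restrict_space) auto

lemma avgop_win: "avgop W x = (\<integral>s. W (x + s) \<partial>win)"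
proof -
  have "avgop W x = \<bar>1\<bar> *\<^sub>R (\<integral>s. indicator {x-1/2..x+1/2} (x + 1 * s) *\<^sub>R W (x + 1 * s) \<partial>lborel)"
    unfolding avgop_def set_lebesgue_integral_def by (rule lborel_integral_real_affine) simp
  also have "\<dots> = (\<integral>s. W (x + s) \<partial>win)"
    unfolding integral_win by (auto intro!: Bochner_Integration.integral_cong simp: indicator_def)
  finally show ?thesis .
qed

lemma avgop_measurable [measurable (raw)]:
  assumes [measurable]: "W \<in> borel_measurable borel"
  shows "avgop W \<in> borel_measurable borel"
proof -
  interpret sigma_finite_measure win by (rule sigma_finite_win)
  have [measurable]: "(\<lambda>(x, s). W (x + s)) \<in> borel_measurable (borel \<Otimes>\<^sub>M win)"
  proof -
    have "(\<lambda>s. s) \<in> measurable win borel" by measurable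
    then show ?thesis by measurable
  qed
  have "(\<lambda>x. \<integral>s. W (x + s) \<partial>win) \<in> borel_measurable borel"
    by measurable
  then show ?thesis by (simp add: avgop_win[abs_def])
qed

lemma avgop_per: "per K W \<Longrightarrow> per K (avgop W)"
  unfolding per_def avgop_win by (auto intro!: Bochner_Integration.integral_cong) (metis add.commute add.left_commute)

lemma avgop_cmult: "avgop (\<lambda>x. c * W x) x = c * avgop W x"
  unfolding avgop_win by simp

text \<open>The window \<open>{-1/2..1/2}\<close> lies in the cell because \<open>1 <= K\<close>, so
  the shifted function is integrated over a part of the cell only; translation invariance then
  removes the shift.\<close>

lemma nn_integral_win_le:
  fixes f :: "real \<Rightarrow> ennreal"
  assumes [measurable]: "f \<in> borel_measurable borel" and per: "per K f" and K: "1 \<le> K"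
  shows "(\<integral>\<^sup>+s. f (x + s) \<partial>win) \<le> (\<integral>\<^sup>+s. f s \<partial>mu K)"
proof -
  have sub: "{-1/2..1/2} \<subseteq> IK K"
  proof (cases K)
    case (real k)
    then show ?thesis using K by auto
  next
    case MInf
    then show ?thesis using K by simp
  qed auto
  have "(\<integral>\<^sup>+s. f (x + s) \<partial>win) \<le> (\<integral>\<^sup>+s. f (s + x) \<partial>mu K)"
    unfolding nn_integral_mu nn_integral_win
    using sub by (intro nn_integral_mono) (auto simp: indicator_def add.commute)
  also have "\<dots> = (\<integral>\<^sup>+s. f s \<partial>mu K)"
    using K by (intro nn_integral_mu_translate per) (auto intro: less_le_trans[of 0 1])
  finally show ?thesis .
qed

section \<open>Periodic square-integrable functions and their averages\<close>

definition L2 :: "ereal \<Rightarrow> (real \<Rightarrow> real) \<Rightarrow> bool" where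
  "L2 K W \<longleftrightarrow> W \<in> borel_measurable borel \<and> per K W \<and> integrable (mu K) (\<lambda>x. (W x)\<^sup>2)"

definition nsq :: "ereal \<Rightarrow> (real \<Rightarrow> real) \<Rightarrow> real" where
  "nsq K W = (\<integral>x. (W x)\<^sup>2 \<partial>mu K)"

lemma L2D: assumes "L2 K W" 
  shows "W \<in> borel_measurable borel" "per K W" "integrable (mu K) (\<lambda>x. (W x)\<^sup>2)"
  using assms by (auto simp: L2_def)

lemma nsq_nonneg [simp]: "0 \<le> nsq K W"
  by (simp add: nsq_def)

lemma per_comp: "per K W \<Longrightarrow> per K (\<lambda>x. g (W x))"
  by (simp add: per_def)

lemma per_comp2: "per K W \<Longrightarrow> per K V \<Longrightarrow> per K (\<lambda>x. g (W x) (V x))"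
  by (simp add: per_def)

lemma L2_add: "L2 K U \<Longrightarrow> L2 K W \<Longrightarrow> L2 K (\<lambda>x. U x + W x)"
  unfolding L2_def by (auto intro!: integrable_add_sq per_comp2[where g="(+)"])

lemma L2_cmult: "L2 K W \<Longrightarrow> L2 K (\<lambda>x. c * W x)"
  unfolding L2_def by (auto simp: power_mult_distrib intro!: per_comp[where g="(*) c"])

lemma nsq_cmult: "nsq K (\<lambda>x. c * W x) = c\<^sup>2 * nsq K W"
  by (simp add: nsq_def power_mult_distrib)

lemma L2_win:
  assumes "L2 K W" "1 \<le> K"
  shows "integrable win (\<lambda>s. (W (x + s))\<^sup>2)" "(\<integral>s. (W (x + s))\<^sup>2 \<partial>win) \<le> nsq K W"
    "integrable win (\<lambda>s. W (x + s))"
proof -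
  note [measurable] = L2D(1)[OF assms(1)]
  have fin: "(\<integral>\<^sup>+s. ennreal ((W s)\<^sup>2) \<partial>mu K) = ennreal (nsq K W)"
    unfolding nsq_def by (rule nn_integral_eq_integral[OF L2D(3)[OF assms(1)]]) simp
  have le: "(\<integral>\<^sup>+s. ennreal ((W (x + s))\<^sup>2) \<partial>win) \<le> ennreal (nsq K W)"
    using nn_integral_win_le[of "\<lambda>s. ennreal ((W s)\<^sup>2)" K x] assms L2D[OF assms(1)] 
    by (simp add: fin per_comp[where g="\<lambda>y. ennreal (y\<^sup>2)"])
  show 1: "integrable win (\<lambda>s. (W (x + s))\<^sup>2)"
    using le by (intro integrableI_bounded) (auto simp: le_less_trans)
  show "(\<integral>s. (W (x + s))\<^sup>2 \<partial>win) \<le> nsq K W"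
    using le nn_integral_eq_integral[OF 1] by simp
  show "integrable win (\<lambda>s. W (x + s))"
    using integrable_mult_sq[of "\<lambda>s. W (x + s)" win "\<lambda>_. 1"] 1 by simp
qed

lemma avgop_add:
  assumes "L2 K U" "L2 K W" "1 \<le> K"
  shows "avgop (\<lambda>x. U x + W x) x = avgop U x + avgop W x"
  unfolding avgop_win using L2_win(3)[OF assms(1,3)] L2_win(3)[OF assms(2,3)] by simp

lemma avgop_diff:
  assumes "L2 K U" "L2 K W" "1 \<le> K"
  shows "avgop (\<lambda>x. U x - W x) x = avgop U x - avgop W x"
  unfolding avgop_win using L2_win(3)[OF assms(1,3)] L2_win(3)[OF assms(2,3)] by simp

lemma avgop_sq_le_win:
  assumes [measurable]: "W \<in> borel_measurable borel" and i: "integrable win (\<lambda>s. (W (x + s))\<^sup>2)"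
  shows "(avgop W x)\<^sup>2 \<le> (\<integral>s. (W (x + s))\<^sup>2 \<partial>win)"
  using Cauchy_Schwarz_integral[of "\<lambda>s. W (x + s)" win "\<lambda>_. 1"] i
  by (simp add: avgop_win)

lemma avgop_sq_le:
  assumes "L2 K W" "1 \<le> K"
  shows "(avgop W x)\<^sup>2 \<le> nsq K W"
  using avgop_sq_le_win[OF L2D(1)[OF assms(1)] L2_win(1)[OF assms]] L2_win(2)[OF assms] by (rule order_trans)

text \<open>Averaging maps L2 into bounded functions with constant 1, uniformly in \<open>K\<close>.
  The constants that dominate averages in the later limits come from here.\<close>

lemma avgop_le:
  assumes "L2 K W" "1 \<le> K"
  shows "\<bar>avgop W x\<bar> \<le> sqrt (nsq K W)"
  using avgop_sq_le[OF assms] by (simp add: real_le_rsqrt)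

text \<open>Averaging is a contraction in L2: Cauchy-Schwarz on each window, then Tonelli, then
  every translate integrates to the same value over the cell.\<close>

lemma nn_integral_avgop_sq:
  assumes "L2 K W" "1 \<le> K"
  shows "(\<integral>\<^sup>+x. ennreal ((avgop W x)\<^sup>2) \<partial>mu K) \<le> ennreal (nsq K W)"
proof -
  note [measurable] = L2D(1)[OF assms(1)]
  interpret p: pair_sigma_finite "mu K" win
    by (intro pair_sigma_finite.intro sigma_finite_mu sigma_finite_win)
  have "(\<integral>\<^sup>+x. ennreal ((avgop W x)\<^sup>2) \<partial>mu K) \<le> (\<integral>\<^sup>+x. (\<integral>\<^sup>+s. ennreal ((W (x + s))\<^sup>2) \<partial>win) \<partial>mu K)"
  proof (rule nn_integral_mono)
    fix x
    show "ennreal ((avgop W x)\<^sup>2) \<le> (\<integral>\<^sup>+s. ennreal ((W (x + s))\<^sup>2) \<partial>win)"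
      using avgop_sq_le_win[OF L2D(1)[OF assms(1)] L2_win(1)[OF assms], of x]
      by (subst nn_integral_eq_integral[OF L2_win(1)[OF assms]]) (auto intro: ennreal_leI)
  qed
  also have "\<dots> = (\<integral>\<^sup>+s. (\<integral>\<^sup>+x. ennreal ((W (x + s))\<^sup>2) \<partial>mu K) \<partial>win)"
  proof (rule p.Fubini'[symmetric])
    have "(\<lambda>s. s) \<in> measurable win borel" "(\<lambda>s. s) \<in> measurable (mu K) borel" by measurable
    then show "(\<lambda>(x, s). ennreal ((W (x + s))\<^sup>2)) \<in> borel_measurable (mu K \<Otimes>\<^sub>M win)" by measurable
  qed
  also have "\<dots> = (\<integral>\<^sup>+s. (\<integral>\<^sup>+x. ennreal ((W x)\<^sup>2) \<partial>mu K) \<partial>win)"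
    using assms L2D(2)[OF assms(1)]
    by (intro nn_integral_cong nn_integral_mu_translate per_comp[where g="\<lambda>y. ennreal (y\<^sup>2)"])
       (auto intro: less_le_trans[of 0 1])
  also have "\<dots> = ennreal (nsq K W)"
    using nn_integral_eq_integral[OF L2D(3)[OF assms(1)]] by (simp add: nsq_def)
  finally show ?thesis .
qed

lemma avgop_L2:
  assumes "L2 K W" "1 \<le> K"
  shows "L2 K (avgop W)" "nsq K (avgop W) \<le> nsq K W"
proof -
  note [measurable] = L2D(1)[OF assms(1)]
  have 1: "integrable (mu K) (\<lambda>x. (avgop W x)\<^sup>2)"
    using nn_integral_avgop_sq[OF assms] by (intro integrableI_bounded) (auto simp: le_less_trans)
  then show "L2 K (avgop W)" using L2D[OF assms(1)] by (auto simp: L2_def avgop_per)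
  show "nsq K (avgop W) \<le> nsq K W"
    using nn_integral_eq_integral[OF 1] nn_integral_avgop_sq[OF assms] by (simp add: nsq_def)
qed

text \<open>The kernel is symmetric: transferring the shift from \<open>g\<close> to
  \<open>h\<close> changes \<open>s\<close> into \<open>-s\<close>, and the window is invariant
  under reflection. Boundedness of one factor and integrability of the other make both double
  integrals absolutely convergent, as Fubini demands.\<close>

lemma avgop_selfadjoint:
  assumes [measurable]: "g \<in> borel_measurable borel" "h \<in> borel_measurable borel"
    and per: "per K g" "per K h" and K: "0 < K"
    and bd: "\<And>x. \<bar>g x\<bar> \<le> C" and h: "integrable (mu K) h"
  shows "(\<integral>x. h x * avgop g x \<partial>mu K) = (\<integral>x. g x * avgop h x \<partial>mu K)"
proof -
  interpret p: pair_sigma_finite "mu K" win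
    by (intro pair_sigma_finite.intro sigma_finite_mu sigma_finite_win)
  have [measurable]: "(\<lambda>s. s) \<in> measurable win borel" "(\<lambda>s. s) \<in> measurable (mu K) borel" by measurable
  have C: "0 \<le> C" using bd[of 0] by simp
  have hh: "(\<integral>\<^sup>+x. ennreal \<bar>h x\<bar> \<partial>mu K) = ennreal (\<integral>x. \<bar>h x\<bar> \<partial>mu K)"
    using h by (intro nn_integral_eq_integral) auto
  have i1: "integrable (mu K \<Otimes>\<^sub>M win) (\<lambda>(x, s). h x * g (x + s))"
  proof (rule integrableI_bounded)
    show "(\<lambda>(x, s). h x * g (x + s)) \<in> borel_measurable (mu K \<Otimes>\<^sub>M win)" by measurable
    have "(\<integral>\<^sup>+z. norm (case z of (x, s) \<Rightarrow> h x * g (x + s)) \<partial>(mu K \<Otimes>\<^sub>M win))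
      = (\<integral>\<^sup>+x. \<integral>\<^sup>+s. ennreal \<bar>h x * g (x + s)\<bar> \<partial>win \<partial>mu K)"
      by (subst p.M2.nn_integral_fst[symmetric]) auto
    also have "\<dots> \<le> (\<integral>\<^sup>+x. \<integral>\<^sup>+s. ennreal (C * \<bar>h x\<bar>) \<partial>win \<partial>mu K)"
      by (intro nn_integral_mono ennreal_leI)
         (auto simp: abs_mult mult.commute[of C] intro!: mult_left_mono bd)
    also have "\<dots> = ennreal C * (\<integral>\<^sup>+x. ennreal \<bar>h x\<bar> \<partial>mu K)"
      using C by (simp add: ennreal_mult nn_integral_cmult)
    also have "\<dots> < \<infinity>" by (simp add: hh ennreal_mult_less_top)
    finally show "(\<integral>\<^sup>+z. norm (case z of (x, s) \<Rightarrow> h x * g (x + s)) \<partial>(mu K \<Otimes>\<^sub>M win)) < \<infinity>" .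
  qed
  have i2: "integrable (mu K \<Otimes>\<^sub>M win) (\<lambda>(x, s). g x * h (x + s))"
  proof (rule integrableI_bounded)
    show "(\<lambda>(x, s). g x * h (x + s)) \<in> borel_measurable (mu K \<Otimes>\<^sub>M win)" by measurable
    have "(\<integral>\<^sup>+z. norm (case z of (x, s) \<Rightarrow> g x * h (x + s)) \<partial>(mu K \<Otimes>\<^sub>M win))
      = (\<integral>\<^sup>+s. \<integral>\<^sup>+x. ennreal \<bar>g x * h (x + s)\<bar> \<partial>mu K \<partial>win)"
      by (subst p.nn_integral_snd[symmetric]) auto
    also have "\<dots> \<le> (\<integral>\<^sup>+s. \<integral>\<^sup>+x. ennreal (C * \<bar>h (x + s)\<bar>) \<partial>mu K \<partial>win)"
      by (intro nn_integral_mono ennreal_leI)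
         (auto simp: abs_mult intro!: mult_right_mono bd)
    also have "\<dots> = (\<integral>\<^sup>+s. ennreal C * (\<integral>\<^sup>+x. ennreal \<bar>h x\<bar> \<partial>mu K) \<partial>win)"
      using C K per(2)
      by (simp add: ennreal_mult nn_integral_cmult nn_integral_mu_translate[of "\<lambda>x. ennreal \<bar>h x\<bar>"] 
          per_comp[where g="\<lambda>y. ennreal \<bar>y\<bar>"])
    also have "\<dots> < \<infinity>" by (simp add: hh ennreal_mult_less_top)
    finally show "(\<integral>\<^sup>+z. norm (case z of (x, s) \<Rightarrow> g x * h (x + s)) \<partial>(mu K \<Otimes>\<^sub>M win)) < \<infinity>" .
  qed
  have "(\<integral>x. h x * avgop g x \<partial>mu K) = (\<integral>x. (\<integral>s. h x * g (x + s) \<partial>win) \<partial>mu K)"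
    by (simp add: avgop_win)
  also have "\<dots> = (\<integral>s. (\<integral>x. h x * g (x + s) \<partial>mu K) \<partial>win)"
    by (rule p.Fubini_integral[symmetric]) (rule i1)
  also have "\<dots> = (\<integral>s. (\<integral>x. h (x - s) * g x \<partial>mu K) \<partial>win)"
  proof (rule Bochner_Integration.integral_cong[OF refl])
    fix s
    have "per K (\<lambda>x. h (x - s) * g x)"
      using per unfolding per_def by (metis add_diff_eq diff_add_eq)
    moreover have "(\<lambda>x. h (x - s) * g x) \<in> borel_measurable borel" by measurable
    ultimately have "(\<integral>x. h ((x + s) - s) * g (x + s) \<partial>mu K) = (\<integral>x. h (x - s) * g x \<partial>mu K)"
      using integral_mu_translate(2)[of "\<lambda>x. h (x - s) * g x" K s] K by blast
    then show "(\<integral>x. h x * g (x + s) \<partial>mu K) = (\<integral>x. h (x - s) * g x \<partial>mu K)" by simp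
  qed
  also have "\<dots> = (\<integral>s. (\<integral>x. h (x + s) * g x \<partial>mu K) \<partial>win)"
  proof -
    let ?F = "\<lambda>s. indicator {-1/2..1/2} s * (\<integral>x. h (x + s) * g x \<partial>mu K)"
    have "(\<integral>s. ?F s \<partial>lborel) = \<bar>-1\<bar> *\<^sub>R (\<integral>s. ?F (0 + -1 * s) \<partial>lborel)"
      by (rule lborel_integral_real_affine) simp
    also have "\<dots> = (\<integral>s. indicator {-1/2..1/2} s * (\<integral>x. h (x - s) * g x \<partial>mu K) \<partial>lborel)"
      by (auto intro!: Bochner_Integration.integral_cong simp: indicator_def)
    finally show ?thesis by (simp add: integral_win)
  qed
  also have "\<dots> = (\<integral>x. (\<integral>s. g x * h (x + s) \<partial>win) \<partial>mu K)"
    using p.Fubini_integral[OF i2] by (simp add: mult.commute)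
  also have "\<dots> = (\<integral>x. g x * avgop h x \<partial>mu K)" by (simp add: avgop_win)
  finally show ?thesis .
qed

section \<open>Equicontinuity and completeness\<close>

text \<open>The windows around \<open>x\<close> and \<open>y\<close> share \<open>A\<close>; each of
  the two remainders has length \<open>y - x\<close>, and Cauchy-Schwarz on it gives one of the two
  square roots.\<close>

lemma avgop_equicont:
  assumes W: "L2 K W" "1 \<le> K" and xy: "x \<le> y" "y \<le> x + 1"
  shows "\<bar>avgop W y - avgop W x\<bar> \<le> 2 * sqrt ((y - x) * nsq K W)"
proof -
  note [measurable] = L2D(1)[OF W(1)]
  define A where "A = {y-1/2..x+1/2}"
  have [measurable]: "A \<in> sets borel" by (simp add: A_def)
  have eq: "avgop (\<lambda>z. indicator A z * W z) y = avgop (\<lambda>z. indicator A z * W z) x"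
    unfolding avgop_def set_lebesgue_integral_def using xy
    by (intro Bochner_Integration.integral_cong) (auto simp: A_def indicator_def)
  have rest: "\<bar>avgop W z - avgop (\<lambda>z. indicator A z * W z) z\<bar> \<le> sqrt ((y - x) * nsq K W)"
    if m: "(\<integral>s. (1 - indicator A (z + s))\<^sup>2 \<partial>win) = y - x" for z
  proof -
    have i1: "integrable win (\<lambda>s. (1 - indicator A (z + s) :: real)\<^sup>2)"
      by (rule finite_measure.integrable_const_bound[OF finite_measure_win, of _ 1]) (auto simp: indicator_def)
    have i2: "integrable win (\<lambda>s. indicator A (z + s) * W (z + s))"
      by (rule Bochner_Integration.integrable_bound[OF L2_win(3)[OF W, of z]]) (auto simp: indicator_def)
    have "avgop W z - avgop (\<lambda>z. indicator A z * W z) z = (\<integral>s. (1 - indicator A (z + s)) * W (z + s) \<partial>win)"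
      using i2 L2_win(3)[OF W, of z] by (simp add: avgop_win algebra_simps)
    moreover have "(\<integral>s. (1 - indicator A (z + s)) * W (z + s) \<partial>win)\<^sup>2 \<le> (y - x) * nsq K W"
    proof (rule order_trans)
      show "(\<integral>s. (1 - indicator A (z + s)) * W (z + s) \<partial>win)\<^sup>2
          \<le> (\<integral>s. (1 - indicator A (z + s))\<^sup>2 \<partial>win) * (\<integral>s. (W (z + s))\<^sup>2 \<partial>win)"
        by (rule Cauchy_Schwarz_integral[OF _ _ i1 L2_win(1)[OF W, of z]]) simp_all
      show "(\<integral>s. (1 - indicator A (z + s))\<^sup>2 \<partial>win) * (\<integral>s. (W (z + s))\<^sup>2 \<partial>win) \<le> (y - x) * nsq K W"
        unfolding m using L2_win(2)[OF W, of z] xy by (intro mult_left_mono) auto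
    qed
    ultimately show ?thesis by (simp add: real_le_rsqrt)
  qed
  have my: "(\<integral>s. (1 - indicator A (y + s) :: real)\<^sup>2 \<partial>win) = y - x"
  proof -
    have "(\<integral>s. (1 - indicator A (y + s) :: real)\<^sup>2 \<partial>win) = (\<integral>s. indicator {x-y+1/2<..1/2} s \<partial>lborel)"
      unfolding integral_win using xy
      by (intro Bochner_Integration.integral_cong) (auto simp: A_def indicator_def)
    then show ?thesis using xy by simp
  qed
  have mx: "(\<integral>s. (1 - indicator A (x + s) :: real)\<^sup>2 \<partial>win) = y - x"
  proof -
    have "(\<integral>s. (1 - indicator A (x + s) :: real)\<^sup>2 \<partial>win) = (\<integral>s. indicator {-1/2..<y-x-1/2} s \<partial>lborel)"
      unfolding integral_win using xy
      by (intro Bochner_Integration.integral_cong) (auto simp: A_def indicator_def)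
    then show ?thesis using xy by simp
  qed
  show ?thesis using rest[OF mx] rest[OF my] eq by linarith
qed

text \<open>Arzela-Ascoli: a diagonal sequence converges on the rationals, and equicontinuity
  carries this to all points. The period may vary with \<open>n\<close>, so one statement serves a
  fixed cell as well as growing cells.\<close>

lemma avgop_convergent_subseq:
  assumes W: "\<And>n. L2 (K n) (W n)" "\<And>n. 1 \<le> K n" and B: "\<And>n. nsq (K n) (W n) \<le> B"
  obtains r :: "nat \<Rightarrow> nat" where "strict_mono r" "\<And>x. convergent (\<lambda>n. avgop (W (r n)) x)"
proof -
  have B0: "0 \<le> B" using B[of 0] nsq_nonneg order_trans by blast
  have "norm (avgop (W n) x) \<le> sqrt B" for n x
    using avgop_le[OF W(1) W(2), of n x] B[of n] by (simp add: order_trans)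
  then obtain r :: "nat \<Rightarrow> nat" where r: "strict_mono r" 
    and conv: "\<And>x. x \<in> \<rat> \<Longrightarrow> \<exists>l. (\<lambda>n. avgop (W (r n)) x) \<longlonglongrightarrow> l"
    using function_convergent_subsequence[of "\<rat>" "\<lambda>n. avgop (W n)" "sqrt B"] countable_rat by metis
  have "Cauchy (\<lambda>n. avgop (W (r n)) x)" for x
  proof (rule metric_CauchyI)
    fix e :: real assume e: "e > 0"
    \<comment> \<open>Equicontinuity then contributes at most
      \<open>2 * sqrt (d * (B + 1)) <= e / 4\<close>; \<open>B + 1\<close> keeps the quotient
      meaningful for \<open>B = 0\<close>.\<close>
    define d where "d = min 1 ((e / 8)\<^sup>2 / (B + 1))"
    have d: "0 < d" "d \<le> 1" "d * (B + 1) \<le> (e/8)\<^sup>2"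
    proof -
      show "0 < d" "d \<le> 1" using e B0 by (auto simp: d_def)
      have "d * (B + 1) \<le> (e / 8)\<^sup>2 / (B + 1) * (B + 1)"
        using B0 by (intro mult_right_mono) (auto simp: d_def)
      then show "d * (B + 1) \<le> (e/8)\<^sup>2" using B0 by simp
    qed
    obtain y where y: "y \<in> \<rat>" "x < y" "y < x + d"
      using Rats_dense_in_real[of x "x + d"] d(1) by auto
    have close: "\<bar>avgop (W n) y - avgop (W n) x\<bar> \<le> e / 4" for n
    proof -
      have "\<bar>avgop (W n) y - avgop (W n) x\<bar> \<le> 2 * sqrt ((y - x) * nsq (K n) (W n))"
        using y d by (intro avgop_equicont W) auto
      also have "(y - x) * nsq (K n) (W n) \<le> d * (B + 1)"
        using y d B0 B[of n] by (intro mult_mono) auto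
      also note d(3)
      finally show ?thesis using e by simp
    qed
    from conv[OF y(1)] have "Cauchy (\<lambda>n. avgop (W (r n)) y)" by (auto intro: LIMSEQ_imp_Cauchy)
    then obtain N where N: "\<And>m n. m \<ge> N \<Longrightarrow> n \<ge> N \<Longrightarrow> dist (avgop (W (r m)) y) (avgop (W (r n)) y) < e / 4"
      using metric_CauchyD[of _ "e/4"] e by force
    have "dist (avgop (W (r m)) x) (avgop (W (r n)) x) < e" if "m \<ge> N" "n \<ge> N" for m n
      using N[OF that] close[of "r m"] close[of "r n"] e unfolding dist_real_def by linarith
    then show "\<exists>M. \<forall>m\<ge>M. \<forall>n\<ge>M. dist (avgop (W (r m)) x) (avgop (W (r n)) x) < e" by blast
  qed
  then show thesis using that[OF r] by (simp add: Cauchy_convergent_iff)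
qed

section \<open>Fatou's lemma and completeness of L2\<close>

lemma Fatou_integral:
  fixes f :: "nat \<Rightarrow> 'a \<Rightarrow> real"
  assumes [measurable]: "\<And>n. f n \<in> borel_measurable M" "g \<in> borel_measurable M"
    and i: "\<And>n. integrable M (f n)" and nn: "\<And>n x. 0 \<le> f n x"
    and lim: "AE x in M. (\<lambda>n. f n x) \<longlonglongrightarrow> g x"
    and le: "\<And>n. (\<integral>x. f n x \<partial>M) \<le> c n" and c: "c \<longlonglongrightarrow> C"
  shows "integrable M g" "(\<integral>x. g x \<partial>M) \<le> C"
proof -
  have g0: "AE x in M. 0 \<le> g x" using lim
  proof eventually_elim
    case (elim x)
    then show ?case by (rule LIMSEQ_le_const) (use nn in auto)
  qed
  have C0: "0 \<le> C"
  proof (rule LIMSEQ_le_const[OF c], intro exI allI impI)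
    fix n
    have "0 \<le> (\<integral>x. f n x \<partial>M)" using nn by simp
    then show "0 \<le> c n" using le[of n] by linarith
  qed
  have "(\<integral>\<^sup>+x. ennreal (g x) \<partial>M) = (\<integral>\<^sup>+x. liminf (\<lambda>n. ennreal (f n x)) \<partial>M)"
  proof (rule nn_integral_cong_AE)
    show "AE x in M. ennreal (g x) = liminf (\<lambda>n. ennreal (f n x))" using lim
      by eventually_elim (simp add: lim_imp_Liminf[OF _ tendsto_ennrealI])
  qed
  also have "\<dots> \<le> liminf (\<lambda>n. \<integral>\<^sup>+x. ennreal (f n x) \<partial>M)"
    by (rule nn_integral_liminf) simp
  also have "\<dots> \<le> liminf (\<lambda>n. ennreal (c n))"
    by (intro Liminf_mono always_eventually allI) (simp add: nn_integral_eq_integral[OF i] nn le ennreal_leI)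
  also have "\<dots> = ennreal C"
    by (intro lim_imp_Liminf tendsto_ennrealI c) simp
  finally have *: "(\<integral>\<^sup>+x. ennreal (g x) \<partial>M) \<le> ennreal C" .
  have "(\<integral>\<^sup>+x. ennreal (norm (g x)) \<partial>M) = (\<integral>\<^sup>+x. ennreal (g x) \<partial>M)"
    using g0 by (intro nn_integral_cong_AE) auto
  then show g: "integrable M g"
    using * by (intro integrableI_bounded) (auto simp: le_less_trans)
  show "(\<integral>x. g x \<partial>M) \<le> C"
    using * C0 by (simp add: nn_integral_eq_integral[OF g g0])
qed

text \<open>With squared distances below \<open>(1/16)^k\<close>, the sum of the terms
  \<open>4^k * (d k x)^2\<close> has integral at most the sum of \<open>(1/4)^k\<close>. So it is
  finite almost everywhere, which bounds the increments by a multiple of \<open>(1/2)^k\<close>. The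
  weight \<open>4^k\<close> takes the place of Minkowski's inequality.\<close>

lemma AE_convergent_subseq:
  fixes f :: "nat \<Rightarrow> 'a \<Rightarrow> real"
  assumes [measurable]: "\<And>n. f n \<in> borel_measurable M"
    and i: "\<And>m n. integrable M (\<lambda>x. (f m x - f n x)\<^sup>2)"
    and Cau: "\<And>e. e > 0 \<Longrightarrow> \<exists>N. \<forall>m\<ge>N. \<forall>n\<ge>N. (\<integral>x. (f m x - f n x)\<^sup>2 \<partial>M) < e"
  obtains r :: "nat \<Rightarrow> nat" where "strict_mono r" "AE x in M. convergent (\<lambda>n. f (r n) x)"
proof -
  have "\<exists>r :: nat \<Rightarrow> nat. \<forall>k. (\<forall>m\<ge>r k. \<forall>n\<ge>r k. (\<integral>x. (f m x - f n x)\<^sup>2 \<partial>M) < (1/16)^k) \<and> r k < r (Suc k)"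
  proof (rule dependent_nat_choice)
    show "\<exists>N. \<forall>m\<ge>N. \<forall>n\<ge>N. (\<integral>x. (f m x - f n x)\<^sup>2 \<partial>M) < (1/16)^0" by (rule Cau) simp
  next
    fix N0 :: nat and k :: nat
    obtain N where N: "\<forall>m\<ge>N. \<forall>n\<ge>N. (\<integral>x. (f m x - f n x)\<^sup>2 \<partial>M) < (1/16)^(Suc k)"
      using Cau[of "(1/16)^(Suc k)"] by auto
    show "\<exists>N. (\<forall>m\<ge>N. \<forall>n\<ge>N. (\<integral>x. (f m x - f n x)\<^sup>2 \<partial>M) < (1/16)^(Suc k)) \<and> N0 < N"
      by (rule exI[of _ "max N (Suc N0)"]) (use N in auto)
  qed
  then obtain r :: "nat \<Rightarrow> nat" where 
    r1: "\<And>k m n. m \<ge> r k \<Longrightarrow> n \<ge> r k \<Longrightarrow> (\<integral>x. (f m x - f n x)\<^sup>2 \<partial>M) < (1/16)^k" and r2: "\<And>k. r k < r (Suc k)"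
    by blast
  have mono: "strict_mono r" using r2 by (simp add: strict_mono_Suc_iff)
  define d where "d = (\<lambda>k x. f (r (Suc k)) x - f (r k) x)"
  have [measurable]: "d k \<in> borel_measurable M" for k by (simp add: d_def)
  have di: "(\<integral>\<^sup>+x. ennreal (4^k * (d k x)\<^sup>2) \<partial>M) \<le> ennreal ((1/4)^k)" for k
  proof -
    have "(\<integral>x. (d k x)\<^sup>2 \<partial>M) \<le> (1/16)^k" unfolding d_def using r1[of k "r (Suc k)" "r k"] r2[of k] by simp
    then have "(\<integral>x. 4^k * (d k x)\<^sup>2 \<partial>M) \<le> 4^k * (1/16)^k" by simp
    also have "\<dots> = (1/4)^k" by (simp flip: power_mult_distrib)
    finally have "ennreal (\<integral>x. 4^k * (d k x)\<^sup>2 \<partial>M) \<le> ennreal ((1/4)^k)" by (rule ennreal_leI)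
    moreover have "integrable M (\<lambda>x. 4^k * (d k x)\<^sup>2)" using i by (simp add: d_def)
    ultimately show ?thesis by (simp add: nn_integral_eq_integral)
  qed
  have "(\<integral>\<^sup>+x. (\<Sum>k. ennreal (4^k * (d k x)\<^sup>2)) \<partial>M) = (\<Sum>k. \<integral>\<^sup>+x. ennreal (4^k * (d k x)\<^sup>2) \<partial>M)"
    by (rule nn_integral_suminf) simp
  also have "\<dots> \<le> (\<Sum>k. ennreal ((1/4)^k))"
    by (intro suminf_le di summableI)
  also have "\<dots> = ennreal (\<Sum>k. (1/4)^k)"
    by (rule suminf_ennreal2) (auto intro: summable_geometric)
  also have "\<dots> < \<infinity>" by simp
  finally have "AE x in M. (\<Sum>k. ennreal (4^k * (d k x)\<^sup>2)) \<noteq> \<infinity>"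
    by (intro nn_integral_PInf_AE) auto
  then have "AE x in M. convergent (\<lambda>n. f (r n) x)"
  proof eventually_elim
    case (elim x)
    then have s: "summable (\<lambda>k. 4^k * (d k x)\<^sup>2)"
      by (intro summable_suminf_not_top) auto
    then obtain C where C: "\<And>k. norm (4^k * (d k x)\<^sup>2) \<le> C"
      using summable_imp_Bseq[OF s] by (auto simp: Bseq_def)
    have "summable (\<lambda>k. d k x)"
    proof (rule summable_comparison_test')
      show "summable (\<lambda>k. sqrt C * (1/2)^k)" by (intro summable_mult summable_geometric) simp
      fix k :: nat
      have "(2^k * \<bar>d k x\<bar>)\<^sup>2 \<le> C"
        using C[of k] by (simp add: power_mult_distrib power_mult[symmetric] mult.commute[of k 2])
           (simp add: power_mult)
      then have "2^k * \<bar>d k x\<bar> \<le> sqrt C" by (rule real_le_rsqrt)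
      then show "norm (d k x) \<le> sqrt C * (1/2)^k" by (simp add: field_simps)
    qed
    then have "(\<lambda>n. f (r 0) x + (\<Sum>k<n. d k x)) \<longlonglongrightarrow> f (r 0) x + (\<Sum>k. d k x)"
      by (intro tendsto_add tendsto_const summable_LIMSEQ)
    then show ?case
      by (simp add: d_def sum_lessThan_telescope[of "\<lambda>n. f (r n) x"]) (auto simp: convergent_def)
  qed
  with mono show thesis by (rule that)
qed

lemma L2_diff: "L2 K U \<Longrightarrow> L2 K W \<Longrightarrow> L2 K (\<lambda>x. U x - W x)"
  using L2_add[of K U "\<lambda>x. -1 * W x"] L2_cmult[of K W "-1"] by simp

lemma L2_complete:
  assumes W: "\<And>n. L2 K (W n)"
    and Cau: "\<And>e. e > 0 \<Longrightarrow> \<exists>N. \<forall>m\<ge>N. \<forall>n\<ge>N. nsq K (\<lambda>x. W m x - W n x) < e"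
    and lim: "(\<lambda>n. nsq K (W n)) \<longlonglongrightarrow> \<nu>"
  obtains V where "L2 K V" "(\<lambda>n. nsq K (\<lambda>x. W n x - V x)) \<longlonglongrightarrow> 0" "nsq K V \<le> \<nu>"
proof -
  note [measurable] = L2D(1)[OF W]
  have d2: "integrable (mu K) (\<lambda>x. (W m x - W n x)\<^sup>2)" for m n
    using L2D(3)[OF L2_diff[OF W W]] .
  obtain r :: "nat \<Rightarrow> nat" where r: "strict_mono r" "AE x in mu K. convergent (\<lambda>n. W (r n) x)"
    by (rule AE_convergent_subseq[of W "mu K"]) (use d2 Cau in \<open>auto simp: nsq_def\<close>)
  \<comment> \<open>\<open>lim\<close> has some value also where the sequence diverges. That value
    depends on the sequence alone, so it agrees at points one period apart and \<open>V\<close> is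
    periodic at every point.\<close>
  define V where "V x = lim (\<lambda>n. W (r n) x)" for x
  have [measurable]: "V \<in> borel_measurable borel" unfolding V_def[abs_def] by simp
  have V: "AE x in mu K. (\<lambda>n. W (r n) x) \<longlonglongrightarrow> V x"
    using r(2) by eventually_elim (simp add: V_def convergent_LIMSEQ_iff)
  have "per K V" using L2D(2)[OF W] by (simp add: per_def V_def)
  have lr: "(\<lambda>n. nsq K (W (r n))) \<longlonglongrightarrow> \<nu>"
    using LIMSEQ_subseq_LIMSEQ[OF lim r(1)] by (simp add: o_def)
  have V2: "AE x in mu K. (\<lambda>n. (W (r n) x)\<^sup>2) \<longlonglongrightarrow> (V x)\<^sup>2"
    using V by eventually_elim (intro tendsto_intros)
  have iV: "integrable (mu K) (\<lambda>x. (V x)\<^sup>2)"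
    by (rule Fatou_integral(1)[OF _ _ _ _ V2 _ lr]) (use L2D(3)[OF W] in \<open>auto simp: nsq_def\<close>)
  have LV: "L2 K V" using iV \<open>per K V\<close> by (simp add: L2_def)
  have le: "nsq K V \<le> \<nu>" unfolding nsq_def
    by (rule Fatou_integral(2)[OF _ _ _ _ V2 _ lr]) (use L2D(3)[OF W] in \<open>auto simp: nsq_def\<close>)
  have "(\<lambda>n. nsq K (\<lambda>x. W n x - V x)) \<longlonglongrightarrow> 0"
  proof (rule LIMSEQ_I)
    fix e :: real assume e: "e > 0"
    obtain N where N: "\<And>m n. m \<ge> N \<Longrightarrow> n \<ge> N \<Longrightarrow> nsq K (\<lambda>x. W m x - W n x) < e / 2"
      using Cau[of "e/2"] e by auto
    have "nsq K (\<lambda>x. W n x - V x) \<le> e / 2" if n: "n \<ge> N" for n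
    proof -
      have l: "AE x in mu K. (\<lambda>k. (W n x - W (r (k + N)) x)\<^sup>2) \<longlonglongrightarrow> (W n x - V x)\<^sup>2"
        using V
      proof eventually_elim
        case (elim x)
        then show ?case by (intro tendsto_intros LIMSEQ_ignore_initial_segment[of "\<lambda>k. W (r k) x"])
      qed
      have "N \<le> r (k + N)" for k using seq_suble[OF r(1), of "k + N"] by simp
      then have b: "(\<integral>x. (W n x - W (r (k + N)) x)\<^sup>2 \<partial>mu K) \<le> e / 2" for k
        using N[OF n, of "r (k + N)"] by (simp add: nsq_def less_imp_le)
      show ?thesis unfolding nsq_def
        by (rule Fatou_integral(2)[OF _ _ _ _ l b tendsto_const]) (use d2 in auto)
    qed
    then show "\<exists>no. \<forall>n\<ge>no. norm (nsq K (\<lambda>x. W n x - V x) - 0) < e"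
      using e by (intro exI[of _ N]) (fastforce intro: le_less_trans)
  qed
  with LV le show thesis using that by blast
qed

section \<open>The Nehari set\<close>

lemma PK_eq_QK: "PK r K W = QK r K W"
  by (simp add: PK_def QK_def)

lemma QK_mu: "QK r K W = (\<integral>x. \<bar>avgop W x\<bar> powr r \<partial>mu K)"
  by (simp add: QK_def set_lebesgue_integral_mu)

lemma QK_nonneg [simp]: "0 \<le> QK r K W"
  by (simp add: QK_mu)

lemma QK_cmult: "QK r K (\<lambda>x. c * W x) = \<bar>c\<bar> powr r * QK r K W"
  by (simp add: QK_mu avgop_cmult abs_mult powr_mult)

lemma normLr_2: "(normLr 2 (IK K) W)\<^sup>2 = nsq K W"
  by (simp add: normLr_def set_lebesgue_integral_mu powr_half_sqrt nsq_def)

lemma inLr_mu: "inLr r (IK K) W \<longleftrightarrow> W \<in> borel_measurable borel \<and> integrable (mu K) (\<lambda>x. \<bar>W x\<bar> powr r)"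
  by (simp add: inLr_def set_integrable_mu)

lemma periodicK_per: "periodicK K W = per K W"
  by (simp add: periodicK_def per_def)

lemma powr_le_sq:
  fixes y r c :: real
  assumes "r \<ge> 2" "\<bar>y\<bar> \<le> c"
  shows "\<bar>y\<bar> powr r \<le> c powr (r - 2) * y\<^sup>2"
proof -
  have "\<bar>y\<bar> powr r = \<bar>y\<bar> powr (r - 2) * \<bar>y\<bar> powr 2" by (simp only: powr_add[symmetric]) simp
  also have "\<bar>y\<bar> powr 2 = y\<^sup>2" by simp
  also have "\<bar>y\<bar> powr (r - 2) * y\<^sup>2 \<le> c powr (r - 2) * y\<^sup>2"
    using assms by (intro mult_right_mono powr_mono2) auto
  finally show ?thesis .
qed

lemma avgop_powr_integrable:
  assumes "L2 K W" "1 \<le> K" "r \<ge> 2"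
  shows "integrable (mu K) (\<lambda>x. \<bar>avgop W x\<bar> powr r)"
proof (rule Bochner_Integration.integrable_bound)
  note [measurable] = L2D(1)[OF assms(1)]
  show "integrable (mu K) (\<lambda>x. sqrt (nsq K W) powr (r - 2) * (avgop W x)\<^sup>2)"
    using L2D(3)[OF avgop_L2(1)[OF assms(1,2)]] by simp
  show "(\<lambda>x. \<bar>avgop W x\<bar> powr r) \<in> borel_measurable (mu K)" by measurable
  show "AE x in mu K. norm (\<bar>avgop W x\<bar> powr r) \<le> norm (sqrt (nsq K W) powr (r - 2) * (avgop W x)\<^sup>2)"
    using powr_le_sq[OF assms(3) avgop_le[OF assms(1,2)]] by (intro AE_I2) auto
qed

text \<open>All but two of the \<open>r\<close> powers are taken out in the supremum norm, and the
  L2 contraction handles the rest. The bound \<open>c\<close> is left free so that a small supremum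
  can be exploited, as in \<open>cmin_le\<close>.\<close>

lemma QK_le_nsq:
  assumes "L2 K W" "1 \<le> K" "r \<ge> 2" and c: "\<And>x. \<bar>avgop W x\<bar> \<le> c"
  shows "QK r K W \<le> c powr (r - 2) * nsq K W"
proof -
  note A2 = avgop_L2[OF assms(1,2)]
  have "QK r K W \<le> (\<integral>x. c powr (r - 2) * (avgop W x)\<^sup>2 \<partial>mu K)"
    unfolding QK_mu using L2D(3)[OF A2(1)] avgop_powr_integrable[OF assms(1-3)] powr_le_sq[OF assms(3) c]
    by (intro integral_mono) auto
  also have "\<dots> \<le> c powr (r - 2) * nsq K W"
    using A2(2) by (simp add: nsq_def[of K "avgop W"] mult_left_mono)
  finally show ?thesis .
qed

lemma nsq_pos_iff:
  assumes "L2 K W"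
  shows "0 < nsq K W \<longleftrightarrow> \<not> (AE x\<in>IK K in lborel. W x = 0)"
proof -
  have "nsq K W = 0 \<longleftrightarrow> (AE x in mu K. W x = 0)"
    unfolding nsq_def using integral_nonneg_eq_0_iff_AE[OF L2D(3)[OF assms]] by simp
  then show ?thesis by (simp add: AE_mu less_le)
qed

lemma finite_K_powr_integrable:
  assumes "L2 (ereal k) W" "1 \<le> k" "0 \<le> r"
  shows "integrable (mu (ereal k)) (\<lambda>x. \<bar>avgop W x\<bar> powr r)"
proof (rule finite_measure.integrable_const_bound[OF finite_measure_mu])
  note [measurable] = L2D(1)[OF assms(1)]
  show "AE x in mu (ereal k). norm (\<bar>avgop W x\<bar> powr r) \<le> sqrt (nsq (ereal k) W) powr r"
    using avgop_le[OF assms(1)] assms by (intro AE_I2) (auto intro!: powr_mono2)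
qed (use L2D(1)[OF assms(1)] in measurable)

locale ground_wave =
  fixes p q s2 :: real
  assumes p2: "2 < p" and q1: "1 < q" and qp: "q < p" and s2: "0 < s2"
begin

definition X where "X K W \<longleftrightarrow> L2 K W \<and> integrable (mu K) (\<lambda>x. \<bar>avgop W x\<bar> powr q)"

text \<open>This is \<open>LK - FK / p\<close>, the combination in which the \<open>p\<close>-th
  power cancels.\<close>

definition J where "J K W = (1/2 - 1/p) * s2 * nsq K W + (1 - q/p) * QK q K W"

lemma coeff_pos: "0 < 1/2 - 1/p" "0 < 1 - q/p"
  using p2 qp by (auto simp: field_simps)

lemma XK_iff: "1 \<le> K \<Longrightarrow> W \<in> XK p q K \<longleftrightarrow> X K W"
  using avgop_powr_integrable[of K W p] p2
  by (auto simp: XK_def X_def inLr_mu periodicK_per L2_def)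

lemma X_finite: "1 \<le> k \<Longrightarrow> X (ereal k) W \<longleftrightarrow> L2 (ereal k) W"
  using finite_K_powr_integrable[of k W q] q1 by (auto simp: X_def)

lemma X_cmult: "X K W \<Longrightarrow> X K (\<lambda>x. c * W x)"
  by (simp add: X_def L2_cmult avgop_cmult abs_mult powr_mult)

lemma FK_eq: "FK p q s2 K W = s2 * nsq K W + q * QK q K W - p * QK p K W"
  by (simp add: FK_def normLr_2 PK_eq_QK)

lemma LK_eq: "LK p q s2 K W = s2 * nsq K W / 2 + QK q K W - QK p K W"
  by (simp add: LK_def normLr_2 PK_eq_QK)

lemma MK_iff: "1 \<le> K \<Longrightarrow> W \<in> MK p q s2 K \<longleftrightarrow> X K W \<and> 0 < nsq K W \<and> FK p q s2 K W = 0"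
  using nsq_pos_iff by (auto simp: MK_def XK_iff X_def)

lemma LK_eq_J: "FK p q s2 K W = 0 \<Longrightarrow> LK p q s2 K W = J K W"
proof -
  assume "FK p q s2 K W = 0"
  then have "QK p K W = (s2 * nsq K W + q * QK q K W) / p" using p2 by (simp add: FK_eq field_simps)
  then show ?thesis unfolding LK_eq J_def using p2 by (simp only:) (simp add: diff_divide_distrib add_divide_distrib algebra_simps)
qed

lemma J_nonneg: "0 \<le> J K W"
  unfolding J_def using coeff_pos s2 by (intro add_nonneg_nonneg mult_nonneg_nonneg) auto

text \<open>Dividing the equation \<open>FK = 0\<close> for \<open>t W\<close> by
  \<open>t powr p\<close> gives \<open>m a b t = c\<close> with \<open>a = s2 * nsq K W\<close>,
  \<open>b = q * QK q K W\<close> and \<open>c = p * QK p K W\<close>. Both exponents are negative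
  whatever the order of \<open>q\<close> and 2, so the ray through a nonzero \<open>W\<close> meets
  the Nehari set at most once.\<close>

definition m where "m a b t = a * t powr (2 - p) + b * t powr (q - p)"

lemma m_eq_iff: "0 < t \<Longrightarrow> m a b t = c \<longleftrightarrow> t\<^sup>2 * a + t powr q * b = t powr p * c"
proof -
  assume t: "0 < t"
  have "t powr p * m a b t = t\<^sup>2 * a + t powr q * b"
    using t by (simp add: m_def algebra_simps flip: powr_add)
  then show ?thesis using t by (metis mult_cancel_left powr_eq_0_iff less_irrefl)
qed

lemma m_strict_antimono:
  assumes "0 < a" "0 \<le> b" "0 < t" "t < u"
  shows "m a b u < m a b t"
  unfolding m_def using assms p2 qp
  by (intro add_less_le_mono mult_strict_left_mono mult_left_mono)
     (auto intro!: powr_less_mono2_neg less_imp_le)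

lemma Nehari_root:
  assumes "0 < a" "0 \<le> b" "0 < c"
  obtains t where "0 < t" "m a b t = c"
proof -
  \<comment> \<open>At \<open>l\<close> the first summand alone equals \<open>c\<close>. For
    \<open>t >= 1\<close> both powers are at most \<open>t powr (- d)\<close>, and \<open>u\<close>
    is taken so large that \<open>(a + b) * u powr (- d) <= c\<close>; the maximum with
    \<open>l\<close> orders the interval for the intermediate value theorem.\<close>
  define l where "l = (c / a) powr (1 / (2 - p))"
  define d where "d = min (p - 2) (p - q)"
  define u where "u = max (max 1 l) ((c / (a + b)) powr (1 / - d))"
  have d: "d > 0" using p2 qp by (simp add: d_def)
  have l: "l > 0" using assms by (simp add: l_def)
  have u: "u \<ge> 1" "u \<ge> l" by (auto simp: u_def)
  have "l powr (2 - p) = c / a" using assms p2 by (simp add: l_def powr_powr)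
  then have ml: "c \<le> m a b l" using assms by (simp add: m_def)
  have "m a b u \<le> a * u powr (-d) + b * u powr (-d)"
    unfolding m_def using u assms by (intro add_mono mult_left_mono powr_mono) (auto simp: d_def)
  also have "\<dots> = (a + b) * u powr (-d)" by (simp add: algebra_simps)
  also have "\<dots> \<le> (a + b) * ((c / (a + b)) powr (1 / - d)) powr (-d)"
    using assms d by (intro mult_left_mono powr_mono2') (auto simp: u_def)
  also have "\<dots> = c" using assms d by (simp add: powr_powr)
  finally have mu: "m a b u \<le> c" .
  have "\<exists>t\<ge>l. t \<le> u \<and> m a b t = c"
    by (rule IVT2'[OF mu ml u(2)]) (use l in \<open>auto simp: m_def intro!: continuous_intros\<close>)
  then obtain t where "l \<le> t" "m a b t = c" by blast
  with l show thesis by (intro that) auto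
qed

lemma Nehari_root_le_1:
  assumes "0 < a" "0 \<le> b" "a + b \<le> c" 
  obtains t where "0 < t" "t \<le> 1" "m a b t = c"
proof -
  have "0 < c" using assms by simp
  then obtain t where t: "0 < t" "m a b t = c" using Nehari_root assms by metis
  have "t \<le> 1"
  proof (rule ccontr)
    assume "\<not> t \<le> 1"
    then have "m a b t < m a b 1" using assms by (intro m_strict_antimono) auto
    then show False using t assms by (simp add: m_def)
  qed
  with t show thesis by (intro that) auto
qed

text \<open>Strict monotonicity replaces an implicit function theorem: at a fixed positive point
  other than 1 the limit \<open>m a0 b0\<close> lies strictly on one side of \<open>a0 + b0\<close>,
  so eventually the root is on the proper side of that point. Existence is asserted eventually,
  because \<open>a n\<close> and \<open>c n\<close> are known to be positive only for large
  \<open>n\<close>.\<close>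

lemma Nehari_root_stable:
  fixes a b c :: "nat \<Rightarrow> real"
  assumes a: "a \<longlonglongrightarrow> a0" and b: "b \<longlonglongrightarrow> b0" and c: "c \<longlonglongrightarrow> a0 + b0"
    and a0: "0 < a0" and b0: "\<And>n. 0 \<le> b n"
  obtains t where "t \<longlonglongrightarrow> 1" "\<forall>\<^sub>F n in sequentially. 0 < t n \<and> m (a n) (b n) (t n) = c n"
proof -
  have b00: "0 \<le> b0" using LIMSEQ_le_const[OF b] b0 by blast
  have ea: "\<forall>\<^sub>F n in sequentially. 0 < a n" using order_tendstoD(1)[OF a a0] .
  have ec: "\<forall>\<^sub>F n in sequentially. 0 < c n" using order_tendstoD(1)[OF c, of 0] a0 b00 by simp
  define t where "t n = (SOME t. 0 < t \<and> m (a n) (b n) t = c n)" for n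
  have ev: "\<forall>\<^sub>F n in sequentially. 0 < t n \<and> m (a n) (b n) (t n) = c n"
    using ea ec
  proof eventually_elim
    case (elim n)
    then have "\<exists>t. 0 < t \<and> m (a n) (b n) t = c n" using Nehari_root b0 by metis
    then show ?case unfolding t_def by (rule someI_ex)
  qed
  have lim: "(\<lambda>n. m (a n) (b n) x) \<longlonglongrightarrow> m a0 b0 x" for x
    unfolding m_def by (intro tendsto_intros a b)
  have m1: "m a0 b0 1 = a0 + b0" by (simp add: m_def)
  have "t \<longlonglongrightarrow> 1"
  proof (rule order_tendstoI)
    fix l :: real assume "l < 1"
    \<comment> \<open>Raised to 1/2 if necessary, as \<open>m\<close> is compared at positive
      arguments only.\<close>
    define l' where "l' = max l (1/2)"
    have l': "0 < l'" "l' < 1" "l \<le> l'" using \<open>l < 1\<close> by (auto simp: l'_def)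
    have "a0 + b0 < m a0 b0 l'" using m_strict_antimono[OF a0 b00, of l' 1] l' m1 by simp
    then have "0 < m a0 b0 l' - (a0 + b0)" by simp
    from order_tendstoD(1)[OF tendsto_diff[OF lim c] this]
    show "\<forall>\<^sub>F n in sequentially. l < t n" using ev ea
    proof eventually_elim
      case (elim n)
      show ?case
      proof (rule ccontr)
        assume "\<not> l < t n"
        then have "t n \<le> l'" using l' by simp
        then have "m (a n) (b n) l' \<le> m (a n) (b n) (t n)"
          using m_strict_antimono[of "a n" "b n" "t n" l'] elim b0 by (cases "t n = l'") auto
        then show False using elim by simp
      qed
    qed
  next
    fix u :: real assume u: "1 < u"
    have "m a0 b0 u < a0 + b0" using m_strict_antimono[OF a0 b00, of 1 u] u m1 by simp
    then have "m a0 b0 u - (a0 + b0) < 0" by simp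
    from order_tendstoD(2)[OF tendsto_diff[OF lim c] this]
    show "\<forall>\<^sub>F n in sequentially. t n < u" using ev ea
    proof eventually_elim
      case (elim n)
      show ?case
      proof (rule ccontr)
        assume "\<not> t n < u"
        then have "u \<le> t n" by simp
        then have "m (a n) (b n) (t n) \<le> m (a n) (b n) u"
          using m_strict_antimono[of "a n" "b n" u "t n"] elim b0 u by (cases "t n = u") auto
        then show False using elim by simp
      qed
    qed
  qed
  then show thesis using ev by (rule that)
qed

lemma FK_cmult:
  assumes "0 < t"
  shows "FK p q s2 K (\<lambda>x. t * W x) = t\<^sup>2 * (s2 * nsq K W) + t powr q * (q * QK q K W) - t powr p * (p * QK p K W)"
  using assms by (simp add: FK_eq nsq_cmult QK_cmult algebra_simps)

lemma MK_scaled: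
  assumes "1 \<le> K" "X K W" "0 < nsq K W" "0 < t"
    and "m (s2 * nsq K W) (q * QK q K W) t = p * QK p K W"
  shows "(\<lambda>x. t * W x) \<in> MK p q s2 K"
  using assms by (simp add: MK_iff X_cmult nsq_cmult FK_cmult m_eq_iff)

lemma nsq_pos_of_QK_pos:
  assumes "L2 K W" "1 \<le> K" "0 < QK p K W"
  shows "0 < nsq K W"
  using QK_le_nsq[OF assms(1,2), of p, OF _ avgop_le[OF assms(1,2)]] p2 assms(3)
  by (cases "nsq K W = 0") (auto simp: less_le)

lemma MK_nonempty_of_QK_pos:
  assumes "1 \<le> K" "X K W" "0 < QK p K W"
  shows "MK p q s2 K \<noteq> {}"
proof -
  have n: "0 < nsq K W" using nsq_pos_of_QK_pos assms by (simp add: X_def)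
  obtain t where "0 < t" "m (s2 * nsq K W) (q * QK q K W) t = p * QK p K W"
    using Nehari_root[of "s2 * nsq K W" "q * QK q K W" "p * QK p K W"] n s2 q1 p2 assms(3) by auto
  then show ?thesis using MK_scaled[OF assms(1,2) n] by blast
qed

lemma J_scale_le:
  assumes "0 < t" "t \<le> 1"
  shows "J K (\<lambda>x. t * W x) \<le> J K W"
proof -
  have "t\<^sup>2 \<le> 1" using assms by (simp add: power_le_one)
  moreover have "t powr q \<le> 1" using powr_mono2[of q t 1] assms q1 by simp
  ultimately show ?thesis unfolding J_def nsq_cmult QK_cmult using assms coeff_pos s2
    by (intro add_mono mult_left_mono) (auto intro!: mult_left_le_one_le)
qed

lemma ellK_le_LK: "1 \<le> K \<Longrightarrow> W \<in> MK p q s2 K \<Longrightarrow> ellK p q s2 K \<le> LK p q s2 K W"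
  unfolding ellK_def
  by (rule cInf_lower) (auto intro!: bdd_belowI[of _ 0] simp: MK_iff LK_eq_J J_nonneg)

lemma ellK_nonneg:
  assumes "1 \<le> K" "MK p q s2 K \<noteq> {}"
  shows "0 \<le> ellK p q s2 K"
  unfolding ellK_def using assms
  by (intro cInf_greatest) (auto simp: MK_iff LK_eq_J J_nonneg)

lemma Nehari_projection:
  assumes "1 \<le> K" "X K W" "0 < nsq K W" "FK p q s2 K W \<le> 0"
  obtains t where "0 < t" "t \<le> 1" "(\<lambda>x. t * W x) \<in> MK p q s2 K"
    "LK p q s2 K (\<lambda>x. t * W x) \<le> J K W"
proof -
  obtain t where t: "0 < t" "t \<le> 1" "m (s2 * nsq K W) (q * QK q K W) t = p * QK p K W"
    using Nehari_root_le_1[of "s2 * nsq K W" "q * QK q K W" "p * QK p K W"] assms(3,4) s2 q1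
    by (auto simp: FK_eq)
  have M: "(\<lambda>x. t * W x) \<in> MK p q s2 K" using MK_scaled assms t by blast
  then have "LK p q s2 K (\<lambda>x. t * W x) = J K (\<lambda>x. t * W x)"
    using assms(1) by (simp add: MK_iff LK_eq_J)
  then show thesis using that t M J_scale_le[OF t(1,2)] by simp
qed

lemma ellK_le_J:
  assumes "1 \<le> K" "X K W" "0 < nsq K W" "FK p q s2 K W \<le> 0"
  shows "ellK p q s2 K \<le> J K W"
proof -
  obtain t where t: "(\<lambda>x. t * W x) \<in> MK p q s2 K" "LK p q s2 K (\<lambda>x. t * W x) \<le> J K W"
    using Nehari_projection[OF assms] by metis
  then show ?thesis using ellK_le_LK[OF assms(1) t(1)] by linarith
qed

text \<open>A limit obtained by lower semicontinuity is only known to satisfy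
  \<open>FK <= 0\<close>; scaling restores the constraint without raising \<open>J\<close>.\<close>

lemma minimizer_of_J_le:
  assumes "1 \<le> K" "X K W" "0 < nsq K W" "FK p q s2 K W \<le> 0" "J K W \<le> ellK p q s2 K"
  obtains t where "is_minimizer p q s2 K (\<lambda>x. t * W x)"
proof -
  obtain t where t: "(\<lambda>x. t * W x) \<in> MK p q s2 K" "LK p q s2 K (\<lambda>x. t * W x) \<le> J K W"
    using Nehari_projection[OF assms(1-4)] by metis
  have "LK p q s2 K (\<lambda>x. t * W x) \<le> LK p q s2 K U" if "U \<in> MK p q s2 K" for U
    using t(2) assms(5) ellK_le_LK[OF assms(1) that] by linarith
  with t(1) show thesis by (intro that[of t]) (simp add: is_minimizer_def)
qed

lemma is_minimizerD:
  assumes "is_minimizer p q s2 K W" "1 \<le> K"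
  shows "X K W" "0 < nsq K W" "FK p q s2 K W = 0" "LK p q s2 K W = J K W" "J K W = ellK p q s2 K"
proof -
  show 1: "X K W" "0 < nsq K W" "FK p q s2 K W = 0" using assms by (auto simp: is_minimizer_def MK_iff)
  then show 2: "LK p q s2 K W = J K W" by (simp add: LK_eq_J)
  have "ellK p q s2 K = LK p q s2 K W"
    unfolding ellK_def using assms by (intro cInf_eq_minimum) (auto simp: is_minimizer_def)
  then show "J K W = ellK p q s2 K" using 2 by simp
qed

lemma is_minimizerI:
  assumes "1 \<le> K" "X K W" "0 < nsq K W" "FK p q s2 K W = 0" "J K W \<le> ellK p q s2 K"
  shows "is_minimizer p q s2 K W"
  using assms ellK_le_LK by (fastforce simp: is_minimizer_def MK_iff LK_eq_J)

text \<open>The root \<open>c\<close> of \<open>p * c powr (p - 2) = s2\<close>, the smallest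
  supremum of an average at which the \<open>p\<close>-th power can balance the quadratic term. It
  does not depend on \<open>K\<close>.\<close>

definition cmin where "cmin = (s2 / p) powr (1 / (p - 2))"

lemma cmin_pos: "0 < cmin" using s2 p2 by (simp add: cmin_def)

text \<open>Discarding the nonnegative \<open>q\<close>-term leaves
  \<open>s2 * nsq K W <= p * QK p K W\<close>, and interpolation lets the norm cancel. This bound is
  what keeps suitably translated minimizers from vanishing in the limit of large periods.\<close>

lemma cmin_le:
  assumes "L2 K W" "1 \<le> K" "0 < nsq K W" "FK p q s2 K W \<le> 0" and c: "\<And>x. \<bar>avgop W x\<bar> \<le> c"
  shows "cmin \<le> c"
proof -
  have c0: "0 \<le> c" using c[of 0] by simp
  have "0 \<le> q * QK q K W" using q1 by simp
  then have "s2 * nsq K W \<le> p * QK p K W" using assms(4) unfolding FK_eq by linarith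
  also have "\<dots> \<le> p * (c powr (p - 2) * nsq K W)"
    using QK_le_nsq[OF assms(1,2) _ c, of p] p2 by (intro mult_left_mono) auto
  finally have "s2 \<le> p * c powr (p - 2)" using assms(3) by (simp add: mult.assoc[symmetric])
  then have "s2 / p \<le> c powr (p - 2)" using p2 by (simp add: field_simps)
  then have "cmin \<le> (c powr (p - 2)) powr (1 / (p - 2))"
    unfolding cmin_def using s2 p2 by (intro powr_mono2) auto
  then show ?thesis using c0 p2 by (simp add: powr_powr)
qed

lemma cmin_sq_le_nsq:
  assumes "L2 K W" "1 \<le> K" "0 < nsq K W" "FK p q s2 K W \<le> 0"
  shows "cmin\<^sup>2 \<le> nsq K W"
  using cmin_le[OF assms avgop_le[OF assms(1,2)]] cmin_pos
  by (metis less_imp_le power_mono real_sqrt_pow2 nsq_nonneg)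

end

section \<open>Existence of periodic minimizers\<close>

lemma powr_abs_tendsto:
  fixes u :: "nat \<Rightarrow> real"
  assumes "u \<longlonglongrightarrow> v" "0 < r"
  shows "(\<lambda>n. \<bar>u n\<bar> powr r) \<longlonglongrightarrow> \<bar>v\<bar> powr r"
  using assms by (intro tendsto_powr' tendsto_rabs tendsto_const) auto

lemma powr_integral_tendsto:
  fixes u :: "nat \<Rightarrow> real \<Rightarrow> real"
  assumes [measurable]: "\<And>n. u n \<in> borel_measurable borel"
    and lim: "\<And>x. (\<lambda>n. u n x) \<longlonglongrightarrow> v x" and B: "\<And>n x. \<bar>u n x\<bar> \<le> B" and r: "0 < r"
  shows "(\<lambda>n. \<integral>x. \<bar>u n x\<bar> powr r \<partial>mu (ereal k)) \<longlonglongrightarrow> (\<integral>x. \<bar>v x\<bar> powr r \<partial>mu (ereal k))"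
proof (rule integral_dominated_convergence)
  have [measurable]: "v \<in> borel_measurable borel"
    by (rule borel_measurable_LIMSEQ_real[OF lim]) auto
  show "(\<lambda>x. \<bar>v x\<bar> powr r) \<in> borel_measurable (mu (ereal k))"
    "\<And>n. (\<lambda>x. \<bar>u n x\<bar> powr r) \<in> borel_measurable (mu (ereal k))" by measurable
  show "integrable (mu (ereal k)) (\<lambda>x. B powr r)"
    using finite_measure.integrable_const[OF finite_measure_mu] .
  show "AE x in mu (ereal k). (\<lambda>n. \<bar>u n x\<bar> powr r) \<longlonglongrightarrow> \<bar>v x\<bar> powr r"
    using powr_abs_tendsto[OF lim r] by simp
  show "AE x in mu (ereal k). norm (\<bar>u n x\<bar> powr r) \<le> B powr r" for n
    using B[of n] r by (auto intro!: powr_mono2)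
qed

lemma nsq_parallelogram:
  assumes "L2 K U" "L2 K W"
  shows "nsq K (\<lambda>x. 1/2 * (U x + W x)) = (nsq K U + nsq K W) / 2 - nsq K (\<lambda>x. U x - W x) / 4"
proof -
  have "(\<lambda>x. (1/2 * (U x + W x))\<^sup>2) = (\<lambda>x. ((U x)\<^sup>2 + (W x)\<^sup>2) / 2 - (U x - W x)\<^sup>2 / 4)"
    by (intro ext) (simp add: power2_eq_square field_simps)
  then show ?thesis
    using L2D(3)[OF assms(1)] L2D(3)[OF assms(2)] L2D(3)[OF L2_diff[OF assms]]
    by (simp add: nsq_def)
qed

lemma L2_const: "L2 (ereal k) (\<lambda>x. c)"
  using finite_measure.integrable_const[OF finite_measure_mu] by (simp add: L2_def per_def)

lemma nsq_bound_avgop_tendsto: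
  assumes "\<And>n. L2 K (U n)" "L2 K V" "1 \<le> K" "(\<lambda>n. nsq K (\<lambda>x. U n x - V x)) \<longlonglongrightarrow> 0"
  shows "(\<lambda>n. avgop (U n) x) \<longlonglongrightarrow> avgop V x"
proof (rule LIM_zero_cancel, rule Lim_null_comparison)
  show "(\<lambda>n. sqrt (nsq K (\<lambda>x. U n x - V x))) \<longlonglongrightarrow> 0"
    using tendsto_real_sqrt[OF assms(4)] by simp
  show "\<forall>\<^sub>F n in sequentially. norm (avgop (U n) x - avgop V x) \<le> sqrt (nsq K (\<lambda>x. U n x - V x))"
    using avgop_le[OF L2_diff[OF assms(1,2)] assms(3)] avgop_diff[OF assms(1-3)] by simp
qed

context ground_wave
begin

lemma MK_nonempty_finite:
  assumes "1 \<le> k"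
  shows "MK p q s2 (ereal k) \<noteq> {}"
proof (rule MK_nonempty_of_QK_pos)
  show "X (ereal k) (\<lambda>_. 1)" using assms L2_const by (simp add: X_finite)
  have "avgop (\<lambda>_. 1) x = 1" for x by (simp add: avgop_win)
  then have "QK p (ereal k) (\<lambda>_. 1) = measure (mu (ereal k)) (space (mu (ereal k)))" by (simp add: QK_mu)
  also have "\<dots> = 2 * k" using assms by (simp add: mu_def measure_restrict_space)
  finally show "0 < QK p (ereal k) (\<lambda>_. 1)" using assms by simp
qed (use assms in simp)

lemma nsq_le_J: "nsq K W \<le> J K W / ((1/2 - 1/p) * s2)"
proof -
  have "(1/2 - 1/p) * s2 * nsq K W \<le> J K W"
    unfolding J_def using coeff_pos by simp
  then show ?thesis using coeff_pos s2 by (simp add: pos_le_divide_eq mult.commute mult.assoc)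
qed

lemma nsq_pos_of_FK_neg:
  assumes "L2 K W" "1 \<le> K" "FK p q s2 K W < 0"
  shows "0 < nsq K W"
proof -
  have "0 \<le> s2 * nsq K W" "0 \<le> q * QK q K W" using s2 q1 by simp_all
  then have "0 < p * QK p K W" using assms(3) unfolding FK_eq by linarith
  then have "0 < QK p K W" using p2 by (simp add: zero_less_mult_iff)
  then show ?thesis using nsq_pos_of_QK_pos assms by blast
qed

lemma minimizer_exists_finite:
  assumes k: "1 \<le> k"
  shows "\<exists>W. is_minimizer p q s2 (ereal k) W"
proof -
  let ?K = "ereal k"
  define l where "l = ellK p q s2 ?K"
  define c1 where "c1 = (1/2 - 1/p) * s2"
  define c2 where "c2 = 1 - q/p"
  have c1: "0 < c1" and c2: "0 < c2" using coeff_pos s2 by (auto simp: c1_def c2_def)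
  have K: "1 \<le> ?K" using k by simp
  have Jc: "J ?K W = c1 * nsq ?K W + c2 * QK q ?K W" for W by (simp add: J_def c1_def c2_def)
  have "\<exists>W. W \<in> MK p q s2 ?K \<and> LK p q s2 ?K W < l + 1 / real (Suc n)" for n
  proof -
    have "Inf (LK p q s2 ?K ` MK p q s2 ?K) < l + 1 / real (Suc n)" by (simp add: l_def ellK_def)
    then show ?thesis using cInf_lessD[of "LK p q s2 ?K ` MK p q s2 ?K"] MK_nonempty_finite[OF k] by blast
  qed
  then obtain W where W: "\<And>n. W n \<in> MK p q s2 ?K" "\<And>n. LK p q s2 ?K (W n) < l + 1 / real (Suc n)"
    by metis
  have WL: "L2 ?K (W n)" and Wp: "0 < nsq ?K (W n)" and WF: "FK p q s2 ?K (W n) = 0" for n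
    using W(1)[of n] by (auto simp: MK_iff[OF K] X_def)
  note WJ = LK_eq_J[OF WF]
  have Jlim: "(\<lambda>n. J ?K (W n)) \<longlonglongrightarrow> l"
  proof (rule tendsto_sandwich)
    show "\<forall>\<^sub>F n in sequentially. l \<le> J ?K (W n)"
      using ellK_le_LK[OF K W(1)] by (simp add: l_def WJ)
    show "\<forall>\<^sub>F n in sequentially. J ?K (W n) \<le> l + 1 / real (Suc n)"
      using W(2) by (simp add: WJ less_imp_le)
    show "(\<lambda>n. l + 1 / real (Suc n)) \<longlonglongrightarrow> l"
      using tendsto_add[OF tendsto_const[of l] LIMSEQ_Suc[OF lim_1_over_n]] by simp
  qed simp
  define B where "B = (l + 1) / c1"
  have WB: "nsq ?K (W n) \<le> B" for n
  proof -
    have "1 / real (Suc n) \<le> 1" by simp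
    then have "J ?K (W n) \<le> l + 1" using W(2)[of n] unfolding WJ by linarith
    then have "J ?K (W n) / c1 \<le> B" using c1 by (simp add: B_def divide_right_mono)
    then show ?thesis using nsq_le_J[of ?K "W n"] by (simp add: c1_def)
  qed
  obtain r :: "nat \<Rightarrow> nat" where r: "strict_mono r" and conv: "\<And>x. convergent (\<lambda>n. avgop (W (r n)) x)"
    using avgop_convergent_subseq[of "\<lambda>_. ?K" W B, OF WL K WB] by blast
  define U where "U n = W (r n)" for n
  define v where "v x = lim (\<lambda>n. avgop (U n) x)" for x
  have UL: "L2 ?K (U n)" and UB: "nsq ?K (U n) \<le> B" and UF: "FK p q s2 ?K (U n) = 0" for n
    by (simp_all add: U_def WL WB WF)
  note [measurable] = L2D(1)[OF UL]
  have v: "(\<lambda>n. avgop (U n) x) \<longlonglongrightarrow> v x" for x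
    using conv[of x] by (simp add: v_def U_def convergent_LIMSEQ_iff)
  have bd: "\<bar>avgop (U n) x\<bar> \<le> sqrt B" for n x
    using avgop_le[OF UL K, of n x] UB[of n] by (meson order_trans real_sqrt_le_mono)
  define M where "M r = (\<integral>x. \<bar>v x\<bar> powr r \<partial>mu ?K)" for r
  have Qlim: "(\<lambda>n. QK r ?K (U n)) \<longlonglongrightarrow> M r" if "0 < r" for r
    unfolding QK_mu M_def by (rule powr_integral_tendsto[OF _ v bd that]) measurable
  have UJ: "(\<lambda>n. J ?K (U n)) \<longlonglongrightarrow> l"
    using LIMSEQ_subseq_LIMSEQ[OF Jlim r] by (simp add: o_def U_def)
  \<comment> \<open>The limit of the squared norms is solved for from
    \<open>J = c1 * nsq + c2 * QK q\<close>: the limits of \<open>J\<close> and of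
    \<open>QK q\<close> are known, while strong convergence is still open.\<close>
  define \<nu> where "\<nu> = (l - c2 * M q) / c1"
  have nlim: "(\<lambda>n. nsq ?K (U n)) \<longlonglongrightarrow> \<nu>"
  proof -
    have "(\<lambda>n. (J ?K (U n) - c2 * QK q ?K (U n)) / c1) \<longlonglongrightarrow> \<nu>"
      unfolding \<nu>_def using q1 c1 by (intro tendsto_intros UJ Qlim) auto
    then show ?thesis using c1 by (simp add: Jc)
  qed
  have l_eq: "l = c1 * \<nu> + c2 * M q" using c1 by (simp add: \<nu>_def)
  have bal: "s2 * \<nu> + q * M q - p * M p = 0"
  proof -
    have "(\<lambda>n. FK p q s2 ?K (U n)) \<longlonglongrightarrow> s2 * \<nu> + q * M q - p * M p"
      unfolding FK_eq using q1 p2 by (intro tendsto_intros Qlim nlim) auto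
    then show ?thesis by (simp add: UF LIMSEQ_const_iff)
  qed
  have "cmin\<^sup>2 \<le> \<nu>"
    using cmin_sq_le_nsq[OF UL K] Wp UF by (intro LIMSEQ_le_const[OF nlim]) (auto simp: U_def)
  then have "0 < \<nu>" using cmin_pos by (meson less_le_trans zero_less_power)
  moreover have "0 \<le> M q" by (simp add: M_def)
  ultimately have "0 < s2 * \<nu>" "0 \<le> q * M q" using s2 q1 by simp_all
  then have "0 < p * M p" using bal by linarith
  then have Mp: "0 < M p" using p2 by (simp add: zero_less_mult_iff)
  \<comment> \<open>If two far members of the sequence stay apart, then by the parallelogram law their midpoint has
    strictly smaller norm but asymptotically the same \<open>\<Q>\<close> and \<open>\<P>\<close>, which would push \<open>J\<close> below its infimum.\<close>
  have Cau: "\<exists>N. \<forall>m\<ge>N. \<forall>n\<ge>N. nsq ?K (\<lambda>x. U m x - U n x) < e" if e: "0 < e" for e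
  proof (rule ccontr)
    assume "\<not> ?thesis"
    then have "\<forall>N. \<exists>m n. N \<le> m \<and> N \<le> n \<and> e \<le> nsq ?K (\<lambda>x. U m x - U n x)" by (meson not_less)
    then obtain f g where fg: "\<And>N. N \<le> f N" "\<And>N. N \<le> g N" "\<And>N. e \<le> nsq ?K (\<lambda>x. U (f N) x - U (g N) x)"
      by metis
    have fl: "filterlim f at_top sequentially" "filterlim g at_top sequentially"
      using fg by (auto intro: filterlim_at_top_mono[OF filterlim_ident])
    define Z where "Z N x = 1/2 * (U (f N) x + U (g N) x)" for N x
    have ZL: "L2 ?K (Z N)" for N unfolding Z_def[abs_def] by (intro L2_cmult L2_add UL)
    note [measurable] = L2D(1)[OF ZL]
    have aZ: "avgop (Z N) x = 1/2 * (avgop (U (f N)) x + avgop (U (g N)) x)" for N x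
      unfolding Z_def[abs_def] by (simp only: avgop_cmult avgop_add[OF UL UL K])
    have "(\<lambda>N. 1/2 * (avgop (U (f N)) x + avgop (U (g N)) x)) \<longlonglongrightarrow> 1/2 * (v x + v x)" for x
      by (intro tendsto_intros filterlim_compose[OF v] fl)
    then have Zv: "(\<lambda>N. avgop (Z N) x) \<longlonglongrightarrow> v x" for x by (simp add: aZ)
    have Zb: "\<bar>avgop (Z N) x\<bar> \<le> sqrt B" for N x
      using bd[of "f N" x] bd[of "g N" x] unfolding aZ by (simp add: abs_le_iff)
    have ZQ: "(\<lambda>N. QK r ?K (Z N)) \<longlonglongrightarrow> M r" if "0 < r" for r
      unfolding QK_mu M_def by (rule powr_integral_tendsto[OF _ Zv Zb that]) measurable
    \<comment> \<open>The squared norms of the midpoints need not converge; this majorant does, to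
      \<open>\<nu> - e / 4\<close>.\<close>
    define b where "b N = (nsq ?K (U (f N)) + nsq ?K (U (g N))) / 2 - e / 4" for N
    have nb: "nsq ?K (Z N) \<le> b N" for N
      using nsq_parallelogram[OF UL UL, of "f N" "g N"] fg(3)[of N] by (simp add: b_def Z_def[abs_def])
    have "b \<longlonglongrightarrow> (\<nu> + \<nu>) / 2 - e / 4"
      unfolding b_def by (intro tendsto_intros filterlim_compose[OF nlim] fl) auto
    then have bl: "b \<longlonglongrightarrow> \<nu> - e / 4" by simp
    have "(\<lambda>N. s2 * b N + q * QK q ?K (Z N) - p * QK p ?K (Z N)) \<longlonglongrightarrow> s2 * (\<nu> - e/4) + q * M q - p * M p"
      using q1 p2 by (intro tendsto_intros bl ZQ) auto
    moreover have "s2 * (\<nu> - e/4) + q * M q - p * M p < 0" using bal e s2 by (simp add: algebra_simps)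
    ultimately have ev1: "\<forall>\<^sub>F N in sequentially. s2 * b N + q * QK q ?K (Z N) - p * QK p ?K (Z N) < 0"
      by (rule order_tendstoD(2))
    have "(\<lambda>N. c1 * b N + c2 * QK q ?K (Z N)) \<longlonglongrightarrow> c1 * (\<nu> - e/4) + c2 * M q"
      using q1 by (intro tendsto_intros bl ZQ) auto
    moreover have "c1 * (\<nu> - e/4) + c2 * M q < l" using l_eq e c1 by (simp add: algebra_simps)
    ultimately have ev2: "\<forall>\<^sub>F N in sequentially. c1 * b N + c2 * QK q ?K (Z N) < l"
      by (rule order_tendstoD(2))
    obtain N where N: "s2 * b N + q * QK q ?K (Z N) - p * QK p ?K (Z N) < 0" "c1 * b N + c2 * QK q ?K (Z N) < l"
      using eventually_conj[OF ev1 ev2] by (auto simp: eventually_sequentially)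
    have F: "FK p q s2 ?K (Z N) < 0" unfolding FK_eq
      using N(1) mult_left_mono[OF nb[of N], of s2] s2 by linarith
    have "J ?K (Z N) < l" unfolding Jc
      using N(2) mult_left_mono[OF nb[of N], of c1] c1 by linarith
    moreover have "l \<le> J ?K (Z N)" unfolding l_def
      by (rule ellK_le_J[OF K _ nsq_pos_of_FK_neg[OF ZL K F]]) (use F ZL k in \<open>auto simp: X_finite\<close>)
    ultimately show False by simp
  qed
  obtain V where V: "L2 ?K V" "(\<lambda>n. nsq ?K (\<lambda>x. U n x - V x)) \<longlonglongrightarrow> 0" "nsq ?K V \<le> \<nu>"
    using L2_complete[OF UL Cau nlim] by blast
  have av: "avgop V x = v x" for x
    using LIMSEQ_unique[OF nsq_bound_avgop_tendsto[OF UL V(1) K V(2)] v] .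
  have VQ: "QK r ?K V = M r" for r by (simp add: QK_mu av M_def)
  \<comment> \<open>Both \<open>FK\<close> and \<open>J\<close> increase with the norm, so the
    inequality \<open>nsq ?K V <= \<nu>\<close> from completeness suffices.\<close>
  have "FK p q s2 ?K V \<le> 0"
    unfolding FK_eq VQ using bal mult_left_mono[OF V(3), of s2] s2 by linarith
  moreover have "J ?K V \<le> l"
    unfolding Jc VQ using l_eq mult_left_mono[OF V(3), of c1] c1 by linarith
  moreover have "0 < nsq ?K V" using nsq_pos_of_QK_pos[OF V(1) K] Mp by (simp add: VQ)
  ultimately show ?thesis
    using minimizer_of_J_le[OF K _ _ _ _] V(1) k unfolding l_def by (metis X_finite)
qed

end

section \<open>The Euler-Lagrange equation of periodic minimizers\<close>

text \<open>Young's inequality with one factor equal to 1. It yields both the tangent inequality for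
  powers and the maximality of \<open>LK\<close> along rays.\<close>

lemma Bernoulli_powr:
  fixes r z :: real
  assumes r: "1 < r" and z: "0 \<le> z"
  shows "r * z \<le> (r - 1) + z powr r"
proof -
  have "1 * z \<le> 1 powr (r / (r - 1)) / (r / (r - 1)) + z powr r / r"
    using assms by (intro Youngs_inequality) (auto simp: field_simps)
  then have "r * z \<le> r * (1 powr (r / (r - 1)) / (r / (r - 1)) + z powr r / r)"
    using r by (intro mult_left_mono) auto
  also have "\<dots> = (r - 1) + z powr r" using r by (simp add: field_simps)
  finally show ?thesis .
qed

lemma Psi_mult_self: "Psi r w * w = r * \<bar>w\<bar> powr r" if "r \<noteq> 0"
proof (cases "w = 0")
  case False
  have "sgn w * \<bar>w\<bar> powr (r - 1) * w = \<bar>w\<bar> powr (r - 1) * \<bar>w\<bar> powr 1"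
    using False by (simp add: sgn_if abs_if)
  also have "\<dots> = \<bar>w\<bar> powr r" by (simp only: powr_add[symmetric]) simp
  finally show ?thesis by (simp add: Psi_def mult.assoc)
qed (simp add: Psi_def)

lemma abs_Psi: "0 \<le> r \<Longrightarrow> \<bar>Psi r w\<bar> = r * \<bar>w\<bar> powr (r - 1)"
  by (cases "w = 0") (auto simp: Psi_def abs_mult sgn_if)

lemma abs_Psi_le: "1 \<le> r \<Longrightarrow> \<bar>w\<bar> \<le> c \<Longrightarrow> \<bar>Psi r w\<bar> \<le> r * c powr (r - 1)"
  by (auto simp: abs_Psi intro!: mult_left_mono powr_mono2)

text \<open>The graph of the \<open>r\<close>-th power lies above its tangent at \<open>b\<close>;
  the mixed term is handled by Bernoulli's inequality for the ratio of \<open>|a|\<close> to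
  \<open>|b|\<close>, multiplied by \<open>|b| powr r\<close>.\<close>

lemma powr_convexity:
  fixes a b r :: real
  assumes "1 < r"
  shows "\<bar>b\<bar> powr r - \<bar>a\<bar> powr r \<le> Psi r b * (b - a)"
proof -
  have "Psi r b * a \<le> \<bar>Psi r b * a\<bar>" by simp
  also have "\<dots> = r * \<bar>b\<bar> powr (r - 1) * \<bar>a\<bar>" using assms by (simp add: abs_mult abs_Psi)
  also have "\<dots> \<le> (r - 1) * \<bar>b\<bar> powr r + \<bar>a\<bar> powr r"
  proof (cases "b = 0")
    case False
    have "r * (\<bar>a\<bar> / \<bar>b\<bar>) \<le> (r - 1) + (\<bar>a\<bar> / \<bar>b\<bar>) powr r"
      using assms by (intro Bernoulli_powr) auto
    then have "r * (\<bar>a\<bar> / \<bar>b\<bar>) * \<bar>b\<bar> powr r \<le> ((r - 1) + (\<bar>a\<bar> / \<bar>b\<bar>) powr r) * \<bar>b\<bar> powr r"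
      by (intro mult_right_mono) auto
    moreover have "r * (\<bar>a\<bar> / \<bar>b\<bar>) * \<bar>b\<bar> powr r = r * \<bar>b\<bar> powr (r - 1) * \<bar>a\<bar>"
      using False by (simp add: powr_diff)
    moreover have "((r - 1) + (\<bar>a\<bar> / \<bar>b\<bar>) powr r) * \<bar>b\<bar> powr r = (r - 1) * \<bar>b\<bar> powr r + \<bar>a\<bar> powr r"
      using False by (simp add: powr_divide field_simps)
    ultimately show ?thesis by simp
  qed simp
  finally show ?thesis using Psi_mult_self[of r b] assms by (simp add: algebra_simps)
qed

lemma Psi_tendsto:
  assumes "(u \<longlongrightarrow> v) F" "1 < r"
  shows "((\<lambda>n. Psi r (u n)) \<longlongrightarrow> Psi r v) F"
proof (cases "v = 0")
  case False
  then show ?thesis unfolding Psi_def using assms by (intro tendsto_intros) auto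
next
  case True
  \<comment> \<open>\<open>sgn\<close> is discontinuous at 0, so here convergence is obtained for
    the absolute value of \<open>Psi\<close>.\<close>
  have "((\<lambda>n. r * \<bar>u n\<bar> powr (r - 1)) \<longlongrightarrow> r * \<bar>v\<bar> powr (r - 1)) F"
    using assms by (intro tendsto_mult tendsto_const tendsto_powr' tendsto_rabs) auto
  then have "((\<lambda>n. \<bar>Psi r (u n)\<bar>) \<longlongrightarrow> 0) F" using assms True by (simp add: abs_Psi)
  then show ?thesis using True by (simp add: tendsto_rabs_zero_iff Psi_def)
qed

lemma Psi_measurable [measurable]: "Psi r \<in> borel_measurable borel"
  unfolding Psi_def[abs_def] by measurable

lemma L2_bounded:
  assumes [measurable]: "f \<in> borel_measurable borel" and "per (ereal k) f" and b: "\<And>x. \<bar>f x\<bar> \<le> C"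
  shows "L2 (ereal k) f"
proof -
  have "integrable (mu (ereal k)) (\<lambda>x. (f x)\<^sup>2)"
    by (rule finite_measure.integrable_const_bound[OF finite_measure_mu, of _ "C\<^sup>2"])
       (use b in \<open>auto simp: abs_le_square_iff intro!: AE_I2 power2_le_iff_abs_le[THEN iffD2] order_trans[OF abs_ge_zero b]\<close>)
  then show ?thesis using assms by (simp add: L2_def)
qed

lemma L2_finite_integrable:
  assumes "L2 (ereal k) h"
  shows "integrable (mu (ereal k)) h"
proof -
  note [measurable] = L2D(1)[OF assms]
  have "integrable (mu (ereal k)) (\<lambda>x. h x * 1)"
    using L2D(3)[OF assms] finite_measure.integrable_const[OF finite_measure_mu, of k "1::real"]
    by (intro integrable_mult_sq) auto
  then show ?thesis by simp
qed

lemma nsq_add: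
  assumes "L2 K U" "L2 K W"
  shows "nsq K (\<lambda>x. U x + c * W x) = nsq K U + 2 * c * (\<integral>x. U x * W x \<partial>mu K) + c\<^sup>2 * nsq K W"
proof -
  have "(\<lambda>x. (U x + c * W x)\<^sup>2) = (\<lambda>x. (U x)\<^sup>2 + 2 * c * (U x * W x) + c\<^sup>2 * (W x)\<^sup>2)"
    by (simp add: power2_eq_square algebra_simps)
  then show ?thesis
    using L2D[OF assms(1)] L2D[OF assms(2)] integrable_mult_sq[of U "mu K" W]
    by (simp add: nsq_def)
qed

lemma shift_L2:
  assumes "L2 K W" "0 < K"
  shows "L2 K (\<lambda>x. W (x + s))" "nsq K (\<lambda>x. W (x + s)) = nsq K W"
proof -
  note [measurable] = L2D(1)[OF assms(1)]
  have p: "per K (\<lambda>x. (W x)\<^sup>2)" using L2D(2)[OF assms(1)] by (rule per_comp)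
  have "per K (\<lambda>x. W (x + s))"
    using L2D(2)[OF assms(1)] unfolding per_def by (metis add.assoc add.commute)
  then show "L2 K (\<lambda>x. W (x + s))"
    using integral_mu_translate(1)[OF _ p assms(2), of s] L2D(3)[OF assms(1)] by (simp add: L2_def)
  show "nsq K (\<lambda>x. W (x + s)) = nsq K W"
    using integral_mu_translate(2)[OF _ p assms(2), of s] by (simp add: nsq_def)
qed

lemma avgop_shift: "avgop (\<lambda>x. W (x + s)) x = avgop W (x + s)"
  by (simp add: avgop_win algebra_simps)

lemma shift_QK:
  assumes "L2 K W" "0 < K"
  shows "QK r K (\<lambda>x. W (x + s)) = QK r K W"
    "integrable (mu K) (\<lambda>x. \<bar>avgop (\<lambda>x. W (x + s)) x\<bar> powr r) \<longleftrightarrow> integrable (mu K) (\<lambda>x. \<bar>avgop W x\<bar> powr r)"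
proof -
  note [measurable] = L2D(1)[OF assms(1)]
  have p: "per K (\<lambda>x. \<bar>avgop W x\<bar> powr r)"
    using avgop_per[OF L2D(2)[OF assms(1)]] by (rule per_comp)
  show "QK r K (\<lambda>x. W (x + s)) = QK r K W"
    unfolding QK_mu avgop_shift by (rule integral_mu_translate(2)[OF _ p assms(2)]) measurable
  show "integrable (mu K) (\<lambda>x. \<bar>avgop (\<lambda>x. W (x + s)) x\<bar> powr r) \<longleftrightarrow> integrable (mu K) (\<lambda>x. \<bar>avgop W x\<bar> powr r)"
    unfolding avgop_shift by (rule integral_mu_translate(1)[OF _ p assms(2)]) measurable
qed

context ground_wave
begin

text \<open>Required at every point, not almost everywhere: pointwise convergence of averages can
  then be transferred to the waves themselves.\<close>

definition EL where
  "EL W \<longleftrightarrow> (\<forall>x. s2 * W x + avgop (\<lambda>s. Psi q (avgop W s)) x = avgop (\<lambda>s. Psi p (avgop W s)) x)"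

text \<open>The left side is \<open>LK\<close> of \<open>t W\<close>. Eliminating
  \<open>QK p\<close> by the constraint leaves nonnegative multiples of
  \<open>t powr r / r - t powr p / p\<close> for \<open>r = 2\<close> and \<open>r = q\<close>. Each
  is maximal at \<open>t = 1\<close>, by Bernoulli's inequality with exponent \<open>p / r\<close>
  at \<open>t powr r\<close>.\<close>

lemma LK_max_on_ray:
  assumes "1 \<le> K" "FK p q s2 K W = 0" "0 < t"
  shows "t\<^sup>2 * (s2 * nsq K W / 2) + t powr q * QK q K W - t powr p * QK p K W \<le> LK p q s2 K W"
proof -
  define a where "a = s2 * nsq K W"
  define Q where "Q = QK q K W"
  have a: "0 \<le> a" "0 \<le> Q" using s2 by (auto simp: a_def Q_def)
  have P: "QK p K W = (a + q * Q) / p" using assms(2) p2 by (simp add: FK_eq a_def Q_def field_simps)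
  have ineq: "t powr r / r - t powr p / p \<le> 1 / r - 1 / p" if r: "0 < r" "r < p" for r
  proof -
    have "p / r * t powr r \<le> (p / r - 1) + (t powr r) powr (p / r)"
      using r by (intro Bernoulli_powr) auto
    also have "(t powr r) powr (p / r) = t powr p" using r by (simp add: powr_powr)
    finally have "(p / r * t powr r) / p \<le> ((p / r - 1) + t powr p) / p"
      using p2 by (intro divide_right_mono) auto
    then show ?thesis using r p2 by (simp add: diff_divide_distrib add_divide_distrib)
  qed
  have "t\<^sup>2 / 2 - t powr p / p \<le> 1 / 2 - 1 / p" using ineq[of 2] p2 assms(3) by simp
  from mult_left_mono[OF this a(1)] have 1: "a * (t\<^sup>2 / 2 - t powr p / p) \<le> a * (1 / 2 - 1 / p)" .
  have "t powr q / q - t powr p / p \<le> 1 / q - 1 / p" using ineq[of q] q1 qp by simp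
  then have "(q * Q) * (t powr q / q - t powr p / p) \<le> (q * Q) * (1 / q - 1 / p)"
    using a q1 by (intro mult_left_mono) auto
  moreover have "(q * Q) * (t powr q / q - t powr p / p) = t powr q * Q - t powr p * (q * Q / p)"
    "(q * Q) * (1 / q - 1 / p) = Q - q * Q / p"
    using q1 by (auto simp: field_simps)
  ultimately have "a * (t\<^sup>2 / 2 - t powr p / p) + (t powr q * Q - t powr p * (q * Q / p))
      \<le> a * (1 / 2 - 1 / p) + (Q - q * Q / p)" using 1 by linarith
  moreover have "t\<^sup>2 * (a / 2) + t powr q * Q - t powr p * ((a + q * Q) / p)
      = a * (t\<^sup>2 / 2 - t powr p / p) + (t powr q * Q - t powr p * (q * Q / p))"
    by (simp add: algebra_simps add_divide_distrib)
  moreover have "LK p q s2 K W = a * (1 / 2 - 1 / p) + (Q - q * Q / p)"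
    unfolding LK_eq P by (simp add: a_def Q_def algebra_simps add_divide_distrib)
  ultimately show ?thesis unfolding P by (simp add: a_def Q_def)
qed

text \<open>No differentiation of \<open>\<L>\<close> is needed: rescale \<open>W + s h\<close> into the Nehari set by \<open>t \<rightarrow> 1\<close> and combine
\<open>\<L>(t W) \<le> \<L>(W) \<le> \<L>(t (W + s h))\<close> with convexity of \<open>\<bar>\<cdot>\<bar>\<^sup>q\<close> and \<open>\<bar>\<cdot>\<bar>\<^sup>p\<close>.\<close>
lemma first_variation:
  assumes k: "1 \<le> k" and W: "is_minimizer p q s2 (ereal k) W" and h: "L2 (ereal k) h"
  shows "0 \<le> s2 * (\<integral>x. W x * h x \<partial>mu (ereal k))
      + (\<integral>x. Psi q (avgop W x) * avgop h x \<partial>mu (ereal k))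
      - (\<integral>x. Psi p (avgop W x) * avgop h x \<partial>mu (ereal k))"
proof -
  let ?K = "ereal k"
  have K: "1 \<le> ?K" using k by simp
  note WD = is_minimizerD[OF W K]
  have WL: "L2 ?K W" using WD(1) by (simp add: X_def)
  note [measurable] = L2D(1)[OF WL] L2D(1)[OF h]
  define s where "s n = 1 / real (Suc n)" for n
  have s0: "s \<longlonglongrightarrow> 0" unfolding s_def using LIMSEQ_Suc[OF lim_1_over_n] by simp
  have sp: "0 < s n" "s n \<le> 1" for n by (auto simp: s_def)
  define U where "U n x = W x + s n * h x" for n x
  have UL: "L2 ?K (U n)" for n unfolding U_def[abs_def] by (intro L2_add L2_cmult WL h)
  note [measurable] = L2D(1)[OF UL]
  have aU: "avgop (U n) x = avgop W x + s n * avgop h x" for n x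
    unfolding U_def[abs_def] by (simp only: avgop_add[OF WL L2_cmult[OF h] K] avgop_cmult)
  define B where "B = sqrt (nsq ?K W) + sqrt (nsq ?K h)"
  have aUB: "\<bar>avgop (U n) x\<bar> \<le> B" for n x
  proof -
    have "\<bar>avgop (U n) x\<bar> \<le> \<bar>avgop W x\<bar> + s n * \<bar>avgop h x\<bar>"
      unfolding aU using abs_triangle_ineq[of "avgop W x" "s n * avgop h x"] sp[of n] by (simp add: abs_mult)
    also have "\<dots> \<le> \<bar>avgop W x\<bar> + 1 * \<bar>avgop h x\<bar>" using sp[of n] by (intro add_left_mono mult_right_mono) auto
    finally show ?thesis using avgop_le[OF WL K, of x] avgop_le[OF h K, of x] by (simp add: B_def)
  qed
  have aWB: "\<bar>avgop W x\<bar> \<le> B" for x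
    using avgop_le[OF WL K, of x] real_sqrt_ge_zero[of "nsq ?K h"] by (simp add: B_def add_increasing2)
  have aUl: "(\<lambda>n. avgop (U n) x) \<longlonglongrightarrow> avgop W x" for x
    unfolding aU using tendsto_add[OF tendsto_const tendsto_mult[OF s0 tendsto_const]] by fastforce
  have Ql: "(\<lambda>n. QK r ?K (U n)) \<longlonglongrightarrow> QK r ?K W" if "0 < r" for r
    unfolding QK_mu by (rule powr_integral_tendsto[OF _ aUl aUB that]) measurable
  define c where "c = (\<integral>x. W x * h x \<partial>mu ?K)"
  have nU: "nsq ?K (U n) = nsq ?K W + 2 * s n * c + (s n)\<^sup>2 * nsq ?K h" for n
    unfolding U_def[abs_def] c_def by (rule nsq_add[OF WL h])
  have "(\<lambda>n. nsq ?K (U n)) \<longlonglongrightarrow> nsq ?K W + 2 * 0 * c + 0\<^sup>2 * nsq ?K h"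
    unfolding nU by (intro tendsto_intros s0)
  then have nl: "(\<lambda>n. nsq ?K (U n)) \<longlonglongrightarrow> nsq ?K W" by simp
  have Pl: "(\<lambda>n. p * QK p ?K (U n)) \<longlonglongrightarrow> s2 * nsq ?K W + q * QK q ?K W"
  proof -
    have "(\<lambda>n. p * QK p ?K (U n)) \<longlonglongrightarrow> p * QK p ?K W" using p2 by (intro tendsto_intros Ql) auto
    then show ?thesis using WD(3) by (simp add: FK_eq)
  qed
  obtain t where t: "t \<longlonglongrightarrow> 1"
    "\<forall>\<^sub>F n in sequentially. 0 < t n \<and> m (s2 * nsq ?K (U n)) (q * QK q ?K (U n)) (t n) = p * QK p ?K (U n)"
  proof (rule Nehari_root_stable)
    show "(\<lambda>n. s2 * nsq ?K (U n)) \<longlonglongrightarrow> s2 * nsq ?K W" by (intro tendsto_intros nl)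
    show "(\<lambda>n. q * QK q ?K (U n)) \<longlonglongrightarrow> q * QK q ?K W" using q1 by (intro tendsto_intros Ql) auto
    show "0 < s2 * nsq ?K W" using s2 WD(2) by simp
    show "0 \<le> q * QK q ?K (U n)" for n using q1 by simp
  qed (use Pl that in auto)
  define D where "D r n = (\<integral>x. Psi r (avgop (U n) x) * avgop h x \<partial>mu ?K)" for r n
  define D0 where "D0 r = (\<integral>x. Psi r (avgop W x) * avgop h x \<partial>mu ?K)" for r
  have ah: "integrable (mu ?K) (\<lambda>x. \<bar>avgop h x\<bar>)"
    using L2_finite_integrable[OF avgop_L2(1)[OF h K]] by simp
  have PsiI: "integrable (mu ?K) (\<lambda>x. Psi r (u x) * avgop h x)"
    if "1 \<le> r" "\<And>x. \<bar>u x\<bar> \<le> B" and [measurable]: "u \<in> borel_measurable borel" for r u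
    by (rule Bochner_Integration.integrable_bound[OF integrable_mult_right[OF ah, of "r * B powr (r - 1)"]])
       (use abs_Psi_le[OF that(1,2)] that(1) in \<open>auto simp: abs_mult intro!: AE_I2 mult_right_mono\<close>)
  have powI: "integrable (mu ?K) (\<lambda>x. \<bar>u x\<bar> powr r)"
    if "1 \<le> r" "\<And>x. \<bar>u x\<bar> \<le> B" and [measurable]: "u \<in> borel_measurable borel" for r u
    by (rule finite_measure.integrable_const_bound[OF finite_measure_mu, of _ "B powr r"])
       (use that in \<open>auto intro!: AE_I2 powr_mono2\<close>)
  have Dl: "D q \<longlonglongrightarrow> D0 q"
    unfolding D_def D0_def
  proof (rule integral_dominated_convergence)
    show "integrable (mu ?K) (\<lambda>x. q * B powr (q - 1) * \<bar>avgop h x\<bar>)" using ah by simp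
    show "AE x in mu ?K. (\<lambda>n. Psi q (avgop (U n) x) * avgop h x) \<longlonglongrightarrow> Psi q (avgop W x) * avgop h x"
      using q1 by (intro AE_I2 tendsto_intros Psi_tendsto aUl)
    show "AE x in mu ?K. norm (Psi q (avgop (U n) x) * avgop h x) \<le> q * B powr (q - 1) * \<bar>avgop h x\<bar>" for n
      using abs_Psi_le[OF _ aUB, of q n] q1 by (auto simp: abs_mult intro!: AE_I2 mult_right_mono)
  qed measurable
  \<comment> \<open>An upper bound for \<open>QK q\<close> is wanted, so the tangent is taken at
    \<open>U n\<close>; its slope \<open>D q n\<close> varies with \<open>n\<close>, which is why
    \<open>Dl\<close> is required. For \<open>QK p\<close> the opposite bound is wanted, and the
    tangent at \<open>W\<close> gives the fixed slope \<open>D0 p\<close>.\<close>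
  have Qup: "QK q ?K (U n) \<le> QK q ?K W + s n * D q n" for n
  proof -
    have "QK q ?K (U n) - QK q ?K W = (\<integral>x. \<bar>avgop (U n) x\<bar> powr q - \<bar>avgop W x\<bar> powr q \<partial>mu ?K)"
      unfolding QK_mu using powI[OF _ aUB] powI[OF _ aWB] q1 by simp
    also have "\<dots> \<le> (\<integral>x. s n * (Psi q (avgop (U n) x) * avgop h x) \<partial>mu ?K)"
    proof (rule integral_mono)
      show "integrable (mu ?K) (\<lambda>x. \<bar>avgop (U n) x\<bar> powr q - \<bar>avgop W x\<bar> powr q)"
        using powI[OF _ aUB] powI[OF _ aWB] q1 by simp
      show "integrable (mu ?K) (\<lambda>x. s n * (Psi q (avgop (U n) x) * avgop h x))"
        using PsiI[OF _ aUB] q1 by simp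
      show "\<bar>avgop (U n) x\<bar> powr q - \<bar>avgop W x\<bar> powr q \<le> s n * (Psi q (avgop (U n) x) * avgop h x)" for x
        using powr_convexity[OF q1, of "avgop (U n) x" "avgop W x"] by (simp add: aU mult.left_commute)
    qed
    finally show ?thesis by (simp add: D_def)
  qed
  have Pup: "QK p ?K W + s n * D0 p \<le> QK p ?K (U n)" for n
  proof -
    have p1: "1 < p" using p2 by simp
    have "- (s n * D0 p) = (\<integral>x. - (s n * (Psi p (avgop W x) * avgop h x)) \<partial>mu ?K)"
      by (simp add: D0_def)
    also have "(\<integral>x. \<bar>avgop W x\<bar> powr p - \<bar>avgop (U n) x\<bar> powr p \<partial>mu ?K) \<le> \<dots>"
    proof (rule integral_mono)
      show "integrable (mu ?K) (\<lambda>x. \<bar>avgop W x\<bar> powr p - \<bar>avgop (U n) x\<bar> powr p)"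
        using powI[OF _ aUB] powI[OF _ aWB] p1 by simp
      show "integrable (mu ?K) (\<lambda>x. - (s n * (Psi p (avgop W x) * avgop h x)))"
        using PsiI[OF _ aWB] p1 by simp
      show "\<bar>avgop W x\<bar> powr p - \<bar>avgop (U n) x\<bar> powr p \<le> - (s n * (Psi p (avgop W x) * avgop h x))" for x
        using powr_convexity[OF p1, of "avgop W x" "avgop (U n) x"] by (simp add: aU mult.left_commute)
    qed
    also have "(\<integral>x. \<bar>avgop W x\<bar> powr p - \<bar>avgop (U n) x\<bar> powr p \<partial>mu ?K) = QK p ?K W - QK p ?K (U n)"
      unfolding QK_mu using powI[OF _ aUB] powI[OF _ aWB] p1 by simp
    finally show ?thesis by simp
  qed
  have np: "\<forall>\<^sub>F n in sequentially. 0 < nsq ?K (U n)" using order_tendstoD(1)[OF nl WD(2)] .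
  \<comment> \<open>The bound for the difference of \<open>LK\<close> at \<open>t n * U n\<close>
    and at \<open>t n * W\<close>, divided by \<open>s n\<close>; its limit is the first variation
    in the direction \<open>h\<close>.\<close>
  define R where "R n = (t n)\<^sup>2 * (s2 * c + s n * s2 * nsq ?K h / 2) + t n powr q * D q n - t n powr p * D0 p" for n
  have alg: "T * (s2 * (N + 2 * e * C + e\<^sup>2 * H) / 2) + Tq * (Q + e * D) - Tp * (P + e * D')
      = T * (s2 * N / 2) + Tq * Q - Tp * P + e * (T * (s2 * C + e * s2 * H / 2) + Tq * D - Tp * D')"
    for T N e C H Tq Q D Tp P D' :: real
    by (simp add: field_simps power2_eq_square)
  have "\<forall>\<^sub>F n in sequentially. 0 \<le> R n"
    using np t(2)
  proof eventually_elim
    case (elim n)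
    have tn: "0 < t n" using elim by simp
    have M: "(\<lambda>x. t n * U n x) \<in> MK p q s2 ?K"
      using elim UL X_finite[OF k] by (intro MK_scaled K) auto
    have "LK p q s2 ?K W \<le> LK p q s2 ?K (\<lambda>x. t n * U n x)" using W M by (simp add: is_minimizer_def)
    also have "\<dots> = (t n)\<^sup>2 * (s2 * nsq ?K (U n) / 2) + t n powr q * QK q ?K (U n) - t n powr p * QK p ?K (U n)"
      using tn by (simp add: LK_eq nsq_cmult QK_cmult)
    also have "\<dots> \<le> (t n)\<^sup>2 * (s2 * nsq ?K (U n) / 2) + t n powr q * (QK q ?K W + s n * D q n)
        - t n powr p * (QK p ?K W + s n * D0 p)"
      by (intro diff_mono add_mono mult_left_mono Qup Pup) auto
    also have "\<dots> = (t n)\<^sup>2 * (s2 * nsq ?K W / 2) + t n powr q * QK q ?K W - t n powr p * QK p ?K W + s n * R n"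
      unfolding nU R_def by (rule alg)
    finally have "LK p q s2 ?K W \<le> (t n)\<^sup>2 * (s2 * nsq ?K W / 2) + t n powr q * QK q ?K W - t n powr p * QK p ?K W + s n * R n" .
    with LK_max_on_ray[OF K WD(3) tn] have "0 \<le> s n * R n" by linarith
    then show ?case using sp(1)[of n] by (simp add: zero_le_mult_iff)
  qed
  moreover have "R \<longlonglongrightarrow> 1\<^sup>2 * (s2 * c + 0 * s2 * nsq ?K h / 2) + 1 powr q * D0 q - 1 powr p * D0 p"
    unfolding R_def by (intro tendsto_intros t s0 Dl) auto
  ultimately have "0 \<le> 1\<^sup>2 * (s2 * c + 0 * s2 * nsq ?K h / 2) + 1 powr q * D0 q - 1 powr p * D0 p"
    by (intro tendsto_lowerbound[where F = sequentially]) auto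
  then show ?thesis by (simp add: c_def D0_def)
qed

text \<open>Since averaging is self-adjoint, testing with minus the residual \<open>E\<close> of the
  equation turns the first variation into \<open>0 <= - nsq ?K E\<close>. The one-sided inequality
  is therefore enough.\<close>

lemma minimizer_EL:
  assumes k: "1 \<le> k" and W: "is_minimizer p q s2 (ereal k) W"
  obtains V where "is_minimizer p q s2 (ereal k) V" "EL V"
proof -
  let ?K = "ereal k"
  have K: "1 \<le> ?K" using k by simp
  note WD = is_minimizerD[OF W K]
  have WL: "L2 ?K W" using WD(1) by (simp add: X_def)
  note [measurable] = L2D(1)[OF WL]
  have PL: "L2 ?K (\<lambda>s. Psi r (avgop W s))" if "1 \<le> r" for r
    by (rule L2_bounded[OF _ per_comp[OF avgop_per[OF L2D(2)[OF WL]], of "Psi r"] abs_Psi_le[OF that avgop_le[OF WL K]]])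
       measurable
  define G where "G r = avgop (\<lambda>s. Psi r (avgop W s))" for r
  have GL: "L2 ?K (G r)" if "1 \<le> r" for r unfolding G_def using avgop_L2(1)[OF PL[OF that] K] .
  define E where "E x = (s2 * W x + G q x) - G p x" for x
  have EL: "L2 ?K E" unfolding E_def[abs_def] using q1 p2 by (intro L2_diff L2_add L2_cmult WL GL) auto
  define h where "h x = (-1) * E x" for x
  have hL: "L2 ?K h" unfolding h_def[abs_def] by (intro L2_cmult EL)
  note [measurable] = L2D(1)[OF hL] L2D(1)[OF EL]
  have GI: "integrable (mu ?K) (\<lambda>x. h x * G r x)" if "1 \<le> r" for r
    using L2D[OF hL] L2D[OF GL[OF that]] by (intro integrable_mult_sq) auto
  have sa: "(\<integral>x. Psi r (avgop W x) * avgop h x \<partial>mu ?K) = (\<integral>x. h x * G r x \<partial>mu ?K)" if "1 \<le> r" for r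
    unfolding G_def using k abs_Psi_le[OF that avgop_le[OF WL K]] L2D[OF PL[OF that]] L2D[OF hL]
    by (intro avgop_selfadjoint[symmetric] L2_finite_integrable[OF hL]) auto
  have WI: "integrable (mu ?K) (\<lambda>x. W x * h x)"
    using L2D[OF hL] L2D[OF WL] by (intro integrable_mult_sq) auto
  have "0 \<le> s2 * (\<integral>x. W x * h x \<partial>mu ?K) + (\<integral>x. h x * G q x \<partial>mu ?K) - (\<integral>x. h x * G p x \<partial>mu ?K)"
    using first_variation[OF k W hL] sa q1 p2 by simp
  also have "\<dots> = (\<integral>x. s2 * (W x * h x) + h x * G q x - h x * G p x \<partial>mu ?K)"
    using WI GI[of q] GI[of p] q1 p2 by simp
  also have "(\<lambda>x. s2 * (W x * h x) + h x * G q x - h x * G p x) = (\<lambda>x. - (E x)\<^sup>2)"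
    by (simp add: h_def E_def power2_eq_square algebra_simps)
  finally have "nsq ?K E \<le> 0" by (simp add: nsq_def)
  then have E0: "nsq ?K E = 0" using nsq_nonneg[of ?K E] by linarith
  \<comment> \<open>\<open>E = 0\<close> holds only almost everywhere; this representative satisfies the equation at every point.\<close>
  define V where "V x = W x + (- 1 / s2) * E x" for x
  have V: "V x = (G p x - G q x) / s2" for x using s2 by (simp add: V_def E_def field_simps)
  have VL: "L2 ?K V" unfolding V_def[abs_def] by (intro L2_add L2_cmult WL EL)
  \<comment> \<open>Averages ignore null sets, so they agree at every point, and the nonlinear terms
    of the equation are the same for \<open>V\<close> and \<open>W\<close>.\<close>
  have av: "avgop V = avgop W"
  proof
    fix x
    have "avgop E x = 0" using avgop_le[OF EL K, of x] by (simp add: E0)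
    then show "avgop V x = avgop W x" unfolding V_def[abs_def] by (simp only: avgop_add[OF WL L2_cmult[OF EL] K] avgop_cmult)
  qed
  have nV: "nsq ?K V = nsq ?K W"
  proof -
    have "AE x in mu ?K. (E x)\<^sup>2 = 0"
      using integral_nonneg_eq_0_iff_AE[OF L2D(3)[OF EL]] E0 by (simp add: nsq_def)
    then have "AE x in mu ?K. (V x)\<^sup>2 = (W x)\<^sup>2"
      by eventually_elim (simp add: V_def)
    then show ?thesis unfolding nsq_def using L2D(1)[OF VL] by (intro integral_cong_AE) auto
  qed
  have QV: "QK r ?K V = QK r ?K W" for r by (simp add: QK_mu av)
  have "is_minimizer p q s2 ?K V"
    using WD K VL k by (intro is_minimizerI) (auto simp: X_finite nV FK_eq QV J_def)
  moreover have "EL V" unfolding EL_def av using V s2 by (simp add: G_def field_simps)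
  ultimately show thesis by (rule that)
qed

lemma EL_shift: "EL W \<Longrightarrow> EL (\<lambda>x. W (x + s))"
  unfolding EL_def using avgop_shift[of "\<lambda>x. Psi _ (avgop W x)" s] by (simp add: avgop_shift)

lemma minimizer_shift:
  assumes "is_minimizer p q s2 K W" "1 \<le> K"
  shows "is_minimizer p q s2 K (\<lambda>x. W (x + s))"
proof -
  have K0: "0 < K" using assms(2) by (auto intro: less_le_trans[of 0 1])
  note WD = is_minimizerD[OF assms]
  have WL: "L2 K W" using WD(1) by (simp add: X_def)
  show ?thesis using WD assms(2) shift_L2[OF WL K0] shift_QK[OF WL K0]
    by (intro is_minimizerI) (auto simp: X_def FK_eq J_def)
qed

text \<open>If the average stayed below \<open>cmin / 2\<close> in absolute value,
  \<open>cmin_le\<close> would give \<open>cmin <= cmin / 2\<close>; the factor one half avoids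
  asking whether the supremum is attained. Translation to the chosen point preserves minimality and
  the equation.\<close>

lemma minimizer_EL_centred:
  assumes k: "1 \<le> k"
  obtains W where "is_minimizer p q s2 (ereal k) W" "EL W" "cmin / 2 \<le> \<bar>avgop W 0\<bar>"
proof -
  have K: "1 \<le> ereal k" using k by simp
  obtain V where V: "is_minimizer p q s2 (ereal k) V" "EL V"
    using minimizer_exists_finite[OF k] minimizer_EL[OF k] by metis
  note VD = is_minimizerD[OF V(1) K]
  have VL: "L2 (ereal k) V" using VD(1) by (simp add: X_def)
  have "\<exists>x. cmin / 2 \<le> \<bar>avgop V x\<bar>"
  proof (rule ccontr)
    assume "\<not> ?thesis"
    then have "cmin \<le> cmin / 2" using VD by (intro cmin_le[OF VL K]) (auto simp: not_le less_imp_le)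
    then show False using cmin_pos by simp
  qed
  then obtain x where "cmin / 2 \<le> \<bar>avgop V x\<bar>" by blast
  then show thesis
    using minimizer_shift[OF V(1) K, of x] EL_shift[OF V(2), of x] that by (simp add: avgop_shift)
qed

end

section \<open>Truncation and periodization\<close>

lemma per_PInf [simp]: "per \<infinity> f"
  by (simp add: per_def)

lemma nsq_PInf: "nsq \<infinity> W = (\<integral>x. (W x)\<^sup>2 \<partial>lborel)"
  by (simp add: nsq_def mu_PInf)

definition trunc :: "real \<Rightarrow> (real \<Rightarrow> real) \<Rightarrow> real \<Rightarrow> real" where
  "trunc R W x = indicator {-R<..R} x * W x"

text \<open>A window centred at distance at least \<open>R - 1/2\<close> from the origin reaches
  only points at distance at least \<open>R - 1\<close>; hence the radius. The norm of this function
  controls the error of a cut-off at \<open>R\<close>.\<close>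

definition tail :: "real \<Rightarrow> (real \<Rightarrow> real) \<Rightarrow> real \<Rightarrow> real" where
  "tail R W x = indicator {y. R - 1 \<le> \<bar>y\<bar>} x * W x"

text \<open>Covers the centres whose window can meet the cut at \<open>R\<close> or
  \<open>-R\<close>. It is a sum of two indicators instead of one for the union, so that its
  integral is 2 even when the intervals overlap.\<close>

definition ann :: "real \<Rightarrow> real \<Rightarrow> real" where
  "ann R x = indicator {-R-1/2..-R+1/2} x + indicator {R-1/2..R+1/2} x"

lemma L2_indicator:
  assumes "L2 \<infinity> W" "A \<in> sets borel"
  shows "L2 \<infinity> (\<lambda>x. indicator A x * W x)" "nsq \<infinity> (\<lambda>x. indicator A x * W x) \<le> nsq \<infinity> W"
proof -
  note [measurable] = L2D(1)[OF assms(1)] assms(2)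
  have 1: "integrable (mu \<infinity>) (\<lambda>x. (indicator A x * W x)\<^sup>2)"
    by (rule Bochner_Integration.integrable_bound[OF L2D(3)[OF assms(1)]])
       (auto intro!: AE_I2 simp: indicator_def)
  then show "L2 \<infinity> (\<lambda>x. indicator A x * W x)" by (simp add: L2_def)
  show "nsq \<infinity> (\<lambda>x. indicator A x * W x) \<le> nsq \<infinity> W"
    unfolding nsq_def using 1 L2D(3)[OF assms(1)] by (intro integral_mono) (auto simp: indicator_def)
qed

lemma tail_set_borel [measurable]: "{y. R - 1 \<le> \<bar>y\<bar>} \<in> sets (borel :: real measure)"
  by measurable

lemma trunc_L2: "L2 \<infinity> W \<Longrightarrow> L2 \<infinity> (trunc R W)" "L2 \<infinity> W \<Longrightarrow> nsq \<infinity> (trunc R W) \<le> nsq \<infinity> W"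
  unfolding trunc_def[abs_def] by (rule L2_indicator; simp)+

lemma tail_L2: "L2 \<infinity> W \<Longrightarrow> L2 \<infinity> (tail R W)"
  unfolding tail_def[abs_def] by (rule L2_indicator) simp_all

lemma one_le_PInf: "1 \<le> (\<infinity> :: ereal)"
  by simp

lemma avgop_trunc_inside:
  assumes "\<bar>x\<bar> < R - 1/2"
  shows "avgop (trunc R W) x = avgop W x"
  unfolding avgop_win using assms
  by (intro Bochner_Integration.integral_cong) (auto simp: trunc_def indicator_def)

lemma avgop_trunc_outside:
  assumes "R + 1/2 < \<bar>x\<bar>"
  shows "avgop (trunc R W) x = 0"
proof -
  have "avgop (trunc R W) x = (\<integral>s. 0 \<partial>win)"
    unfolding avgop_win using assms
    by (intro Bochner_Integration.integral_cong) (auto simp: trunc_def indicator_def)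
  then show ?thesis by simp
qed

lemma avgop_trunc_boundary:
  assumes W: "L2 \<infinity> W" and x: "R - 1/2 \<le> \<bar>x\<bar>"
  shows "\<bar>avgop (trunc R W) x\<bar> \<le> sqrt (nsq \<infinity> (tail R W))"
proof -
  note T = trunc_L2(1)[OF W, of R] and L = tail_L2[OF W, of R]
  have "(avgop (trunc R W) x)\<^sup>2 \<le> (\<integral>s. (trunc R W (x + s))\<^sup>2 \<partial>win)"
    by (rule avgop_sq_le_win[OF L2D(1)[OF T] L2_win(1)[OF T one_le_PInf]])
  also have "\<dots> \<le> (\<integral>s. (tail R W (x + s))\<^sup>2 \<partial>win)"
    using x by (intro integral_mono L2_win(1)[OF T one_le_PInf] L2_win(1)[OF L one_le_PInf])
      (auto simp: trunc_def tail_def indicator_def)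
  also have "\<dots> \<le> nsq \<infinity> (tail R W)" by (rule L2_win(2)[OF L one_le_PInf])
  finally show ?thesis by (simp add: real_le_rsqrt)
qed

lemma ann_nonneg [simp]: "0 \<le> ann R x"
  by (simp add: ann_def)

lemma ann_ge_1: "R - 1/2 \<le> \<bar>x\<bar> \<Longrightarrow> \<bar>x\<bar> \<le> R + 1/2 \<Longrightarrow> 1 \<le> ann R x"
  by (auto simp: ann_def indicator_def)

lemma ann_measurable [measurable]: "ann R \<in> borel_measurable borel"
  unfolding ann_def[abs_def] by measurable

lemma ann_integral: "integrable lborel (ann R)" "(\<integral>x. ann R x \<partial>lborel) = 2"
proof -
  have *: "integrable lborel (indicator {a..a+1::real} :: real \<Rightarrow> real)" for a by simp
  from *[of "-R-1/2"] *[of "R-1/2"]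
  have i: "integrable lborel (indicator {-R-1/2..-R+1/2::real} :: real \<Rightarrow> real)"
    "integrable lborel (indicator {R-1/2..R+1/2::real} :: real \<Rightarrow> real)" by (simp_all add: algebra_simps)
  then show "integrable lborel (ann R)" unfolding ann_def[abs_def] by simp
  show "(\<integral>x. ann R x \<partial>lborel) = 2" unfolding ann_def using i by (subst Bochner_Integration.integral_add) auto
qed

lemma tail_tendsto:
  assumes W: "L2 \<infinity> W"
  shows "(\<lambda>n. sqrt (nsq \<infinity> (tail (real n) W))) \<longlonglongrightarrow> 0"
proof -
  note [measurable] = L2D(1)[OF W] L2D(1)[OF tail_L2[OF W]]
  have "(\<lambda>n. nsq \<infinity> (tail (real n) W)) \<longlonglongrightarrow> (\<integral>x. 0 \<partial>mu \<infinity>)"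
    unfolding nsq_def
  proof (rule integral_dominated_convergence)
    show "integrable (mu \<infinity>) (\<lambda>x. (W x)\<^sup>2)" using L2D(3)[OF W] .
    show "AE x in mu \<infinity>. norm ((tail (real n) W x)\<^sup>2) \<le> (W x)\<^sup>2" for n
      by (auto intro!: AE_I2 simp: tail_def indicator_def)
    show "AE x in mu \<infinity>. (\<lambda>n. (tail (real n) W x)\<^sup>2) \<longlonglongrightarrow> 0"
    proof (intro AE_I2 tendsto_eventually)
      fix x
      have "\<forall>\<^sub>F n in sequentially. \<bar>x\<bar> + 1 < real n" by real_asymp
      then show "\<forall>\<^sub>F n in sequentially. (tail (real n) W x)\<^sup>2 = 0"
        by eventually_elim (auto simp: tail_def indicator_def)
    qed
  qed measurable
  then show ?thesis using tendsto_real_sqrt by fastforce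
qed

text \<open>Cutting off can destroy cancellation inside a window, so near the cut the average of the
  truncation is not bounded by that of \<open>W\<close>; the tail norm pays for it there. Further
  inside the two averages agree, further outside the new one is 0.\<close>

lemma trunc_powr_le:
  assumes W: "L2 \<infinity> W" and r: "0 < r"
  shows "\<bar>avgop (trunc R W) x\<bar> powr r \<le> \<bar>avgop W x\<bar> powr r + ann R x * sqrt (nsq \<infinity> (tail R W)) powr r"
proof -
  let ?d = "sqrt (nsq \<infinity> (tail R W))"
  consider "\<bar>x\<bar> < R - 1/2" | "R - 1/2 \<le> \<bar>x\<bar>" "\<bar>x\<bar> \<le> R + 1/2" | "R + 1/2 < \<bar>x\<bar>" by linarith
  then show ?thesis
  proof cases
    case 1
    then show ?thesis by (simp add: avgop_trunc_inside)
  next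
    case 2
    have "\<bar>avgop (trunc R W) x\<bar> powr r \<le> ?d powr r"
      using avgop_trunc_boundary[OF W 2(1)] r by (intro powr_mono2) auto
    also have "\<dots> \<le> ann R x * ?d powr r"
      using mult_right_mono[OF ann_ge_1[OF 2], of "?d powr r"] by simp
    finally show ?thesis by (simp add: add_increasing)
  next
    case 3
    then show ?thesis using r by (simp add: avgop_trunc_outside)
  qed
qed

lemma trunc_QK_le:
  assumes W: "L2 \<infinity> W" and r: "0 < r" and i: "integrable (mu \<infinity>) (\<lambda>x. \<bar>avgop W x\<bar> powr r)"
  shows "integrable (mu \<infinity>) (\<lambda>x. \<bar>avgop (trunc R W) x\<bar> powr r)"
    and "QK r \<infinity> (trunc R W) \<le> QK r \<infinity> W + 2 * sqrt (nsq \<infinity> (tail R W)) powr r"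
proof -
  note [measurable] = L2D(1)[OF trunc_L2(1)[OF W]]
  let ?g = "\<lambda>x. \<bar>avgop W x\<bar> powr r + ann R x * sqrt (nsq \<infinity> (tail R W)) powr r"
  have g: "integrable (mu \<infinity>) ?g" using i ann_integral[of R] by (simp add: mu_PInf)
  show 1: "integrable (mu \<infinity>) (\<lambda>x. \<bar>avgop (trunc R W) x\<bar> powr r)"
    by (rule Bochner_Integration.integrable_bound[OF g])
       (use trunc_powr_le[OF W r] in \<open>auto intro!: AE_I2 order_trans[OF trunc_powr_le[OF W r]]\<close>)
  have "QK r \<infinity> (trunc R W) \<le> (\<integral>x. ?g x \<partial>mu \<infinity>)"
    unfolding QK_mu by (rule integral_mono[OF 1 g trunc_powr_le[OF W r]])
  also have "\<dots> = QK r \<infinity> W + 2 * sqrt (nsq \<infinity> (tail R W)) powr r"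
    unfolding QK_mu using i ann_integral[of R] by (simp add: mu_PInf)
  finally show "QK r \<infinity> (trunc R W) \<le> QK r \<infinity> W + 2 * sqrt (nsq \<infinity> (tail R W)) powr r" .
qed

lemma inner_tendsto:
  fixes f :: "real \<Rightarrow> real"
  assumes "integrable lborel f"
  shows "(\<lambda>n. \<integral>x. indicator {x. \<bar>x\<bar> < real n - 1/2} x * f x \<partial>lborel) \<longlonglongrightarrow> (\<integral>x. f x \<partial>lborel)"
proof (rule integral_dominated_convergence)
  note [measurable] = borel_measurable_integrable[OF assms]
  show "integrable lborel (\<lambda>x. \<bar>f x\<bar>)" using assms by simp
  show "f \<in> borel_measurable lborel" "(\<lambda>x. indicator {x. \<bar>x\<bar> < real n - 1/2} x * f x) \<in> borel_measurable lborel" for n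
    by measurable
  show "AE x in lborel. (\<lambda>n. indicator {x. \<bar>x\<bar> < real n - 1/2} x * f x) \<longlonglongrightarrow> f x"
  proof (intro AE_I2 tendsto_eventually)
    fix x :: real
    have "\<forall>\<^sub>F n in sequentially. \<bar>x\<bar> < real n - 1/2" by real_asymp
    then show "\<forall>\<^sub>F n in sequentially. indicator {x. \<bar>x\<bar> < real n - 1/2} x * f x = f x"
      by eventually_elim (auto simp: indicator_def)
  qed
qed (auto simp: indicator_def)

text \<open>Centres whose window does not feel the cut contribute the same to both integrals, and
  the boundary layer only adds. By \<open>inner_tendsto\<close> the inner part exhausts the full
  integral as \<open>R\<close> grows.\<close>

lemma trunc_QK_ge:
  assumes W: "L2 \<infinity> W" and r: "2 \<le> r"
  shows "(\<integral>x. indicator {x. \<bar>x\<bar> < R - 1/2} x * \<bar>avgop W x\<bar> powr r \<partial>lborel) \<le> QK r \<infinity> (trunc R W)"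
  unfolding QK_mu mu_PInf
proof (rule integral_mono)
  have 1: "integrable lborel (\<lambda>x. \<bar>avgop W x\<bar> powr r)"
    using avgop_powr_integrable[OF W one_le_PInf r] by (simp add: mu_PInf)
  note [measurable] = borel_measurable_integrable[OF 1]
  show "integrable lborel (\<lambda>x. indicator {x. \<bar>x\<bar> < R - 1/2} x * \<bar>avgop W x\<bar> powr r)"
    by (rule Bochner_Integration.integrable_bound[OF 1]) (auto simp: indicator_def)
  show "integrable lborel (\<lambda>x. \<bar>avgop (trunc R W) x\<bar> powr r)"
    using avgop_powr_integrable[OF trunc_L2(1)[OF W] one_le_PInf r] by (simp add: mu_PInf)
  show "indicator {x. \<bar>x\<bar> < R - 1/2} x * \<bar>avgop W x\<bar> powr r \<le> \<bar>avgop (trunc R W) x\<bar> powr r" for x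
    using avgop_trunc_inside[of x R W] by (auto simp: indicator_def)
qed

text \<open>The subtracted multiple of the period brings \<open>x\<close> into
  \<open>{-k<..k}\<close>; the ceiling, not the floor, matches the cell closed on the right.\<close>

definition periodize :: "real \<Rightarrow> (real \<Rightarrow> real) \<Rightarrow> real \<Rightarrow> real" where
  "periodize k W x = W (x - 2 * k * of_int \<lceil>(x - k) / (2 * k)\<rceil>)"

lemma periodize_per: "0 < k \<Longrightarrow> per (ereal k) (periodize k W)"
proof -
  assume k: "0 < k"
  have "periodize k W (x + 2 * k) = periodize k W x" for x
  proof -
    have "(x + 2 * k - k) / (2 * k) = (x - k) / (2 * k) + 1" using k by (simp add: field_simps)
    then have "\<lceil>(x + 2 * k - k) / (2 * k)\<rceil> = \<lceil>(x - k) / (2 * k)\<rceil> + 1" by simp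
    then show ?thesis by (simp only: periodize_def) (simp add: algebra_simps)
  qed
  then show ?thesis by (simp add: per_def)
qed

lemma periodize_measurable [measurable]:
  assumes [measurable]: "W \<in> borel_measurable borel"
  shows "periodize k W \<in> borel_measurable borel"
  unfolding periodize_def[abs_def] by measurable

text \<open>The range exceeds the cell by half a window on both sides, so that averages at points of
  the cell agree too. On the excess both functions vanish, since \<open>R + 1 <= k\<close> leaves a
  margin of 1 between the support and the ends of the cell.\<close>

lemma periodize_eq_trunc:
  assumes k: "1 \<le> R" "R + 1 \<le> k" and x: "- k - 1/2 \<le> x" "x \<le> k + 1/2"
  shows "periodize k (trunc R W) x = trunc R W x"
proof -
  have k0: "0 < k" using k by simp
  consider "- k < x" "x \<le> k" | "k < x" | "x \<le> - k" by linarith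
  then show ?thesis
  proof cases
    case 1
    then have "\<lceil>(x - k) / (2 * k)\<rceil> = 0" using k0 by (intro ceiling_unique) (auto simp: field_simps)
    then show ?thesis by (simp add: periodize_def)
  next
    case 2
    then have "\<lceil>(x - k) / (2 * k)\<rceil> = 1" using k0 x k by (intro ceiling_unique) (auto simp: field_simps)
    then show ?thesis using 2 x k by (auto simp: periodize_def trunc_def indicator_def)
  next
    case 3
    then have "\<lceil>(x - k) / (2 * k)\<rceil> = - 1" using k0 x k by (intro ceiling_unique) (auto simp: field_simps)
    then show ?thesis using 3 x k by (auto simp: periodize_def trunc_def indicator_def)
  qed
qed

lemma integral_mu_support:
  fixes f :: "real \<Rightarrow> real"
  assumes "\<And>x. x \<notin> {-k<..k} \<Longrightarrow> f x = 0"
  shows "(\<integral>x. f x \<partial>mu (ereal k)) = (\<integral>x. f x \<partial>lborel)"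
  unfolding set_lebesgue_integral_mu[symmetric] set_lebesgue_integral_def IK_ereal
  using assms by (intro Bochner_Integration.integral_cong) (auto simp: indicator_def)

lemma periodize_trunc:
  assumes k: "1 \<le> R" "R + 1 \<le> k" and W: "L2 \<infinity> W"
  shows "L2 (ereal k) (periodize k (trunc R W))"
    and "nsq (ereal k) (periodize k (trunc R W)) = nsq \<infinity> (trunc R W)"
    and "0 < r \<Longrightarrow> QK r (ereal k) (periodize k (trunc R W)) = QK r \<infinity> (trunc R W)"
proof -
  note T = trunc_L2(1)[OF W, of R]
  note [measurable] = L2D(1)[OF T]
  have eq: "periodize k (trunc R W) x = trunc R W x" if "x \<in> {-k<..k}" for x
    using that k by (intro periodize_eq_trunc) auto
  have cong: "integrable (mu (ereal k)) (\<lambda>x. (periodize k (trunc R W) x)\<^sup>2)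
      \<longleftrightarrow> integrable (mu (ereal k)) (\<lambda>x. (trunc R W x)\<^sup>2)"
    by (intro Bochner_Integration.integrable_cong refl) (simp add: eq)
  have "integrable lborel (\<lambda>x. (trunc R W x)\<^sup>2)" using L2D(3)[OF T] by (simp add: mu_PInf)
  then have "integrable (mu (ereal k)) (\<lambda>x. (trunc R W x)\<^sup>2)"
    unfolding set_integrable_mu[symmetric] set_integrable_def
    by (intro integrable_mult_indicator) auto
  then show "L2 (ereal k) (periodize k (trunc R W))"
    using k periodize_per[of k] cong by (simp add: L2_def)
  have "nsq (ereal k) (periodize k (trunc R W)) = (\<integral>x. (trunc R W x)\<^sup>2 \<partial>mu (ereal k))"
    unfolding nsq_def by (intro Bochner_Integration.integral_cong refl) (simp add: eq)
  also have "\<dots> = nsq \<infinity> (trunc R W)"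
    unfolding nsq_PInf using k by (intro integral_mu_support) (auto simp: trunc_def indicator_def)
  finally show "nsq (ereal k) (periodize k (trunc R W)) = nsq \<infinity> (trunc R W)" .
  assume r: "0 < r"
  have "avgop (periodize k (trunc R W)) x = avgop (trunc R W) x" if "x \<in> {-k<..k}" for x
    unfolding avgop_win using that k
    by (intro Bochner_Integration.integral_cong refl periodize_eq_trunc) auto
  then have "QK r (ereal k) (periodize k (trunc R W)) = (\<integral>x. \<bar>avgop (trunc R W) x\<bar> powr r \<partial>mu (ereal k))"
    unfolding QK_mu by (intro Bochner_Integration.integral_cong refl) simp
  also have "\<dots> = QK r \<infinity> (trunc R W)"
    unfolding QK_mu mu_PInf using k r
    by (intro integral_mu_support) (auto simp: avgop_trunc_outside)
  finally show "QK r (ereal k) (periodize k (trunc R W)) = QK r \<infinity> (trunc R W)" .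
qed

section \<open>Finite and infinite period compared; the constraint for solutions on the line\<close>

context ground_wave
begin

text \<open>The test function is the indicator of an interval of length 2. Its average has compact
  support, which settles the exponent \<open>q\<close>, and equals 1 on an interval of length 1,
  which makes \<open>QK p\<close> positive.\<close>

lemma MK_nonempty_infinite: "MK p q s2 \<infinity> \<noteq> {}"
proof (rule MK_nonempty_of_QK_pos[OF one_le_PInf])
  define T where "T = (\<lambda>x. indicator {-1<..1::real} x :: real)"
  have T: "T = trunc 1 (\<lambda>x. 1)" by (simp add: T_def trunc_def[abs_def])
  have TL: "L2 \<infinity> T" by (simp add: L2_def T_def mu_PInf power2_eq_square flip: indicator_inter_arith)
  note [measurable] = L2D(1)[OF TL]
  have TB: "\<bar>avgop T x\<bar> \<le> 1" for x
  proof -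
    have "\<bar>avgop T x\<bar> \<le> (\<integral>s. \<bar>T (x + s)\<bar> \<partial>win)" unfolding avgop_win by simp
    also have "\<dots> \<le> (\<integral>s. 1 \<partial>win)"
      using L2_win(3)[OF TL one_le_PInf] by (intro integral_mono integrable_abs) (auto simp: T_def indicator_def)
    finally show ?thesis by simp
  qed
  have "integrable lborel (\<lambda>x. \<bar>avgop T x\<bar> powr q)"
  proof (rule Bochner_Integration.integrable_bound)
    show "integrable lborel (indicator {-3/2..3/2} :: real \<Rightarrow> real)" by simp
    show "AE x in lborel. norm (\<bar>avgop T x\<bar> powr q) \<le> norm (indicator {-3/2..3/2} x :: real)"
    proof (rule AE_I2)
      fix x :: real
      show "norm (\<bar>avgop T x\<bar> powr q) \<le> norm (indicator {-3/2..3/2} x :: real)"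
      proof (cases "x \<in> {-3/2..3/2}")
        case True
        then show ?thesis using powr_mono2[of q "\<bar>avgop T x\<bar>" 1] TB[of x] q1 by simp
      next
        case False
        then have "avgop T x = 0" unfolding T by (intro avgop_trunc_outside) auto
        then show ?thesis by simp
      qed
    qed
  qed measurable
  then show "X \<infinity> T" using TL by (simp add: X_def mu_PInf)
  have "1 = (\<integral>x. indicator {-1/2<..<1/2::real} x \<partial>lborel :: real)" by simp
  also have "\<dots> \<le> QK p \<infinity> T"
    unfolding QK_mu mu_PInf
  proof (rule integral_mono)
    show "integrable lborel (indicator {-1/2<..<1/2} :: real \<Rightarrow> real)" by simp
    show "integrable lborel (\<lambda>x. \<bar>avgop T x\<bar> powr p)"
      using avgop_powr_integrable[OF TL one_le_PInf] p2 by (simp add: mu_PInf)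
    show "indicator {-1/2<..<1/2} x \<le> \<bar>avgop T x\<bar> powr p" for x
    proof (cases "x \<in> {-1/2<..<1/2}")
      case True
      then have "avgop T x = avgop (\<lambda>x. 1) x" unfolding T by (intro avgop_trunc_inside) auto
      then have "avgop T x = 1" by (simp add: avgop_win)
      then show ?thesis by simp
    qed simp
  qed
  finally show "0 < QK p \<infinity> T" by simp
qed

lemma FK_neg_scaled:
  assumes "FK p q s2 K W = 0" "0 < nsq K W" "1 < t"
  shows "FK p q s2 K (\<lambda>x. t * W x) < 0"
proof -
  define a b where "a = s2 * nsq K W" and "b = q * QK q K W"
  have ab: "0 < a" "0 \<le> b" using assms s2 q1 by (simp_all add: a_def b_def)
  have P: "p * QK p K W = a + b" using assms(1) by (simp add: FK_eq a_def b_def)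
  have "m a b t < m a b 1" using ab assms(3) by (intro m_strict_antimono) auto
  then have "m a b t < a + b" by (simp add: m_def)
  moreover have "t\<^sup>2 * a + t powr q * b = t powr p * m a b t"
    using m_eq_iff[of t a b "m a b t"] assms(3) by simp
  moreover have "0 < t powr p" using assms(3) by simp
  ultimately have "t\<^sup>2 * a + t powr q * b < t powr p * (a + b)"
    by (simp add: mult_strict_left_mono)
  then show ?thesis using assms(3) by (simp add: FK_cmult P flip: a_def b_def)
qed

text \<open>A near-minimizer on the line is first scaled by some \<open>t > 1\<close>, which makes
  \<open>FK\<close> strictly negative at small cost in \<open>J\<close>. Strict inequalities survive
  truncation at a large radius, and periodizing the truncated function preserves its functionals on
  every cell that contains the support with margin 1.\<close>

lemma ellK_limsup:
  assumes e: "0 < e"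
  shows "\<exists>k0\<ge>1. \<forall>k\<ge>k0. ellK p q s2 (ereal k) < ellK p q s2 \<infinity> + e"
proof -
  define l where "l = ellK p q s2 \<infinity>"
  have "Inf (LK p q s2 \<infinity> ` MK p q s2 \<infinity>) < l + e" using e by (simp add: l_def ellK_def)
  then obtain W where W: "W \<in> MK p q s2 \<infinity>" "LK p q s2 \<infinity> W < l + e"
    using cInf_lessD[of "LK p q s2 \<infinity> ` MK p q s2 \<infinity>"] MK_nonempty_infinite by blast
  have WD: "X \<infinity> W" "0 < nsq \<infinity> W" "FK p q s2 \<infinity> W = 0" using W(1) by (auto simp: MK_iff)
  have WJ: "J \<infinity> W < l + e" using W(2) LK_eq_J[OF WD(3)] by simp
  have "((\<lambda>t. (1/2 - 1/p) * s2 * (t\<^sup>2 * nsq \<infinity> W) + (1 - q/p) * (t powr q * QK q \<infinity> W)) \<longlongrightarrow>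
      (1/2 - 1/p) * s2 * (1\<^sup>2 * nsq \<infinity> W) + (1 - q/p) * (1 powr q * QK q \<infinity> W)) (at_right 1)"
    by (intro tendsto_intros) auto
  then have "((\<lambda>t. (1/2 - 1/p) * s2 * (t\<^sup>2 * nsq \<infinity> W) + (1 - q/p) * (t powr q * QK q \<infinity> W)) \<longlongrightarrow> J \<infinity> W) (at_right 1)"
    by (simp add: J_def)
  from order_tendstoD(2)[OF this WJ]
  have "\<forall>\<^sub>F t in at_right 1. J \<infinity> (\<lambda>x. t * W x) < l + e"
    using eventually_at_right_less[of "1::real"]
    by eventually_elim (simp add: J_def nsq_cmult QK_cmult)
  then have "\<forall>\<^sub>F t in at_right 1. J \<infinity> (\<lambda>x. t * W x) < l + e \<and> 1 < t"
    using eventually_at_right_less[of "1::real"] by eventually_elim simp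
  then obtain t where t: "1 < t" "J \<infinity> (\<lambda>x. t * W x) < l + e"
    using eventually_happens'[OF trivial_limit_at_right_real] by blast
  define V where "V = (\<lambda>x. t * W x)"
  have VX: "X \<infinity> V" unfolding V_def by (rule X_cmult[OF WD(1)])
  then have VL: "L2 \<infinity> V" by (simp add: X_def)
  have VF: "FK p q s2 \<infinity> V < 0" unfolding V_def by (rule FK_neg_scaled[OF WD(3,2) t(1)])
  have VJ: "J \<infinity> V < l + e" using t(2) by (simp add: V_def)
  define d where "d n = sqrt (nsq \<infinity> (tail (real n) V))" for n
  have d0: "d \<longlonglongrightarrow> 0" unfolding d_def by (rule tail_tendsto[OF VL])
  have dq: "(\<lambda>n. d n powr q) \<longlonglongrightarrow> 0"
    using powr_abs_tendsto[OF d0, of q] q1 by (simp add: d_def)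
  \<comment> \<open>A convergent lower bound for \<open>QK p\<close> of the truncation, which is the
    direction required for \<open>FK < 0\<close>.\<close>
  define Pn where "Pn n = (\<integral>x. indicator {x. \<bar>x\<bar> < real n - 1/2} x * \<bar>avgop V x\<bar> powr p \<partial>lborel)" for n
  have Pn: "Pn \<longlonglongrightarrow> QK p \<infinity> V"
    unfolding Pn_def QK_mu mu_PInf using avgop_powr_integrable[OF VL one_le_PInf, of p] p2
    by (intro inner_tendsto) (simp add: mu_PInf)
  have "(\<lambda>n. s2 * nsq \<infinity> V + q * (QK q \<infinity> V + 2 * d n powr q) - p * Pn n)
      \<longlonglongrightarrow> s2 * nsq \<infinity> V + q * (QK q \<infinity> V + 2 * 0) - p * QK p \<infinity> V"
    by (intro tendsto_intros dq Pn)
  then have e1: "\<forall>\<^sub>F n in sequentially. s2 * nsq \<infinity> V + q * (QK q \<infinity> V + 2 * d n powr q) - p * Pn n < 0"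
    using VF by (intro order_tendstoD(2)) (auto simp: FK_eq)
  have "(\<lambda>n. J \<infinity> V + (1 - q/p) * (2 * d n powr q)) \<longlonglongrightarrow> J \<infinity> V + (1 - q/p) * (2 * 0)"
    by (intro tendsto_intros dq)
  then have e2: "\<forall>\<^sub>F n in sequentially. J \<infinity> V + (1 - q/p) * (2 * d n powr q) < l + e"
    using VJ by (intro order_tendstoD(2)) auto
  have e3: "\<forall>\<^sub>F n in sequentially. 1 \<le> real n" by real_asymp
  from eventually_happens'[OF _ eventually_conj[OF e1 eventually_conj[OF e2 e3]]]
  obtain n where n: "s2 * nsq \<infinity> V + q * (QK q \<infinity> V + 2 * d n powr q) - p * Pn n < 0"
    "J \<infinity> V + (1 - q/p) * (2 * d n powr q) < l + e" "1 \<le> real n" by auto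
  define T where "T = trunc (real n) V"
  have TL: "L2 \<infinity> T" and Tn: "nsq \<infinity> T \<le> nsq \<infinity> V" using trunc_L2[OF VL] by (simp_all add: T_def)
  have TQ: "QK q \<infinity> T \<le> QK q \<infinity> V + 2 * d n powr q"
    using trunc_QK_le(2)[OF VL, of q "real n"] VX q1 by (simp add: T_def d_def X_def)
  have TP: "Pn n \<le> QK p \<infinity> T" using trunc_QK_ge[OF VL, of p "real n"] p2 by (simp add: Pn_def T_def)
  have "s2 * nsq \<infinity> T \<le> s2 * nsq \<infinity> V" "q * QK q \<infinity> T \<le> q * (QK q \<infinity> V + 2 * d n powr q)"
    "p * Pn n \<le> p * QK p \<infinity> T"
    using Tn TQ TP s2 q1 p2 by (auto intro!: mult_left_mono simp del: distrib_left)
  then have TF: "FK p q s2 \<infinity> T < 0" unfolding FK_eq using n(1) by linarith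
  have TJ: "J \<infinity> T < l + e"
  proof -
    have "(1/2 - 1/p) * s2 * nsq \<infinity> T \<le> (1/2 - 1/p) * s2 * nsq \<infinity> V"
      using Tn coeff_pos s2 by (intro mult_left_mono) auto
    moreover have "(1 - q/p) * QK q \<infinity> T \<le> (1 - q/p) * QK q \<infinity> V + (1 - q/p) * (2 * d n powr q)"
      using mult_left_mono[OF TQ, of "1 - q/p"] coeff_pos by (simp add: distrib_left)
    ultimately show ?thesis using n(2) unfolding J_def by linarith
  qed
  have "ellK p q s2 (ereal k) < l + e" if k: "real n + 1 \<le> k" for k
  proof -
    let ?U = "periodize k T"
    have k1: "1 \<le> ereal k" "1 \<le> k" using k by auto
    note U = periodize_trunc[OF n(3) k VL, folded T_def]
    have "FK p q s2 (ereal k) ?U = FK p q s2 \<infinity> T" "J (ereal k) ?U = J \<infinity> T"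
      using U(2,3) q1 p2 by (simp_all add: FK_eq J_def)
    moreover have "0 < nsq (ereal k) ?U"
      using nsq_pos_of_FK_neg[OF TL one_le_PInf TF] U(2) by simp
    ultimately have "ellK p q s2 (ereal k) \<le> J \<infinity> T"
      using ellK_le_J[of "ereal k" ?U] U(1) k1 TF by (simp add: X_finite)
    then show ?thesis using TJ by simp
  qed
  then show ?thesis unfolding l_def by (intro exI[of _ "real n + 1"]) auto
qed

text \<open>The test function has to be truncated: for \<open>q < 2\<close> it is not clear that \<open>\<Psi>\<^sub>q(\<A> W) \<cdot> \<A>\<bar>W\<bar>\<close> is
integrable, so Fubini does not apply to \<open>W\<close> itself.\<close>
lemma EL_imp_FK_zero:
  assumes X: "X \<infinity> W" and EL: "EL W"
  shows "FK p q s2 \<infinity> W = 0"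
proof -
  have WL: "L2 \<infinity> W" using X by (simp add: X_def)
  note [measurable] = L2D(1)[OF WL] L2D(1)[OF trunc_L2(1)[OF WL]]
  define d where "d n = sqrt (nsq \<infinity> (tail (real n) W))" for n
  have d0: "d \<longlonglongrightarrow> 0" unfolding d_def by (rule tail_tendsto[OF WL])
  have [measurable]: "avgop W \<in> borel_measurable borel" by measurable
  define B where "B = sqrt (nsq \<infinity> W)"
  have aB: "\<bar>avgop W x\<bar> \<le> B" for x unfolding B_def by (rule avgop_le[OF WL one_le_PInf])
  define T where "T n = trunc (real n) W" for n
  have TL: "L2 \<infinity> (T n)" for n unfolding T_def by (rule trunc_L2(1)[OF WL])
  note [measurable] = L2D(1)[OF TL]
  have Ti: "integrable lborel (T n)" for n
  proof (rule Bochner_Integration.integrable_bound)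
    show "integrable lborel (\<lambda>x. (T n x)\<^sup>2 + indicator {-real n<..real n} x)"
      using L2D(3)[OF TL[of n]] by (simp add: mu_PInf)
    have "\<bar>y\<bar> \<le> y\<^sup>2 + 1" for y :: real
      using sum_squares_bound[of "\<bar>y\<bar>" 1] zero_le_power2[of y] by simp
    then show "AE x in lborel. norm (T n x) \<le> norm ((T n x)\<^sup>2 + indicator {-real n<..real n} x)"
      by (auto intro!: AE_I2 simp: T_def trunc_def indicator_def)
  qed measurable
  define G where "G r = avgop (\<lambda>s. Psi r (avgop W s))" for r
  define I where "I r n = (\<integral>x. T n x * G r x \<partial>lborel)" for r n
  have GB: "\<bar>G r x\<bar> \<le> r * B powr (r - 1)" if r: "1 \<le> r" for r x
  proof -
    have [simp]: "(\<lambda>s. Psi r (avgop W (x + s))) \<in> borel_measurable win"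
      by (rule measurable_win) measurable
    have "integrable win (\<lambda>s. Psi r (avgop W (x + s)))"
      by (rule finite_measure.integrable_const_bound[OF finite_measure_win, of _ "r * B powr (r - 1)"])
         (use abs_Psi_le[OF r aB] in auto)
    then have "(\<integral>s. \<bar>Psi r (avgop W (x + s))\<bar> \<partial>win) \<le> (\<integral>s. r * B powr (r - 1) \<partial>win)"
      using abs_Psi_le[OF r aB] by (intro integral_mono) auto
    moreover have "\<bar>G r x\<bar> \<le> (\<integral>s. \<bar>Psi r (avgop W (x + s))\<bar> \<partial>win)" unfolding G_def avgop_win by simp
    ultimately show ?thesis by simp
  qed
  have G_meas [measurable]: "G r \<in> borel_measurable borel" for r
    unfolding G_def by measurable
  have TG: "integrable lborel (\<lambda>x. T n x * G r x)" if r: "1 \<le> r" for r n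
    by (rule Bochner_Integration.integrable_bound[OF integrable_mult_right[OF integrable_abs[OF Ti[of n]], of "r * B powr (r - 1)"]])
       (use r in \<open>auto intro!: AE_I2 mult_right_mono GB simp: abs_mult mult.commute[of "\<bar>T n _\<bar>"]\<close>)
  have I_sa: "I r n = (\<integral>x. Psi r (avgop W x) * avgop (T n) x \<partial>lborel)" if r: "1 \<le> r" for r n
    unfolding I_def G_def using avgop_selfadjoint[of "\<lambda>s. Psi r (avgop W s)" "T n" \<infinity> "r * B powr (r - 1)"]
      abs_Psi_le[OF r aB] Ti[of n] by (simp add: mu_PInf)
  \<comment> \<open>Once averaging has been moved onto \<open>T n\<close>, the integrand equals
    \<open>r * |avgop W x| powr r\<close> inside and 0 outside. In between \<open>Psi\<close> is
    bounded by \<open>C\<close>, the average of \<open>T n\<close> by \<open>d n\<close>, and the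
    mass of \<open>ann\<close> is 2.\<close>
  have I_lim: "I r \<longlonglongrightarrow> r * QK r \<infinity> W"
    if r: "1 < r" and i: "integrable (mu \<infinity>) (\<lambda>x. \<bar>avgop W x\<bar> powr r)" for r
  proof -
    have i': "integrable lborel (\<lambda>x. r * \<bar>avgop W x\<bar> powr r)" using i by (simp add: mu_PInf)
    define In where "In n = (\<integral>x. indicator {x. \<bar>x\<bar> < real n - 1/2} x * (r * \<bar>avgop W x\<bar> powr r) \<partial>lborel)" for n
    have "In \<longlonglongrightarrow> (\<integral>x. r * \<bar>avgop W x\<bar> powr r \<partial>lborel)"
      unfolding In_def by (rule inner_tendsto[OF i'])
    then have In: "In \<longlonglongrightarrow> r * QK r \<infinity> W" by (simp add: QK_mu mu_PInf)
    define C where "C = r * B powr (r - 1)"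
    have C: "0 \<le> C" using r by (simp add: C_def)
    have diff: "norm (I r n - In n) \<le> 2 * C * d n" for n
    proof -
      let ?f = "\<lambda>x. Psi r (avgop W x) * avgop (T n) x"
      let ?g = "\<lambda>x. indicator {x. \<bar>x\<bar> < real n - 1/2} x * (r * \<bar>avgop W x\<bar> powr r)"
      let ?h = "\<lambda>x. ann (real n) x * (C * d n)"
      have ig: "integrable lborel ?g"
        by (rule Bochner_Integration.integrable_bound[OF i']) (auto simp: indicator_def)
      have ih: "integrable lborel ?h" using ann_integral by simp
      have pw: "\<bar>?f x - ?g x\<bar> \<le> ?h x" for x
      proof -
        consider "\<bar>x\<bar> < real n - 1/2" | "real n - 1/2 \<le> \<bar>x\<bar>" "\<bar>x\<bar> \<le> real n + 1/2" | "real n + 1/2 < \<bar>x\<bar>" by linarith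
        then show ?thesis
        proof cases
          case 1
          then have "?f x = ?g x" using r by (simp add: T_def avgop_trunc_inside Psi_mult_self)
          then show ?thesis using C by (simp add: d_def)
        next
          case 2
          have "\<bar>?f x - ?g x\<bar> = \<bar>Psi r (avgop W x)\<bar> * \<bar>avgop (T n) x\<bar>" using 2 by (simp add: abs_mult)
          also have "\<dots> \<le> C * d n"
            using abs_Psi_le[OF _ aB, of r x] avgop_trunc_boundary[OF WL 2(1)] r C
            by (intro mult_mono) (auto simp: C_def d_def T_def)
          also have "\<dots> \<le> ?h x"
            using mult_right_mono[OF ann_ge_1[OF 2], of "C * d n"] C by (simp add: d_def)
          finally show ?thesis .
        next
          case 3
          then show ?thesis using C by (simp add: T_def avgop_trunc_outside d_def)
        qed
      qed
      have id: "integrable lborel (\<lambda>x. ?f x - ?g x)"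
        by (rule Bochner_Integration.integrable_bound[OF ih]) (use pw in \<open>auto intro!: AE_I2 order_trans[OF pw]\<close>)
      have if': "integrable lborel ?f" using Bochner_Integration.integrable_add[OF id ig] by simp
      have "norm (I r n - In n) = \<bar>\<integral>x. ?f x - ?g x \<partial>lborel\<bar>"
        using if' ig r by (simp add: I_sa In_def)
      also have "\<dots> \<le> (\<integral>x. \<bar>?f x - ?g x\<bar> \<partial>lborel)" by (rule integral_abs_bound)
      also have "\<dots> \<le> (\<integral>x. ?h x \<partial>lborel)"
        using id ih pw by (intro integral_mono integrable_abs) auto
      also have "\<dots> = 2 * C * d n" using ann_integral by simp
      finally show ?thesis .
    qed
    have "(\<lambda>n. 2 * C * d n) \<longlonglongrightarrow> 0" by (rule tendsto_mult_right_zero[OF d0])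
    then have "(\<lambda>n. I r n - In n) \<longlonglongrightarrow> 0"
      by (rule Lim_null_comparison[OF always_eventually[OF allI[OF diff]]])
    from tendsto_add[OF this In] show ?thesis by simp
  qed
  have WT: "(\<lambda>n. \<integral>x. T n x * W x \<partial>lborel) \<longlonglongrightarrow> nsq \<infinity> W"
    unfolding nsq_PInf
  proof (rule integral_dominated_convergence)
    show "integrable lborel (\<lambda>x. (W x)\<^sup>2)" using L2D(3)[OF WL] by (simp add: mu_PInf)
    show "AE x in lborel. (\<lambda>n. T n x * W x) \<longlonglongrightarrow> (W x)\<^sup>2"
    proof (intro AE_I2 tendsto_eventually)
      fix x :: real
      have "\<forall>\<^sub>F n in sequentially. \<bar>x\<bar> < real n" by real_asymp
      then show "\<forall>\<^sub>F n in sequentially. T n x * W x = (W x)\<^sup>2"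
        by eventually_elim (auto simp: T_def trunc_def indicator_def power2_eq_square)
    qed
    show "AE x in lborel. norm (T n x * W x) \<le> (W x)\<^sup>2" for n
      by (auto intro!: AE_I2 simp: T_def trunc_def indicator_def power2_eq_square)
  qed measurable
  have TWi: "integrable lborel (\<lambda>x. T n x * W x)" for n
    using integrable_mult_sq[of "T n" lborel W] L2D[OF TL[of n]] L2D[OF WL] by (simp add: mu_PInf)
  have "s2 * (\<integral>x. T n x * W x \<partial>lborel) + I q n = I p n" for n
  proof -
    have "s2 * (\<integral>x. T n x * W x \<partial>lborel) + I q n = (\<integral>x. s2 * (T n x * W x) + T n x * G q x \<partial>lborel)"
      using TWi TG q1 by (simp add: I_def)
    also have "\<dots> = (\<integral>x. T n x * (s2 * W x + G q x) \<partial>lborel)" by (simp add: algebra_simps)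
    also have "\<dots> = I p n" using EL by (simp add: EL_def G_def I_def)
    finally show ?thesis .
  qed
  moreover have "(\<lambda>n. s2 * (\<integral>x. T n x * W x \<partial>lborel) + I q n) \<longlonglongrightarrow> s2 * nsq \<infinity> W + q * QK q \<infinity> W"
    using X q1 by (intro tendsto_intros WT I_lim) (auto simp: X_def)
  moreover have "I p \<longlonglongrightarrow> p * QK p \<infinity> W"
    using p2 avgop_powr_integrable[OF WL one_le_PInf] by (intro I_lim) auto
  ultimately have "s2 * nsq \<infinity> W + q * QK q \<infinity> W = p * QK p \<infinity> W"
    by (simp add: LIMSEQ_unique)
  then show ?thesis by (simp add: FK_eq)
qed

end

section \<open>The limit of large periods\<close>

context ground_wave
begin

lemma ground_wave_compactness:
  fixes k :: "nat \<Rightarrow> real"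
  assumes k1: "\<And>n. 1 \<le> k n" and k: "filterlim k at_top sequentially"
  obtains r U V where "strict_mono (r :: nat \<Rightarrow> nat)" "\<And>n. is_minimizer p q s2 (ereal (k (r n))) (U n)"
    "is_minimizer p q s2 \<infinity> V" "EL V" "(\<lambda>n. ellK p q s2 (ereal (k (r n)))) \<longlonglongrightarrow> ellK p q s2 \<infinity>"
    "(\<lambda>n. \<integral>x. (V x - (if x \<in> IK (ereal (k (r n))) then U n x else 0))\<^sup>2 \<partial>lborel) \<longlonglongrightarrow> 0"
proof -
  define l where "l = ellK p q s2 \<infinity>"
  define E where "E n = ellK p q s2 (ereal (k n))" for n
  define c1 where "c1 = (1/2 - 1/p) * s2"
  define c2 where "c2 = 1 - q/p"
  have c1: "0 < c1" and c2: "0 < c2" using coeff_pos s2 by (auto simp: c1_def c2_def)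
  have Jc: "J K W = c1 * nsq K W + c2 * QK q K W" for K W by (simp add: J_def c1_def c2_def)
  have Kn: "1 \<le> ereal (k n)" for n using k1 by simp
  have E0: "0 \<le> E n" for n unfolding E_def by (rule ellK_nonneg[OF Kn MK_nonempty_finite[OF k1]])
  have Elim: "\<forall>\<^sub>F n in sequentially. E n < l + e" if e: "0 < e" for e
  proof -
    obtain k0 where k0: "\<And>k. k0 \<le> k \<Longrightarrow> ellK p q s2 (ereal k) < l + e"
      using ellK_limsup[OF e] l_def by blast
    have "\<forall>\<^sub>F n in sequentially. k0 \<le> k n" using k by (simp add: filterlim_at_top)
    then show ?thesis by eventually_elim (simp add: E_def k0)
  qed
  obtain N where N: "\<And>n. N \<le> n \<Longrightarrow> E n < l + 1"
    using Elim[of 1] by (auto simp: eventually_sequentially)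
  have "Bseq (\<lambda>n. E (n + N))"
    by (rule BseqI'[of _ "l + 1"]) (use N E0 in \<open>auto intro: less_imp_le\<close>)
  then have "Bseq E" by (rule Bseq_offset)
  then obtain B0 where B0: "\<And>n. norm (E n) \<le> B0" by (auto simp: Bseq_def)
  \<comment> \<open>Bolzano-Weierstrass, obtained as the diagonal principle on a one-point
    set.\<close>
  obtain r1 :: "nat \<Rightarrow> nat" and L where r1: "strict_mono r1" "(\<lambda>n. E (r1 n)) \<longlonglongrightarrow> L"
    using function_convergent_subsequence[of "{()}" "\<lambda>n _. E n" B0] B0
    by (metis countable_finite finite.emptyI finite.insertI singletonI)
  have "L \<le> l"
  proof (rule field_le_epsilon)
    fix e :: real assume "0 < e"
    from eventually_subseq[OF r1(1) Elim[OF this]]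
    show "L \<le> l + e" by (intro tendsto_upperbound[OF r1(2)]) (auto elim: eventually_mono)
  qed
  obtain W where W: "\<And>n. is_minimizer p q s2 (ereal (k n)) (W n)" "\<And>n. EL (W n)"
      "\<And>n. cmin / 2 \<le> \<bar>avgop (W n) 0\<bar>"
  proof -
    have "\<exists>W. is_minimizer p q s2 (ereal (k n)) W \<and> EL W \<and> cmin / 2 \<le> \<bar>avgop W 0\<bar>" for n
      using minimizer_EL_centred[OF k1] by blast
    then show thesis using that by metis
  qed
  note WD = is_minimizerD[OF W(1) Kn]
  have WL: "L2 (ereal (k n)) (W n)" for n using WD(1) by (simp add: X_def)
  have WB: "nsq (ereal (k n)) (W n) \<le> B0 / c1" for n
  proof -
    have "nsq (ereal (k n)) (W n) \<le> E n / c1" using nsq_le_J[of "ereal (k n)" "W n"] WD(5)[of n] by (simp add: c1_def E_def)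
    also have "\<dots> \<le> B0 / c1" using B0[of n] c1 by (intro divide_right_mono) auto
    finally show ?thesis .
  qed
  obtain r2 :: "nat \<Rightarrow> nat" where r2: "strict_mono r2" "\<And>x. convergent (\<lambda>n. avgop (W (r1 (r2 n))) x)"
    using avgop_convergent_subseq[of "\<lambda>n. ereal (k (r1 n))" "\<lambda>n. W (r1 n)" "B0 / c1", OF WL Kn WB] by metis
  define r where "r n = r1 (r2 n)" for n
  have r: "strict_mono r" using strict_mono_o[OF r1(1) r2(1)] by (simp add: r_def[abs_def] o_def)
  have rE: "(\<lambda>n. E (r n)) \<longlonglongrightarrow> L" using LIMSEQ_subseq_LIMSEQ[OF r1(2) r2(1)] by (simp add: o_def r_def)
  define U where "U n = W (r n)" for n
  define \<kappa> where "\<kappa> n = k (r n)" for n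
  have \<kappa>: "filterlim \<kappa> at_top sequentially"
    unfolding \<kappa>_def by (rule filterlim_compose[OF k filterlim_subseq[OF r]])
  have \<kappa>1: "1 \<le> ereal (\<kappa> n)" for n using k1 by (simp add: \<kappa>_def)
  have UL: "L2 (ereal (\<kappa> n)) (U n)" and UEL: "EL (U n)" for n by (simp_all add: U_def \<kappa>_def WL W(2))
  have UJ: "J (ereal (\<kappa> n)) (U n) = E (r n)" for n using WD(5) by (simp add: U_def \<kappa>_def E_def)
  note [measurable] = L2D(1)[OF UL]
  have [measurable]: "avgop (U n) \<in> borel_measurable borel" for n by measurable
  define b where "b = sqrt (B0 / c1)"
  have ab: "\<bar>avgop (U n) x\<bar> \<le> b" for n x
    using avgop_le[OF WL Kn, of "r n" x] WB[of "r n"] unfolding U_def b_def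
    by (meson order_trans real_sqrt_le_mono)
  define v where "v x = lim (\<lambda>n. avgop (U n) x)" for x
  have v: "(\<lambda>n. avgop (U n) x) \<longlonglongrightarrow> v x" for x
    using r2(2)[of x] by (simp add: v_def U_def r_def convergent_LIMSEQ_iff)
  have [measurable]: "v \<in> borel_measurable borel"
    by (rule borel_measurable_LIMSEQ_real[OF v]) simp
  define G where "G r n = avgop (\<lambda>s. Psi r (avgop (U n) s))" for r n
  \<comment> \<open>Each value of \<open>G\<close> involves the averages on a single unit window
    only, so a constant dominates although the cells grow.\<close>
  have Gl: "(\<lambda>n. G r n x) \<longlonglongrightarrow> avgop (\<lambda>s. Psi r (v s)) x" if r: "1 < r" for r x
    unfolding G_def avgop_win[where W="\<lambda>s. Psi r (avgop (U n) s)" for n] avgop_win[where W="\<lambda>s. Psi r (v s)"]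
  proof (rule integral_dominated_convergence)
    show "(\<lambda>s. Psi r (v (x + s))) \<in> borel_measurable win" by (rule measurable_win) measurable
    show "(\<lambda>s. Psi r (avgop (U n) (x + s))) \<in> borel_measurable win" for n by (rule measurable_win) measurable
    show "integrable win (\<lambda>s. r * b powr (r - 1))" by simp
    show "AE s in win. (\<lambda>n. Psi r (avgop (U n) (x + s))) \<longlonglongrightarrow> Psi r (v (x + s))"
      using r by (intro AE_I2 Psi_tendsto v)
    show "AE s in win. norm (Psi r (avgop (U n) (x + s))) \<le> r * b powr (r - 1)" for n
      using abs_Psi_le[OF _ ab, of r n] r by (intro AE_I2) simp
  qed
  have GB: "\<bar>G r n x\<bar> \<le> r * b powr (r - 1)" if r: "1 \<le> r" for r n x
  proof -
    have [simp]: "(\<lambda>s. Psi r (avgop (U n) (x + s))) \<in> borel_measurable win" by (rule measurable_win) measurable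
    have "integrable win (\<lambda>s. Psi r (avgop (U n) (x + s)))"
      by (rule finite_measure.integrable_const_bound[OF finite_measure_win, of _ "r * b powr (r - 1)"])
         (use abs_Psi_le[OF r ab] in auto)
    then have "(\<integral>s. \<bar>Psi r (avgop (U n) (x + s))\<bar> \<partial>win) \<le> (\<integral>s. r * b powr (r - 1) \<partial>win)"
      using abs_Psi_le[OF r ab] by (intro integral_mono) auto
    moreover have "\<bar>G r n x\<bar> \<le> (\<integral>s. \<bar>Psi r (avgop (U n) (x + s))\<bar> \<partial>win)" unfolding G_def avgop_win by simp
    ultimately show ?thesis by simp
  qed
  have UG: "U n x = (G p n x - G q n x) / s2" for n x
    using UEL[of n] s2 unfolding EL_def G_def by (simp add: field_simps)
  define V where "V x = (avgop (\<lambda>s. Psi p (v s)) x - avgop (\<lambda>s. Psi q (v s)) x) / s2" for x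
  have UV: "(\<lambda>n. U n x) \<longlonglongrightarrow> V x" for x
    unfolding UG V_def using p2 q1 s2 by (intro tendsto_intros Gl) auto
  define C where "C = (p * b powr (p - 1) + q * b powr (q - 1)) / s2"
  have UC: "\<bar>U n x\<bar> \<le> C" for n x
  proof -
    have "\<bar>G p n x - G q n x\<bar> \<le> p * b powr (p - 1) + q * b powr (q - 1)"
      using GB[of p n x] GB[of q n x] p2 q1 by (intro order_trans[OF abs_triangle_ineq4] add_mono) auto
    then show ?thesis unfolding UG C_def using s2 by (simp add: divide_right_mono)
  qed
  have [measurable]: "V \<in> borel_measurable borel"
    by (rule borel_measurable_LIMSEQ_real[OF UV]) simp
  \<comment> \<open>The limit of the averages is the average of the limit, which turns the formula
    defining \<open>V\<close> into the equation for \<open>V\<close>.\<close>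
  have vV: "v = avgop V"
  proof
    fix x
    have "(\<lambda>n. avgop (U n) x) \<longlonglongrightarrow> avgop V x"
      unfolding avgop_win
    proof (rule integral_dominated_convergence)
      show "(\<lambda>s. V (x + s)) \<in> borel_measurable win" by (rule measurable_win) measurable
      show "(\<lambda>s. U n (x + s)) \<in> borel_measurable win" for n by (rule measurable_win) measurable
      show "integrable win (\<lambda>s. C)" by simp
      show "AE s in win. norm (U n (x + s)) \<le> C" for n using UC by simp
    qed (use UV in auto)
    then show "v x = avgop V x" using LIMSEQ_unique[OF v] by blast
  qed
  have ELV: "EL V" unfolding EL_def using s2 by (simp add: V_def vV)
  \<comment> \<open>The density of \<open>J\<close>, cut off at the cell, so that waves of different
    periods become functions on one measure space.\<close>
  define f where "f n x = indicator {-\<kappa> n<..\<kappa> n} x * (c1 * (U n x)\<^sup>2 + c2 * \<bar>avgop (U n) x\<bar> powr q)" for n x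
  define f0 where "f0 x = c1 * (V x)\<^sup>2 + c2 * \<bar>avgop V x\<bar> powr q" for x
  have [measurable]: "f n \<in> borel_measurable borel" "f0 \<in> borel_measurable borel" for n
    unfolding f_def[abs_def] f0_def[abs_def] by measurable
  have UX: "integrable (mu (ereal (\<kappa> n))) (\<lambda>x. \<bar>avgop (U n) x\<bar> powr q)" for n
    using WD(1)[of "r n"] by (simp add: X_def U_def \<kappa>_def)
  have fi: "integrable lborel (f n)" for n
  proof -
    have "integrable (mu (ereal (\<kappa> n))) (\<lambda>x. c1 * (U n x)\<^sup>2 + c2 * \<bar>avgop (U n) x\<bar> powr q)"
      using UX L2D(3)[OF UL] by simp
    then show ?thesis unfolding set_integrable_mu[symmetric] set_integrable_def f_def[abs_def] by simp
  qed
  have fE: "(\<integral>x. f n x \<partial>lborel) = E (r n)" for n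
  proof -
    have "(\<integral>x. f n x \<partial>lborel) = (\<integral>x. c1 * (U n x)\<^sup>2 + c2 * \<bar>avgop (U n) x\<bar> powr q \<partial>mu (ereal (\<kappa> n)))"
      unfolding set_lebesgue_integral_mu[symmetric] set_lebesgue_integral_def f_def[abs_def] by simp
    also have "\<dots> = J (ereal (\<kappa> n)) (U n)"
      using UX L2D(3)[OF UL] by (simp add: Jc nsq_def QK_mu)
    finally show ?thesis by (simp add: UJ)
  qed
  have inI: "\<forall>\<^sub>F n in sequentially. x \<in> {-\<kappa> n<..\<kappa> n}" for x
  proof -
    have "\<forall>\<^sub>F n in sequentially. \<bar>x\<bar> < \<kappa> n" using \<kappa> by (simp add: filterlim_at_top_dense)
    then show ?thesis by eventually_elim auto
  qed
  have fl: "(\<lambda>n. f n x) \<longlonglongrightarrow> f0 x" for x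
  proof -
    have "(\<lambda>n. c1 * (U n x)\<^sup>2 + c2 * \<bar>avgop (U n) x\<bar> powr q) \<longlonglongrightarrow> f0 x"
      unfolding f0_def using q1 v by (intro tendsto_intros powr_abs_tendsto UV) (auto simp: vV)
    then show ?thesis
      by (rule Lim_transform_eventually) (use inI[of x] in \<open>eventually_elim, simp add: f_def\<close>)
  qed
  have f_nn: "0 \<le> f n x" "0 \<le> f0 x" for n x using c1 c2 by (auto simp: f_def f0_def)
  have Fat: "integrable lborel f0" "(\<integral>x. f0 x \<partial>lborel) \<le> L"
    using Fatou_integral[of f lborel f0 "\<lambda>n. E (r n)" L] fi f_nn fl fE rE by simp_all
  have V2: "integrable lborel (\<lambda>x. (V x)\<^sup>2)"
    by (rule Bochner_Integration.integrable_bound[OF integrable_mult_right[OF Fat(1), of "1 / c1"]])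
       (use c1 c2 in \<open>auto simp: f0_def field_simps\<close>)
  have Vq: "integrable lborel (\<lambda>x. \<bar>avgop V x\<bar> powr q)"
    by (rule Bochner_Integration.integrable_bound[OF integrable_mult_right[OF Fat(1), of "1 / c2"]])
       (use c1 c2 in \<open>auto simp: f0_def field_simps\<close>)
  have VL: "L2 \<infinity> V" using V2 by (simp add: L2_def mu_PInf)
  have VX: "X \<infinity> V" using VL Vq by (simp add: X_def mu_PInf)
  have VJ: "J \<infinity> V = (\<integral>x. f0 x \<partial>lborel)"
    using V2 Vq by (simp add: Jc nsq_def QK_mu mu_PInf f0_def)
  have "cmin / 2 \<le> \<bar>v 0\<bar>"
    by (rule LIMSEQ_le_const[OF tendsto_rabs[OF v]]) (use W(3) in \<open>auto simp: U_def\<close>)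
  then have "0 < \<bar>avgop V 0\<bar>" using cmin_pos by (simp add: vV)
  then have Vpos: "0 < nsq \<infinity> V"
    using avgop_le[OF VL one_le_PInf, of 0] nsq_nonneg[of \<infinity> V] by (cases "nsq \<infinity> V = 0") (auto simp: less_le)
  have VF: "FK p q s2 \<infinity> V = 0" by (rule EL_imp_FK_zero[OF VX ELV])
  \<comment> \<open>This closes the chain \<open>l <= J \<infinity> V <= L <= l\<close>, whose
    middle inequality is Fatou's lemma.\<close>
  have "l \<le> J \<infinity> V" unfolding l_def using VF by (intro ellK_le_J one_le_PInf VX Vpos) simp
  then have Ll: "L = l" and If: "(\<integral>x. f0 x \<partial>lborel) = l" using Fat(2) VJ \<open>L \<le> l\<close> by auto
  have Vmin: "is_minimizer p q s2 \<infinity> V"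
    using VX Vpos VF If VJ by (intro is_minimizerI one_le_PInf) (auto simp: l_def)
  define V' where "V' n x = (if x \<in> IK (ereal (\<kappa> n)) then U n x else 0)" for n x
  have [measurable]: "V' n \<in> borel_measurable borel" for n unfolding V'_def[abs_def] by measurable
  \<comment> \<open>The 2 comes from \<open>(x - y)^2 <= 2 * x^2 + 2 * y^2\<close>, the
    \<open>c1\<close> from the fact that \<open>c1\<close> times each square is at most the
    corresponding density.\<close>
  define D where "D = 2 / c1"
  have Dp: "0 < D" using c1 by (simp add: D_def)
  have dom: "(V x - V' n x)\<^sup>2 \<le> D * (f0 x + f n x)" for n x
  proof -
    have "(V x - V' n x)\<^sup>2 \<le> 2 * (V x)\<^sup>2 + 2 * (V' n x)\<^sup>2"
      using zero_le_power2[of "V x + V' n x"] by (simp add: power2_sum power2_diff)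
    moreover have "2 * (V x)\<^sup>2 = D * (c1 * (V x)\<^sup>2)" "2 * (V' n x)\<^sup>2 = D * (c1 * (V' n x)\<^sup>2)"
      using c1 by (auto simp: D_def)
    moreover have "c1 * (V x)\<^sup>2 \<le> f0 x" "c1 * (V' n x)\<^sup>2 \<le> f n x"
      using c2 by (auto simp: f0_def f_def V'_def)
    ultimately show ?thesis using Dp mult_left_mono[of _ _ D] by (smt (verit) distrib_left)
  qed
  have V'l: "(\<lambda>n. V' n x) \<longlonglongrightarrow> V x" for x
    by (rule Lim_transform_eventually[OF UV]) (use inI[of x] in \<open>eventually_elim, simp add: V'_def\<close>)
  have Vdi: "integrable lborel (\<lambda>x. (V x - V' n x)\<^sup>2)" for n
    by (rule Bochner_Integration.integrable_bound[of lborel "\<lambda>x. D * (f0 x + f n x)"])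
       (use Fat(1) fi dom f_nn Dp in \<open>auto intro!: AE_I2\<close>)
  \<comment> \<open>Dominated convergence with the moving majorant \<open>D (f0 + f n)\<close>, whose integrals converge.\<close>
  have strong: "(\<lambda>n. \<integral>x. (V x - V' n x)\<^sup>2 \<partial>lborel) \<longlonglongrightarrow> 0"
  proof (rule ccontr)
    assume "\<not> ?thesis"
    then obtain e where e: "0 < e" "\<forall>N. \<exists>n\<ge>N. e \<le> norm ((\<integral>x. (V x - V' n x)\<^sup>2 \<partial>lborel) - 0)"
      unfolding LIMSEQ_iff by (meson not_less)
    then have "\<forall>N. \<exists>n\<ge>N. e \<le> (\<integral>x. (V x - V' n x)\<^sup>2 \<partial>lborel)" by simp
    then obtain \<phi> where \<phi>: "\<And>N. N \<le> \<phi> N" "\<And>N. e \<le> (\<integral>x. (V x - V' (\<phi> N) x)\<^sup>2 \<partial>lborel)" by metis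
    have \<phi>l: "filterlim \<phi> at_top sequentially"
      using \<phi>(1) by (auto intro: filterlim_at_top_mono[OF filterlim_ident])
    \<comment> \<open>Nonnegative by \<open>dom\<close>, so Fatou's lemma applies and would give
      \<open>2 * D * l <= 2 * D * l - e\<close>.\<close>
    define g where "g n x = D * (f0 x + f (\<phi> n) x) - (V x - V' (\<phi> n) x)\<^sup>2" for n x
    have "(\<lambda>n. g n x) \<longlonglongrightarrow> D * (f0 x + f0 x) - (V x - V x)\<^sup>2" for x
      unfolding g_def by (intro tendsto_intros filterlim_compose[OF fl \<phi>l] filterlim_compose[OF V'l \<phi>l])
    then have gl: "AE x in lborel. (\<lambda>n. g n x) \<longlonglongrightarrow> 2 * D * f0 x" by (simp add: algebra_simps)
    have gi: "integrable lborel (g n)" for n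
      unfolding g_def[abs_def] using Fat(1) fi Vdi by simp
    have gI: "(\<integral>x. g n x \<partial>lborel) \<le> D * (l + E (r (\<phi> n))) - e" for n
      unfolding g_def using Fat(1) fi Vdi If fE \<phi>(2)[of n] by simp
    have lim: "(\<lambda>n. D * (l + E (r (\<phi> n))) - e) \<longlonglongrightarrow> D * (l + l) - e"
      using filterlim_compose[OF rE \<phi>l] Ll by (intro tendsto_intros) auto
    have "(\<integral>x. 2 * D * f0 x \<partial>lborel) \<le> D * (l + l) - e"
      by (rule Fatou_integral(2)[OF _ _ gi _ gl gI lim]) (use dom in \<open>auto simp: g_def[abs_def]\<close>)
    then show False using e(1) If by simp
  qed
  show thesis
  proof (rule that[OF r])
    show "is_minimizer p q s2 (ereal (k (r n))) (U n)" for n using W(1) by (simp add: U_def)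
    show "(\<lambda>n. ellK p q s2 (ereal (k (r n)))) \<longlonglongrightarrow> ellK p q s2 \<infinity>"
      using rE by (simp add: E_def Ll l_def)
    show "(\<lambda>n. \<integral>x. (V x - (if x \<in> IK (ereal (k (r n))) then U n x else 0))\<^sup>2 \<partial>lborel) \<longlonglongrightarrow> 0"
      using strong unfolding V'_def \<kappa>_def .
  qed (rule Vmin ELV)+
qed

text \<open>If convergence failed along some sequence, a subsequence would stay away from the limit
  with all periods at least 1, and compactness would extract from it one whose levels do converge to
  the limit.\<close>

lemma ellK_tendsto: "((\<lambda>K::real. ellK p q s2 (ereal K)) \<longlongrightarrow> ellK p q s2 \<infinity>) at_top"
proof (rule tendsto_at_topI_sequentially)
  fix K :: "nat \<Rightarrow> real" assume K: "filterlim K at_top sequentially"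
  show "(\<lambda>n. ellK p q s2 (ereal (K n))) \<longlonglongrightarrow> ellK p q s2 \<infinity>"
  proof (rule ccontr)
    assume "\<not> ?thesis"
    then obtain e where e: "0 < e"
      and ex: "\<And>N. \<exists>n\<ge>N. e \<le> norm (ellK p q s2 (ereal (K n)) - ellK p q s2 \<infinity>)"
      unfolding LIMSEQ_iff by (meson not_less)
    have "\<forall>\<^sub>F n in sequentially. 1 \<le> K n" using K by (simp add: filterlim_at_top)
    then obtain N0 where N0: "\<And>n. N0 \<le> n \<Longrightarrow> 1 \<le> K n"
      unfolding eventually_sequentially by blast
    have "\<forall>N. \<exists>n\<ge>N. 1 \<le> K n \<and> e \<le> norm (ellK p q s2 (ereal (K n)) - ellK p q s2 \<infinity>)"
    proof
      fix N
      show "\<exists>n\<ge>N. 1 \<le> K n \<and> e \<le> norm (ellK p q s2 (ereal (K n)) - ellK p q s2 \<infinity>)"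
        using ex[of "max N N0"] N0 by auto
    qed
    then obtain \<phi> where \<phi>: "\<And>N. N \<le> \<phi> N" "\<And>N. 1 \<le> K (\<phi> N)"
        "\<And>N. e \<le> norm (ellK p q s2 (ereal (K (\<phi> N))) - ellK p q s2 \<infinity>)" by metis
    have "filterlim \<phi> at_top sequentially"
      using \<phi>(1) by (auto intro: filterlim_at_top_mono[OF filterlim_ident])
    from filterlim_compose[OF K this] \<phi>(2) obtain r :: "nat \<Rightarrow> nat"
      where "(\<lambda>n. ellK p q s2 (ereal (K (\<phi> (r n))))) \<longlonglongrightarrow> ellK p q s2 \<infinity>"
      using ground_wave_compactness[of "\<lambda>n. K (\<phi> n)"] by blast
    from LIMSEQ_D[OF this e] obtain n where "norm (ellK p q s2 (ereal (K (\<phi> (r n)))) - ellK p q s2 \<infinity>) < e"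
      by blast
    with \<phi>(3)[of "r n"] show False by linarith
  qed
qed

end

theorem theorem13:
  fixes p q \<sigma>2 :: real
  assumes "p > 2" and "1 < q" and "q < p" and "\<sigma>2 > 0"
  shows "(\<exists>W. is_minimizer p q \<sigma>2 \<infinity> W)
    \<and> ((\<lambda>K::real. ellK p q \<sigma>2 (ereal K)) \<longlongrightarrow> ellK p q \<sigma>2 \<infinity>) at_top
    \<and> (\<forall>Km :: nat \<Rightarrow> real. (\<forall>m. Km m > 0) \<and> filterlim Km at_top sequentially \<longrightarrow>
        (\<exists>r Wn Winf. strict_mono r
           \<and> (\<forall>n. is_minimizer p q \<sigma>2 (ereal (Km (r n))) (Wn n))
           \<and> is_minimizer p q \<sigma>2 \<infinity> Winf
           \<and> (AE \<phi> in lborel. \<sigma>2 * Winf \<phi> + avgop (\<lambda>s. Psi q (avgop Winf s)) \<phi>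
                                = avgop (\<lambda>s. Psi p (avgop Winf s)) \<phi>)
           \<and> (\<forall>n. inLr 2 UNIV (\<lambda>\<phi>. if \<phi> \<in> IK (ereal (Km (r n))) then Wn n \<phi> else 0))
           \<and> ((\<lambda>n. normLr 2 UNIV (\<lambda>\<phi>. Winf \<phi> - (if \<phi> \<in> IK (ereal (Km (r n))) then Wn n \<phi> else 0)))
                \<longlonglongrightarrow> 0)))"
proof (intro conjI allI impI)
  interpret ground_wave p q \<sigma>2 by unfold_locales (use assms in auto)
  show "\<exists>W. is_minimizer p q \<sigma>2 \<infinity> W"
  proof -
    have "filterlim (\<lambda>n. real n + 1) at_top sequentially" by real_asymp
    then show ?thesis using ground_wave_compactness[of "\<lambda>n. real n + 1"] by auto
  qed
  show "((\<lambda>K::real. ellK p q \<sigma>2 (ereal K)) \<longlongrightarrow> ellK p q \<sigma>2 \<infinity>) at_top" by (rule ellK_tendsto)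
  fix Km :: "nat \<Rightarrow> real"
  assume Km: "(\<forall>m. Km m > 0) \<and> filterlim Km at_top sequentially"
  have "\<forall>\<^sub>F n in sequentially. 1 \<le> Km n" using Km by (simp add: filterlim_at_top)
  then obtain N where N: "\<And>n. N \<le> n \<Longrightarrow> 1 \<le> Km n"
    unfolding eventually_sequentially by blast
  \<comment> \<open>Small periods may occur early in the sequence; they are skipped by the offset
    \<open>N\<close>, which the final subsequence \<open>r n + N\<close> absorbs.\<close>
  have KmN: "filterlim (\<lambda>n. Km (n + N)) at_top sequentially"
    using Km by (intro filterlim_compose[OF _ filterlim_add_const_nat_at_top]) auto
  have KmN1: "1 \<le> Km (n + N)" for n using N by simp
  obtain r :: "nat \<Rightarrow> nat" and U V where r: "strict_mono r"
    "\<And>n. is_minimizer p q \<sigma>2 (ereal (Km (r n + N))) (U n)" "is_minimizer p q \<sigma>2 \<infinity> V" "EL V"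
    "(\<lambda>n. \<integral>x. (V x - (if x \<in> IK (ereal (Km (r n + N))) then U n x else 0))\<^sup>2 \<partial>lborel) \<longlonglongrightarrow> 0"
    by (rule ground_wave_compactness[OF KmN1 KmN]) (rule that)
  have norm: "normLr 2 UNIV f = sqrt (\<integral>x. (f x)\<^sup>2 \<partial>lborel)" for f
    by (simp add: normLr_def powr_half_sqrt set_lebesgue_integral_def)
  have UL: "L2 (ereal (Km (r n + N))) (U n)" for n
    using is_minimizerD(1)[OF r(2)] N by (simp add: X_def)
  show "\<exists>r Wn Winf. strict_mono r
           \<and> (\<forall>n. is_minimizer p q \<sigma>2 (ereal (Km (r n))) (Wn n))
           \<and> is_minimizer p q \<sigma>2 \<infinity> Winf
           \<and> (AE \<phi> in lborel. \<sigma>2 * Winf \<phi> + avgop (\<lambda>s. Psi q (avgop Winf s)) \<phi>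
                                = avgop (\<lambda>s. Psi p (avgop Winf s)) \<phi>)
           \<and> (\<forall>n. inLr 2 UNIV (\<lambda>\<phi>. if \<phi> \<in> IK (ereal (Km (r n))) then Wn n \<phi> else 0))
           \<and> ((\<lambda>n. normLr 2 UNIV (\<lambda>\<phi>. Winf \<phi> - (if \<phi> \<in> IK (ereal (Km (r n))) then Wn n \<phi> else 0)))
                \<longlonglongrightarrow> 0)"
  proof (intro exI conjI allI)
    show "strict_mono (\<lambda>n. r n + N)" using r(1) by (simp add: strict_mono_def)
    show "AE \<phi> in lborel. \<sigma>2 * V \<phi> + avgop (\<lambda>s. Psi q (avgop V s)) \<phi> = avgop (\<lambda>s. Psi p (avgop V s)) \<phi>"
      using r(4) by (simp add: EL_def)
    show "(\<lambda>n. normLr 2 UNIV (\<lambda>\<phi>. V \<phi> - (if \<phi> \<in> IK (ereal (Km (r n + N))) then U n \<phi> else 0))) \<longlonglongrightarrow> 0"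
      unfolding norm using tendsto_real_sqrt[OF r(5)] by simp
    fix n
    show "is_minimizer p q \<sigma>2 (ereal (Km (r n + N))) (U n)" by (rule r(2))
    let ?V = "\<lambda>\<phi>. if \<phi> \<in> IK (ereal (Km (r n + N))) then U n \<phi> else 0"
    note [measurable] = L2D(1)[OF UL[of n]]
    have "integrable lborel (\<lambda>x. indicator (IK (ereal (Km (r n + N)))) x *\<^sub>R (U n x)\<^sup>2)"
      using L2D(3)[OF UL[of n]] unfolding set_integrable_mu[symmetric] set_integrable_def .
    also have "(\<lambda>x. indicator (IK (ereal (Km (r n + N)))) x *\<^sub>R (U n x)\<^sup>2) = (\<lambda>x. \<bar>?V x\<bar> powr 2)"
      by (auto simp: indicator_def)
    finally show "inLr 2 UNIV ?V"
      by (simp add: inLr_def set_integrable_def)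
  qed (rule r(3))
qed

end
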